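(* Let $s\in(0,1)$, let $\Psi\in B(H^s,H^{-s})$ have finite propagation, and let $\Omega,W\subset\mathbb R^n$ be non-empty open sets such that $W\cap N(\Omega,p(\Psi))_e\neq\emptyset$. If $u\in\widetilde H^s(\Omega)$ satisfies $((-\Delta)^su+\Psi u)|_W=0$, then $u\equiv0$.
   Context: $H^r=H^r(\mathbb R^n)$ is the $L^2$-based Sobolev space; $\widetilde H^s(\Omega)$ is the closure of $C^\infty_c(\Omega)$ in $H^s$. $(-\Delta)^su=\mathcal F^{-1}(|\xi|^{2s}\hat u)$. $N(A,r)=\{x:\mathrm{dist}(x,A)\le r\}$ and $A_e=\mathbb R^n\setminus\overline A$. $\Psi\in B(H^s,H^{-s})$ has finite propagation if there is $R\ge0$ with $\mathrm{spt}(\Psi u)\subseteq N(\mathrm{spt}\,u,R)$ for all $u\in H^s$; the infimum of such $R$ is the propagation $p(\Psi)$. *)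

theory Defs
  imports "HOL-Analysis.Analysis"
begin

fun Ck :: "nat \<Rightarrow> ('a::euclidean_space \<Rightarrow> complex) \<Rightarrow> bool" where
  "Ck 0 f = continuous_on UNIV f"
| "Ck (Suc k) f = ((\<forall>x. f differentiable (at x)) \<and> continuous_on UNIV f \<and>
      (\<forall>b\<in>Basis. Ck k (\<lambda>x. frechet_derivative f (at x) b)))"

definition smooth_fun :: "('a::euclidean_space \<Rightarrow> complex) \<Rightarrow> bool" where
  "smooth_fun f \<longleftrightarrow> (\<forall>k. Ck k f)"

definition csupport :: "('a::euclidean_space \<Rightarrow> complex) \<Rightarrow> 'a set" where
  "csupport f = closure {x. f x \<noteq> 0}"

definition test_fun :: "'a::euclidean_space set \<Rightarrow> ('a \<Rightarrow> complex) \<Rightarrow> bool" where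
  "test_fun U \<phi> \<longleftrightarrow> smooth_fun \<phi> \<and> compact (csupport \<phi>) \<and> csupport \<phi> \<subseteq> U"

definition ft :: "('a::euclidean_space \<Rightarrow> complex) \<Rightarrow> 'a \<Rightarrow> complex" where
  "ft f \<xi> = (LINT x|lborel. cis (- (x \<bullet> \<xi>)) * f x)"

definition ift :: "('a::euclidean_space \<Rightarrow> complex) \<Rightarrow> 'a \<Rightarrow> complex" where
  "ift g x = complex_of_real (1 / (2 * pi) ^ DIM('a)) * (LINT \<xi>|lborel. cis (x \<bullet> \<xi>) * g \<xi>)"

definition L2 :: "('a::euclidean_space \<Rightarrow> complex) \<Rightarrow> bool" where
  "L2 f \<longleftrightarrow> f \<in> borel_measurable lborel \<and> integrable lborel (\<lambda>x. (cmod (f x))\<^sup>2)"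

text \<open>g is the (distributional = L^2) Fourier transform of the L^2 function u:
  <g, phi> = <u, hat phi> for all test functions phi.\<close>
definition is_ft :: "('a::euclidean_space \<Rightarrow> complex) \<Rightarrow> ('a \<Rightarrow> complex) \<Rightarrow> bool" where
  "is_ft u g \<longleftrightarrow> L2 u \<and> g \<in> borel_measurable lborel \<and>
     (\<forall>\<phi>. test_fun UNIV \<phi> \<longrightarrow>
        integrable lborel (\<lambda>x. u x * ft \<phi> x) \<and> integrable lborel (\<lambda>\<xi>. g \<xi> * \<phi> \<xi>) \<and>
        (LINT x|lborel. u x * ft \<phi> x) = (LINT \<xi>|lborel. g \<xi> * \<phi> \<xi>))"

definition FT :: "('a::euclidean_space \<Rightarrow> complex) \<Rightarrow> 'a \<Rightarrow> complex" where
  "FT u = (SOME g. is_ft u g)"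

definition Hs :: "real \<Rightarrow> ('a::euclidean_space \<Rightarrow> complex) \<Rightarrow> bool" where
  "Hs s u \<longleftrightarrow> (\<exists>g. is_ft u g \<and>
      integrable lborel (\<lambda>\<xi>. (1 + (norm \<xi>)\<^sup>2) powr s * (cmod (g \<xi>))\<^sup>2))"

definition hs_norm :: "real \<Rightarrow> ('a::euclidean_space \<Rightarrow> complex) \<Rightarrow> real" where
  "hs_norm s u = sqrt (LINT \<xi>|lborel. (1 + (norm \<xi>)\<^sup>2) powr s * (cmod (FT u \<xi>))\<^sup>2)"

definition Hs_tilde :: "real \<Rightarrow> 'a::euclidean_space set \<Rightarrow> ('a \<Rightarrow> complex) \<Rightarrow> bool" where
  "Hs_tilde s \<Omega> u \<longleftrightarrow> Hs s u \<and>
     (\<forall>\<epsilon>>0. \<exists>\<phi>. test_fun \<Omega> \<phi> \<and> hs_norm s (\<lambda>x. u x - \<phi> x) < \<epsilon>)"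

text \<open>Elements of H^{-s} are modelled as bounded linear functionals on H^s
  (dual via the bilinear distributional pairing). An operator Psi in B(H^s,H^{-s})
  is a map u |-> (Psi u), bilinear and bounded on H^s x H^s.\<close>
definition bounded_Hs_Hms :: "real \<Rightarrow> (('a::euclidean_space \<Rightarrow> complex) \<Rightarrow> ('a \<Rightarrow> complex) \<Rightarrow> complex) \<Rightarrow> bool" where
  "bounded_Hs_Hms s \<Psi> \<longleftrightarrow>
     (\<forall>u v w a b. Hs s u \<longrightarrow> Hs s v \<longrightarrow> Hs s w \<longrightarrow>
        \<Psi> u (\<lambda>x. a * v x + b * w x) = a * \<Psi> u v + b * \<Psi> u w \<and>
        \<Psi> (\<lambda>x. a * v x + b * w x) u = a * \<Psi> v u + b * \<Psi> w u) \<and>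
     (\<exists>C. \<forall>u v. Hs s u \<longrightarrow> Hs s v \<longrightarrow> cmod (\<Psi> u v) \<le> C * hs_norm s u * hs_norm s v)"

definition dspt :: "(('a::euclidean_space \<Rightarrow> complex) \<Rightarrow> complex) \<Rightarrow> 'a set" where
  "dspt f = - {x. \<exists>U. open U \<and> x \<in> U \<and> (\<forall>\<phi>. test_fun U \<phi> \<longrightarrow> f \<phi> = 0)}"

definition fspt :: "('a::euclidean_space \<Rightarrow> complex) \<Rightarrow> 'a set" where
  "fspt u = - {x. \<exists>U. open U \<and> x \<in> U \<and> (AE y in lborel. y \<in> U \<longrightarrow> u y = 0)}"

definition nbhd :: "'a::euclidean_space set \<Rightarrow> real \<Rightarrow> 'a set" where
  "nbhd A r = {x. A \<noteq> {} \<and> infdist x A \<le> r}"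

definition ext_set :: "'a::euclidean_space set \<Rightarrow> 'a set" where
  "ext_set A = - closure A"

definition prop_radius :: "real \<Rightarrow> (('a::euclidean_space \<Rightarrow> complex) \<Rightarrow> ('a \<Rightarrow> complex) \<Rightarrow> complex) \<Rightarrow> real \<Rightarrow> bool" where
  "prop_radius s \<Psi> R \<longleftrightarrow> R \<ge> 0 \<and> (\<forall>u. Hs s u \<longrightarrow> dspt (\<Psi> u) \<subseteq> nbhd (fspt u) R)"

definition finite_propagation :: "real \<Rightarrow> (('a::euclidean_space \<Rightarrow> complex) \<Rightarrow> ('a \<Rightarrow> complex) \<Rightarrow> complex) \<Rightarrow> bool" where
  "finite_propagation s \<Psi> \<longleftrightarrow> (\<exists>R. prop_radius s \<Psi> R)"

definition propagation :: "real \<Rightarrow> (('a::euclidean_space \<Rightarrow> complex) \<Rightarrow> ('a \<Rightarrow> complex) \<Rightarrow> complex) \<Rightarrow> real" where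
  "propagation s \<Psi> = Inf {R. prop_radius s \<Psi> R}"

text \<open>Pairing <(-Delta)^s u, phi> = integral of u * (-Delta)^s phi, where for a test function
  (-Delta)^s phi = F^{-1}(|xi|^{2s} hat phi).\<close>
definition frac_lap_test :: "real \<Rightarrow> ('a::euclidean_space \<Rightarrow> complex) \<Rightarrow> 'a \<Rightarrow> complex" where
  "frac_lap_test s \<phi> = ift (\<lambda>\<xi>. complex_of_real (norm \<xi> powr (2 * s)) * ft \<phi> \<xi>)"

definition frac_lap_pair :: "real \<Rightarrow> ('a::euclidean_space \<Rightarrow> complex) \<Rightarrow> ('a \<Rightarrow> complex) \<Rightarrow> complex" where
  "frac_lap_pair s u \<phi> = (LINT x|lborel. u x * frac_lap_test s \<phi> x)"

end

(*
  The exterior hypothesis gives a point x0 of W that is at distance greater than the propagation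
  from Omega. Near x0 both u and Psi u vanish, hence so does (-Delta)^s u, and it remains to prove
  unique continuation: if u and (-Delta)^s u vanish near x0, then u = 0.

  Since u vanishes near x0, (-Delta)^s u is there a nonzero multiple of the Riesz potential
  of u with kernel |w|^(-n-2s), w = y - x. The functions K with int u(y) K(y - x) dy = 0 for all x
  near x0 are closed under partial derivatives in x. Starting from |w|^(-n-2s), the Laplacian yields
  all |w|^(-n-2s-2k), and further derivatives yield |w|^(-n-2s) P(w / |w|^2) for every polynomial P.
  After the Kelvin transform z = w / |w|^2 the Stone-Weierstrass theorem shows that u annihilates
  every test function.
*)
theory Submission
  imports Defs "HOL-Probability.Probability"
begin


section \<open>Smooth functions and test functions\<close>

text \<open>The relation \<open>is_ft\<close> tests a transform only against compactly supported
  functions, so each Fourier fact is first proved for test functions, with powers of the integrable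
  weight \<open>rho\<close> in the role of Schwartz seminorms. Two radii keep the kernels away from
  their singularity: u vanishes for |y - x0| < 2r while x stays within r of x0, so |y - x| >= r
  wherever the integrand is nonzero. Differentiation under the integral then needs only decay like
  |w|^(-n), and (1 + |w|)^(-n) is square integrable, which suits u in L2. The Laplacian has to
  precede the other derivatives: the derivative of |w|^(-a) P along b contains, besides |w|^(-a-2)
  (w . b) P, the term |w|^(-a) times the derivative of P. That term has lower degree with an
  exponent too large by 2, and the extra powers |w|^(-2k) are what removes it. Inversion is used
  because the complement of a ball is unbounded, whereas its image lies in a compact ball on which
  polynomials approximate uniformly; the weight |w|^(-n-2s) |u| has finite mass, so uniform errors
  are harmless.\<close>

lemma Ck_SucD: "Ck (Suc k) f \<Longrightarrow> Ck k f"
proof (induction k arbitrary: f)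
  case (Suc k)
  then show ?case by (metis Ck.simps(2))
qed auto

text \<open>Derivatives are unique, so an explicit \<open>D\<close> can stand for
  \<open>frechet_derivative\<close>. Smoothness is then shown by exhibiting a \<open>D\<close> whose
  directional values stay in the class under induction.\<close>

lemma Ck_SucI:
  assumes "\<And>x. (f has_derivative D x) (at x)" "\<And>b. b \<in> Basis \<Longrightarrow> Ck k (\<lambda>x. D x b)"
  shows "Ck (Suc k) f"
proof -
  have "frechet_derivative f (at x) = D x" for x
    using assms(1) frechet_derivative_at by metis
  moreover have "continuous_on UNIV f"
    by (metis assms(1) continuous_at_imp_continuous_on has_derivative_continuous)
  ultimately show ?thesis
    using assms by (auto intro: differentiableI)
qed

lemma Ck_SucE:
  assumes "Ck (Suc k) f"
  obtains D where "\<And>x. (f has_derivative D x) (at x)" "\<And>b. b \<in> Basis \<Longrightarrow> Ck k (\<lambda>x. D x b)"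
  using that[of "\<lambda>x. frechet_derivative f (at x)"] assms by (simp add: frechet_derivative_works)

lemma Ck_const: "Ck k (\<lambda>x. c)"
proof (induction k arbitrary: c)
  case (Suc k)
  show ?case by (rule Ck_SucI[where D = "\<lambda>_ _. 0"]) (auto intro: Suc)
qed simp

lemma Ck_add: "Ck k f \<Longrightarrow> Ck k g \<Longrightarrow> Ck k (\<lambda>x. f x + g x)"
proof (induction k arbitrary: f g)
  case 0
  then show ?case by (auto intro: continuous_intros)
next
  case (Suc k)
  obtain D where D: "\<And>x. (f has_derivative D x) (at x)" "\<And>b. b \<in> Basis \<Longrightarrow> Ck k (\<lambda>x. D x b)"
    using Ck_SucE[OF Suc.prems(1)] by metis
  obtain E where E: "\<And>x. (g has_derivative E x) (at x)" "\<And>b. b \<in> Basis \<Longrightarrow> Ck k (\<lambda>x. E x b)"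
    using Ck_SucE[OF Suc.prems(2)] by metis
  show ?case
    by (rule Ck_SucI[where D = "\<lambda>x h. D x h + E x h"])
       (auto intro!: Suc.IH D E has_derivative_add)
qed

lemma Ck_mult: "Ck k f \<Longrightarrow> Ck k g \<Longrightarrow> Ck k (\<lambda>x. f x * g x)"
proof (induction k arbitrary: f g)
  case 0
  then show ?case by (auto intro: continuous_intros)
next
  case (Suc k)
  obtain D where D: "\<And>x. (f has_derivative D x) (at x)" "\<And>b. b \<in> Basis \<Longrightarrow> Ck k (\<lambda>x. D x b)"
    using Ck_SucE[OF Suc.prems(1)] by metis
  obtain E where E: "\<And>x. (g has_derivative E x) (at x)" "\<And>b. b \<in> Basis \<Longrightarrow> Ck k (\<lambda>x. E x b)"
    using Ck_SucE[OF Suc.prems(2)] by metis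
  show ?case
    by (rule Ck_SucI[where D = "\<lambda>x h. f x * E x h + D x h * g x"])
       (auto intro!: Suc.IH Ck_add D E has_derivative_mult Suc.prems[THEN Ck_SucD])
qed

lemma Ck_prod: "(\<And>i. i \<in> I \<Longrightarrow> Ck k (f i)) \<Longrightarrow> Ck k (\<lambda>x. \<Prod>i\<in>I. f i x)"
  by (induction I rule: infinite_finite_induct) (auto intro: Ck_const Ck_mult)

lemma Ck_inner: "Ck k (\<lambda>x. complex_of_real (x \<bullet> c))"
proof (cases k)
  case (Suc j)
  show ?thesis unfolding Suc
    by (rule Ck_SucI[where D = "\<lambda>x h. complex_of_real (h \<bullet> c)"])
       (auto intro!: Ck_const derivative_eq_intros)
qed (auto intro!: continuous_intros)

text \<open>The functions \<open>flatexp m\<close> are smooth because the derivative of one is a linear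
  combination of two others.\<close>

definition flatexp :: "nat \<Rightarrow> real \<Rightarrow> real" where
  "flatexp m x = (if x > 0 then exp (- 1 / x) / x ^ m else 0)"

lemma power_div_fact_le_exp:
  fixes y :: real
  assumes "0 \<le> y"
  shows "y ^ n / fact n \<le> exp y"
proof -
  have "(\<Sum>k\<in>{n}. inverse (fact k) * y ^ k) \<le> (\<Sum>k. inverse (fact k) * y ^ k)"
    by (rule sum_le_suminf) (use assms in \<open>auto intro: summable_exp\<close>)
  then show ?thesis
    by (simp add: exp_def divide_inverse mult.commute)
qed

text \<open>One term of the series of exp (1 / x), the one of order m + 2, beats 1 / x ^ m with two
  powers of x to spare. A quadratic bound is what differentiability at 0 needs.\<close>

lemma flatexp_le: "\<bar>flatexp m x\<bar> \<le> fact (m + 2) * x\<^sup>2"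
proof (cases "x > 0")
  case True
  have "(1 / x) ^ (m + 2) / fact (m + 2) \<le> exp (1 / x)"
    using power_div_fact_le_exp[of "1 / x" "m + 2"] True by simp
  then have "1 / exp (1 / x) \<le> fact (m + 2) * x ^ (m + 2)"
    using True by (simp add: field_simps del: fact_Suc)
  then have "exp (- 1 / x) / x ^ m \<le> fact (m + 2) * x ^ (m + 2) / x ^ m"
    using True by (intro divide_right_mono) (auto simp: exp_minus inverse_eq_divide)
  then show ?thesis
    using True by (simp add: flatexp_def power_add power2_eq_square del: fact_Suc)
qed (auto simp: flatexp_def)

lemma flatexp_DERIV: "(flatexp m has_real_derivative (flatexp (m + 2) x - m * flatexp (m + 1) x)) (at x)"
proof -
  consider "x > 0" | "x < 0" | "x = 0" by linarith
  then show ?thesis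
  proof cases
    case 1
    have "((\<lambda>x. exp (- 1 / x) / x ^ m) has_real_derivative (flatexp (m + 2) x - m * flatexp (m + 1) x)) (at x)"
      (is "(?f has_real_derivative ?d) _")
    proof -
      have "(?f has_real_derivative
          (exp (- 1 / x) * (1 / x\<^sup>2) * x ^ m - exp (- 1 / x) * (m * x ^ (m - 1))) / (x ^ m * x ^ m)) (at x)"
        using 1 by (auto intro!: derivative_eq_intros simp: power2_eq_square)
      moreover have "(exp (- 1 / x) * (1 / x\<^sup>2) * x ^ m - exp (- 1 / x) * (m * x ^ (m - 1))) / (x ^ m * x ^ m) = ?d"
        using 1 by (cases m) (simp_all add: flatexp_def power2_eq_square divide_simps, simp_all add: algebra_simps)
      ultimately show ?thesis by simp
    qed
    then show ?thesis
      by (rule has_field_derivative_transform_within_open[of _ _ _ "{0<..}"]) (auto simp: flatexp_def 1)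
  next
    case 2
    have "((\<lambda>x. 0) has_real_derivative (flatexp (m + 2) x - m * flatexp (m + 1) x)) (at x)"
      using 2 by (auto simp: flatexp_def)
    then show ?thesis
      by (rule has_field_derivative_transform_within_open[of _ _ _ "{..<0}"]) (auto simp: flatexp_def 2)
  next
    \<comment> \<open>At the junction the quadratic bound makes the difference quotient O(h); the
      claimed derivative is 0 there because every \<open>flatexp\<close> vanishes at 0.\<close>
    case 3
    have "((\<lambda>h. (flatexp m (0 + h) - flatexp m 0) / h) \<longlongrightarrow> 0) (at 0)"
    proof (rule Lim_null_comparison)
      have "norm ((flatexp m (0 + h) - flatexp m 0) / h) \<le> fact (m + 2) * \<bar>h\<bar>" for h :: real
      proof (cases "h = 0")
        case False
        have "\<bar>flatexp m h\<bar> \<le> fact (m + 2) * \<bar>h\<bar> * \<bar>h\<bar>"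
          using flatexp_le[of m h] by (simp add: power2_eq_square abs_mult[symmetric] mult.assoc del: fact_Suc)
        with False show ?thesis
          by (simp add: flatexp_def[of m 0] pos_divide_le_eq del: fact_Suc)
      qed (simp add: flatexp_def)
      then show "\<forall>\<^sub>F h in at 0. norm ((flatexp m (0 + h) - flatexp m 0) / h) \<le> fact (m + 2) * \<bar>h\<bar>"
        by simp
      show "((\<lambda>h. fact (m + 2) * \<bar>h\<bar>) \<longlongrightarrow> (0::real)) (at 0)"
        by (auto intro!: tendsto_eq_intros)
    qed
    then show ?thesis unfolding 3 DERIV_def by (simp add: flatexp_def)
  qed
qed

lemma Ck_flatexp: "Ck k (\<lambda>x. complex_of_real (flatexp m (x \<bullet> c + d)))"
proof (induction k arbitrary: m)
  case 0
  have "continuous_on UNIV (flatexp m)"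
    by (meson DERIV_isCont continuous_at_imp_continuous_on flatexp_DERIV)
  then show ?case
    by (auto intro!: continuous_intros continuous_on_compose2[of UNIV "flatexp m"])
next
  case (Suc k)
  show ?case
  proof (rule Ck_SucI)
    fix x
    have "((\<lambda>x. flatexp m (x \<bullet> c + d)) has_derivative
        (\<lambda>h. (flatexp (m + 2) (x \<bullet> c + d) - m * flatexp (m + 1) (x \<bullet> c + d)) * (h \<bullet> c))) (at x)"
      by (rule has_derivative_compose[of "\<lambda>x. x \<bullet> c + d" _ _ _ "flatexp m",
            OF _ flatexp_DERIV[unfolded has_field_derivative_def]])
         (auto intro!: derivative_eq_intros)
    from has_derivative_of_real[OF this, where 'a=complex]
    show "((\<lambda>x. complex_of_real (flatexp m (x \<bullet> c + d))) has_derivative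
        (\<lambda>h. complex_of_real (h \<bullet> c) * (complex_of_real (flatexp (m + 2) (x \<bullet> c + d))
              + (- of_nat m) * complex_of_real (flatexp (m + 1) (x \<bullet> c + d))))) (at x)"
      by (simp add: algebra_simps)
  next
    fix b :: 'a
    show "Ck k (\<lambda>x. complex_of_real (b \<bullet> c) * (complex_of_real (flatexp (m + 2) (x \<bullet> c + d))
              + (- of_nat m) * complex_of_real (flatexp (m + 1) (x \<bullet> c + d))))"
      by (intro Ck_mult Ck_add Ck_const Suc)
  qed
qed

lemma csupport_subset: "closed S \<Longrightarrow> (\<And>x. f x \<noteq> 0 \<Longrightarrow> x \<in> S) \<Longrightarrow> csupport f \<subseteq> S"
  unfolding csupport_def by (rule closure_minimal) auto

lemma in_csupport: "f x \<noteq> 0 \<Longrightarrow> x \<in> csupport f"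
  unfolding csupport_def using closure_subset by fastforce

lemma test_funI:
  assumes "smooth_fun \<phi>" "compact S" "S \<subseteq> U" "\<And>x. \<phi> x \<noteq> 0 \<Longrightarrow> x \<in> S"
  shows "test_fun U \<phi>"
proof -
  have "csupport \<phi> \<subseteq> S"
    using assms by (intro csupport_subset) (auto intro: compact_imp_closed)
  then show ?thesis
    using assms unfolding test_fun_def
    by (metis bounded_subset compact_eq_bounded_closed csupport_def closed_closure subset_trans)
qed

lemma test_fun_mono: "test_fun U \<phi> \<Longrightarrow> U \<subseteq> V \<Longrightarrow> test_fun V \<phi>"
  by (auto simp: test_fun_def)

lemma test_fun_outside: "test_fun U \<phi> \<Longrightarrow> x \<notin> U \<Longrightarrow> \<phi> x = 0"
  using in_csupport by (force simp: test_fun_def)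

lemma test_fun_smooth: "test_fun U \<phi> \<Longrightarrow> Ck k \<phi>"
  by (auto simp: test_fun_def smooth_fun_def)

lemma test_fun_compact: "test_fun U \<phi> \<Longrightarrow> compact (csupport \<phi>)"
  by (auto simp: test_fun_def)

lemma test_fun_mult_smooth:
  assumes "test_fun U \<phi>" "smooth_fun f"
  shows "test_fun U (\<lambda>x. f x * \<phi> x)"
  using assms
  by (intro test_funI[where S = "csupport \<phi>"])
     (auto simp: test_fun_def smooth_fun_def intro!: Ck_mult in_csupport)

lemma test_fun_add:
  assumes "test_fun U \<phi>" "test_fun U \<psi>"
  shows "test_fun U (\<lambda>x. \<phi> x + \<psi> x)"
proof (rule test_funI[where S = "csupport \<phi> \<union> csupport \<psi>"])
  show "x \<in> csupport \<phi> \<union> csupport \<psi>" if "\<phi> x + \<psi> x \<noteq> 0" for x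
    using that in_csupport[of \<phi> x] in_csupport[of \<psi> x] by (cases "\<phi> x = 0") auto
qed (use assms in \<open>auto simp: test_fun_def smooth_fun_def intro: Ck_add\<close>)

lemma test_fun_cmult: "test_fun U \<phi> \<Longrightarrow> test_fun U (\<lambda>x. c * \<phi> x)"
  using test_fun_mult_smooth[of U \<phi> "\<lambda>_. c"] by (simp add: smooth_fun_def Ck_const)

lemma test_fun_derivative:
  assumes "test_fun U \<phi>"
  obtains D where "\<And>x. (\<phi> has_derivative D x) (at x)" "\<And>b. b \<in> Basis \<Longrightarrow> test_fun U (\<lambda>x. D x b)"
proof
  have S: "Ck (Suc k) \<phi>" for k by (rule test_fun_smooth[OF assms])
  show D: "(\<phi> has_derivative frechet_derivative \<phi> (at x)) (at x)" for x
    using S[of 0] by (simp add: frechet_derivative_works)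
  show "test_fun U (\<lambda>x. frechet_derivative \<phi> (at x) b)" if b: "b \<in> Basis" for b
  proof (rule test_funI[where S = "csupport \<phi>"])
    show "smooth_fun (\<lambda>x. frechet_derivative \<phi> (at x) b)"
      using S b by (auto simp: smooth_fun_def)
    fix x assume x: "frechet_derivative \<phi> (at x) b \<noteq> 0"
    show "x \<in> csupport \<phi>"
    proof (rule ccontr)
      assume "x \<notin> csupport \<phi>"
      moreover have "open (- csupport \<phi>)" by (simp add: csupport_def open_Compl)
      moreover have "0 = \<phi> y" if "y \<in> - csupport \<phi>" for y
        using that in_csupport[of \<phi> y] by fastforce
      ultimately have "(\<phi> has_derivative (\<lambda>h. 0)) (at x)"
        using has_derivative_transform_within_open[of "\<lambda>_. 0" "\<lambda>h. 0" x UNIV "- csupport \<phi>" \<phi>]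
          has_derivative_const[of 0 "at x"] by blast
      with D[of x] have "frechet_derivative \<phi> (at x) = (\<lambda>h. 0)"
        by (rule has_derivative_unique)
      with x show False by simp
    qed
  qed (use assms in \<open>auto simp: test_fun_def\<close>)
qed

section \<open>Bump functions on boxes\<close>

definition bump :: "real \<Rightarrow> 'a::euclidean_space \<Rightarrow> 'a \<Rightarrow> 'a \<Rightarrow> real" where
  "bump k a b x = (\<Prod>i\<in>Basis. flatexp 0 (k * (x \<bullet> i - a \<bullet> i)) * flatexp 0 (k * (b \<bullet> i - x \<bullet> i)))"

lemma flatexp_bounds: "0 \<le> flatexp m x" "flatexp 0 x \<le> 1"
  by (auto simp: flatexp_def)

lemma bump_bounds: "0 \<le> bump k a b x" "bump k a b x \<le> 1"
  unfolding bump_def by (auto intro!: prod_nonneg prod_le_1 mult_nonneg_nonneg mult_le_one simp: flatexp_bounds)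

lemma bump_nonzero_iff: "k > 0 \<Longrightarrow> bump k a b x \<noteq> 0 \<longleftrightarrow> x \<in> box a b"
  by (auto simp: bump_def mem_box flatexp_def zero_less_mult_iff)

lemma test_fun_bump:
  assumes "k > 0" "cbox a b \<subseteq> U"
  shows "test_fun U (\<lambda>x. complex_of_real (bump k a b x))"
proof (rule test_funI[OF _ compact_cbox assms(2)])
  have "Ck n (\<lambda>x. complex_of_real (flatexp 0 (k * (x \<bullet> i - a \<bullet> i))) * complex_of_real (flatexp 0 (k * (b \<bullet> i - x \<bullet> i))))" for n i
    using Ck_flatexp[of n 0 "k *\<^sub>R i" "- k * (a \<bullet> i)"] Ck_flatexp[of n 0 "- k *\<^sub>R i" "k * (b \<bullet> i)"]
    by (intro Ck_mult) (auto simp: algebra_simps)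
  then show "smooth_fun (\<lambda>x. complex_of_real (bump k a b x))"
    by (auto simp: smooth_fun_def bump_def intro!: Ck_prod)
  show "complex_of_real (bump k a b x) \<noteq> 0 \<Longrightarrow> x \<in> cbox a b" for x
    using bump_nonzero_iff[OF assms(1), of a b x] box_subset_cbox[of a b] by auto
qed

text \<open>The parameter of \<open>bump\<close> is a steepness: exp (- 1 / (k t)) tends to 1 for
  each t > 0. Being bounded by 1, these test functions pass to box indicators by dominated
  convergence.\<close>

lemma bump_tendsto_indicator:
  "(\<lambda>k. bump (real (Suc k)) a b x) \<longlonglongrightarrow> indicator (box a b) x"
proof (cases "x \<in> box a b")
  case True
  have *: "(\<lambda>k. flatexp 0 (real (Suc k) * t)) \<longlonglongrightarrow> 1" if "t > 0" for t
  proof -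
    have "(\<lambda>k. exp (- (inverse (real (Suc k)) * (1 / t)))) \<longlonglongrightarrow> exp (- (0 * (1 / t)))"
      by (intro tendsto_intros LIMSEQ_inverse_real_of_nat)
    moreover have "flatexp 0 (real (Suc k) * t) = exp (- (inverse (real (Suc k)) * (1 / t)))" for k
      using that by (simp add: flatexp_def divide_inverse del: of_nat_Suc)
    ultimately show ?thesis by simp
  qed
  have "(\<lambda>k. bump (real (Suc k)) a b x) \<longlonglongrightarrow> (\<Prod>i\<in>(Basis::'a set). 1 * 1)"
    unfolding bump_def using True by (intro tendsto_prod tendsto_mult *) (auto simp: mem_box)
  then show ?thesis using True by simp
next
  case False
  then have "bump (real (Suc k)) a b x = 0" for k
    using bump_nonzero_iff[of "real (Suc k)" a b x] by auto
  then show ?thesis using False by simp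
qed


section \<open>Integration on Euclidean space\<close>

lemma
  fixes f :: "'a::euclidean_space \<Rightarrow> real \<Rightarrow> 'b::{real_normed_field,banach,second_countable_topology}"
  assumes f: "\<And>i. i \<in> Basis \<Longrightarrow> integrable lborel (f i)"
  shows integrable_prod_Basis: "integrable lborel (\<lambda>x. \<Prod>i\<in>Basis. f i (x \<bullet> i))"
    and integral_prod_Basis: "(LINT x|lborel. (\<Prod>i\<in>Basis. f i (x \<bullet> i))) = (\<Prod>i\<in>Basis. (LINT t|lborel. f i t))"
proof -
  interpret P: product_sigma_finite "\<lambda>_::'a. lborel :: real measure"
    by standard
  have [measurable]: "f i \<in> borel_measurable borel" if "i \<in> Basis" for i
    using borel_measurable_integrable[OF f[OF that]] by simp
  have m[measurable]: "(\<lambda>x. \<Prod>i\<in>Basis. f i (x \<bullet> i)) \<in> borel_measurable borel"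
    by (intro borel_measurable_prod) auto
  have eq: "(\<Prod>i\<in>Basis. f i ((\<Sum>b\<in>Basis. g b *\<^sub>R b) \<bullet> i)) = (\<Prod>i\<in>Basis. f i (g i))" for g
    by (intro prod.cong) simp_all
  show "integrable lborel (\<lambda>x. \<Prod>i\<in>Basis. f i (x \<bullet> i))"
    by (subst lborel_eq, subst integrable_distr_eq)
       (auto simp: eq intro!: P.product_integrable_prod f)
  show "(LINT x|lborel. (\<Prod>i\<in>Basis. f i (x \<bullet> i))) = (\<Prod>i\<in>Basis. (LINT t|lborel. f i t))"
    by (subst lborel_eq, subst integral_distr)
       (auto simp: eq intro!: P.product_integral_prod f)
qed

lemma
  fixes f :: "'a::euclidean_space \<Rightarrow> 'b::{banach,second_countable_topology}"
  assumes c: "c \<noteq> 0" and f[measurable]: "f \<in> borel_measurable lborel"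
  shows integrable_affine_iff: "integrable lborel (\<lambda>x. f (t + c *\<^sub>R x)) \<longleftrightarrow> integrable lborel f"
    and integral_affine: "integral\<^sup>L lborel f = \<bar>c\<bar> ^ DIM('a) *\<^sub>R (LINT x|lborel. f (t + c *\<^sub>R x))"
proof -
  have [measurable]: "f \<in> borel_measurable borel" using f by simp
  have "integrable lborel f \<longleftrightarrow> integrable lborel (\<lambda>x. \<bar>c\<bar> ^ DIM('a) *\<^sub>R f (t + c *\<^sub>R x))"
    using arg_cong[OF lborel_affine[OF c, of t], of "\<lambda>M. integrable M f"]
    by (simp add: integrable_density integrable_distr_eq)
  also have "\<dots> \<longleftrightarrow> integrable lborel (\<lambda>x. f (t + c *\<^sub>R x))"
    using c integrable_scaleR_right[of "1 / \<bar>c\<bar> ^ DIM('a)" lborel "\<lambda>x. \<bar>c\<bar> ^ DIM('a) *\<^sub>R f (t + c *\<^sub>R x)"]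
    by (auto intro!: integrable_scaleR_right)
  finally show "integrable lborel (\<lambda>x. f (t + c *\<^sub>R x)) \<longleftrightarrow> integrable lborel f" ..
  have "integral\<^sup>L lborel f = (LINT x|lborel. \<bar>c\<bar> ^ DIM('a) *\<^sub>R f (t + c *\<^sub>R x))"
    using arg_cong[OF lborel_affine[OF c, of t], of "\<lambda>M. integral\<^sup>L M f"]
    by (simp add: integral_density integral_distr)
  then show "integral\<^sup>L lborel f = \<bar>c\<bar> ^ DIM('a) *\<^sub>R (LINT x|lborel. f (t + c *\<^sub>R x))"
    by simp
qed

section \<open>A product weight for decay estimates\<close>

lemma integrable_inverse_1_plus_square: "integrable lborel (\<lambda>x::real. 1 / (1 + x\<^sup>2))"
proof -
  have "interval_lebesgue_integrable lborel 0 \<infinity> (\<lambda>x::real. 1 / (1 + x^2))"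
    by (rule integrable_I0i_1_div_plus_square)
  then have 1: "integrable lborel (\<lambda>x::real. indicator {0<..} x * (1 / (1 + x\<^sup>2)))"
    by (simp add: interval_lebesgue_integrable_def set_integrable_def einterval_def greaterThan_def)
  have 2: "integrable lborel (\<lambda>x::real. indicator {0<..} (- x) * (1 / (1 + x\<^sup>2)))"
    using lborel_integrable_real_affine[OF 1, of "-1" 0] by simp
  show ?thesis
  proof (rule integrable_cong_AE_imp[OF Bochner_Integration.integrable_add[OF 1 2]])
    show "AE x in lborel. indicator {0<..} x * (1 / (1 + x\<^sup>2)) + indicator {0<..} (- x) * (1 / (1 + x\<^sup>2)) = 1 / (1 + (x::real)\<^sup>2)"
      using AE_lborel_singleton[of "0::real"] by eventually_elim (auto simp: indicator_def)
  qed auto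
qed

text \<open>The product over coordinates reduces integrability in every dimension to one variable.
  Test functions and their transforms are later bounded by the square of \<open>rho\<close>: one
  factor pays for a weight up to 1 + |x|^2 or for a translation, the other is integrated.\<close>

definition rho :: "'a::euclidean_space \<Rightarrow> real" where
  "rho x = (\<Prod>i\<in>Basis. 1 / (1 + (x \<bullet> i)\<^sup>2))"

lemma rho_pos: "0 < rho x"
  unfolding rho_def by (intro prod_pos) (auto simp: add_pos_nonneg)

lemma rho_nonzero[simp]: "rho x \<noteq> 0"
  using rho_pos[of x] by simp

lemma rho_le_1: "rho x \<le> 1"
  unfolding rho_def by (intro prod_le_1) (auto simp: add_pos_nonneg)

lemma rho_square_le: "(rho x)\<^sup>2 \<le> rho x"
  using rho_pos[of x] rho_le_1[of x] by (simp add: power2_eq_square mult_left_le)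

lemma continuous_on_rho: "continuous_on S rho"
  unfolding rho_def[abs_def] by (intro continuous_intros) (auto simp: add_nonneg_eq_0_iff)

lemma borel_measurable_rho[measurable]: "rho \<in> borel_measurable borel"
  by (intro borel_measurable_continuous_onI continuous_on_rho)

lemma integrable_rho: "integrable lborel rho"
  unfolding rho_def[abs_def] by (intro integrable_prod_Basis integrable_inverse_1_plus_square)

text \<open>Peetre's inequality, coordinate by coordinate; it rests on 2 b^2 + 2 (a - b)^2 - a^2 =
  (a - 2 b)^2 >= 0. It makes translates comparable to \<open>rho\<close> itself, as dominated
  convergence requires.\<close>

lemma rho_diff_le: "rho (x - z) \<le> 2 ^ DIM('a) * rho x / rho (z::'a::euclidean_space)"
proof -
  have 1: "1 / (1 + (a - b)\<^sup>2) \<le> 2 * (1 / (1 + a\<^sup>2)) * (1 + b\<^sup>2)" for a b :: real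
  proof -
    have "1 + a\<^sup>2 \<le> 2 * ((1 + b\<^sup>2) * (1 + (a - b)\<^sup>2))"
    proof -
      have "a\<^sup>2 \<le> 2 * b\<^sup>2 + 2 * (a - b)\<^sup>2"
        using sum_squares_ge_zero[of "a - 2 * b" 0] by (simp add: power2_eq_square algebra_simps)
      moreover have "0 \<le> b\<^sup>2 * (a - b)\<^sup>2" by simp
      moreover have "0 \<le> (a - b)\<^sup>2" "0 \<le> b\<^sup>2" by simp_all
      moreover have "2 * ((1 + b\<^sup>2) * (1 + (a - b)\<^sup>2)) = 2 + 2 * b\<^sup>2 + 2 * (a - b)\<^sup>2 + 2 * (b\<^sup>2 * (a - b)\<^sup>2)"
        by (simp only: distrib_left distrib_right mult_1_left mult_1_right)
      ultimately show ?thesis by linarith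
    qed
    moreover have "1 / B \<le> 2 * (1 / A) * C" if "A \<le> 2 * (C * B)" "A > 0" "B > 0" for A B C :: real
      using that by (simp add: field_simps)
    ultimately show ?thesis
      by (meson add_pos_nonneg zero_le_power2 zero_less_one)
  qed
  have "rho (x - z) \<le> (\<Prod>i\<in>(Basis::'a set). 2 * (1 / (1 + (x \<bullet> i)\<^sup>2)) * (1 + (z \<bullet> i)\<^sup>2))"
    unfolding rho_def by (intro prod_mono) (auto simp: inner_diff_left add_nonneg_nonneg intro!: 1[simplified])
  also have "\<dots> = 2 ^ DIM('a) * rho x / rho z"
    unfolding rho_def prod.distrib prod_dividef by simp
  finally show ?thesis .
qed

text \<open>Expanding the product of the factors 1 + (x . i)^2 gives 1, the squares, and mixed terms
  that are nonnegative.\<close>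

lemma one_plus_norm_le_inverse_rho: "1 + (norm x)\<^sup>2 \<le> 1 / rho x"
proof -
  have "1 + (\<Sum>i\<in>I. (x \<bullet> i)\<^sup>2) \<le> (\<Prod>i\<in>I. 1 + (x \<bullet> i)\<^sup>2)" if "finite I" for I
    using that
  proof induction
    case (insert j I)
    have "1 \<le> (\<Prod>i\<in>I. 1 + (x \<bullet> i)\<^sup>2)"
      by (intro prod_ge_1) auto
    then have "(x \<bullet> j)\<^sup>2 * 1 \<le> (x \<bullet> j)\<^sup>2 * (\<Prod>i\<in>I. 1 + (x \<bullet> i)\<^sup>2)"
      by (intro mult_left_mono) auto
    then show ?case using insert by (simp add: algebra_simps)
  qed simp
  from this[of Basis] show ?thesis
    by (simp add: rho_def prod_dividef norm_eq_sqrt_inner[of x] euclidean_inner[of x x] power2_eq_square sum_nonneg)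
qed

text \<open>Each factor of \<open>rho\<close> is compared with (1 + |x|)^(-2). This makes (1 +
  |x|)^(-n) square integrable, so that an L2 function meets the decay condition imposed on
  \<open>v\<close> in the unique continuation argument.\<close>

lemma one_plus_norm_power_le_rho: "(1 / (1 + norm x) ^ DIM('a))\<^sup>2 \<le> rho (x::'a::euclidean_space)"
proof -
  have "(1 / (1 + norm x) ^ DIM('a))\<^sup>2 = (\<Prod>i\<in>(Basis::'a set). (1 / (1 + norm x))\<^sup>2)"
    by (simp add: power_divide power_mult[symmetric] mult.commute)
  also have "\<dots> \<le> rho x"
    unfolding rho_def
  proof (intro prod_mono conjI)
    fix i :: 'a assume "i \<in> Basis"
    then have "(x \<bullet> i)\<^sup>2 \<le> (norm x)\<^sup>2"
      using Basis_le_norm[of i x] by (metis abs_ge_zero power2_abs power_mono)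
    moreover have "(1 + norm x)\<^sup>2 = 1 + 2 * norm x + (norm x)\<^sup>2"
      by (simp add: power2_sum)
    ultimately have "1 + (x \<bullet> i)\<^sup>2 \<le> (1 + norm x)\<^sup>2"
      using norm_ge_zero[of x] by linarith
    then show "(1 / (1 + norm x))\<^sup>2 \<le> 1 / (1 + (x \<bullet> i)\<^sup>2)"
      by (simp add: power_divide frac_le add_pos_nonneg)
  qed auto
  finally show ?thesis .
qed

lemma test_fun_continuous: "test_fun U \<phi> \<Longrightarrow> continuous_on S \<phi>"
  using test_fun_smooth[of U \<phi> 0] continuous_on_subset by fastforce

lemma test_fun_measurable: "test_fun U \<phi> \<Longrightarrow> \<phi> \<in> borel_measurable borel"
  by (intro borel_measurable_continuous_onI test_fun_continuous)

lemma test_fun_bound: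
  assumes "test_fun U \<phi>"
  obtains C where "C \<ge> 0" "\<And>x. cmod (\<phi> x) \<le> C * (rho x)\<^sup>2"
proof -
  have "compact ((\<lambda>x. cmod (\<phi> x) / (rho x)\<^sup>2) ` csupport \<phi>)"
    by (intro compact_continuous_image test_fun_compact[OF assms] continuous_intros
          test_fun_continuous[OF assms] continuous_on_rho) auto
  then obtain C where "\<forall>y\<in>(\<lambda>x. cmod (\<phi> x) / (rho x)\<^sup>2) ` csupport \<phi>. norm y \<le> C"
    using compact_imp_bounded bounded_iff by blast
  then have C: "cmod (\<phi> x) / (rho x)\<^sup>2 \<le> C" if "x \<in> csupport \<phi>" for x
    using that by simp
  show ?thesis
  proof
    show "0 \<le> max C 0" by simp
    show "cmod (\<phi> x) \<le> max C 0 * (rho x)\<^sup>2" for x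
    proof (cases "\<phi> x = 0")
      case False
      then have "cmod (\<phi> x) \<le> C * (rho x)\<^sup>2"
        using C[OF in_csupport[of \<phi>, OF False]] rho_pos[of x] by (simp add: pos_divide_le_eq)
      also have "\<dots> \<le> max C 0 * (rho x)\<^sup>2"
        by (intro mult_right_mono) auto
      finally show ?thesis .
    qed auto
  qed
qed

lemma integrable_rho_bound:
  fixes f :: "'a::euclidean_space \<Rightarrow> 'b::{banach,second_countable_topology}"
  assumes "f \<in> borel_measurable lborel" "\<And>x. norm (f x) \<le> C * rho x"
  shows "integrable lborel f"
  by (rule Bochner_Integration.integrable_bound[OF integrable_mult_right[OF integrable_rho, of C] assms(1)])
     (use assms(2) in \<open>auto intro: order.trans[OF _ abs_ge_self]\<close>)

lemma rho_square_bound: "a \<le> C * (rho x)\<^sup>2 \<Longrightarrow> C \<ge> 0 \<Longrightarrow> a \<le> C * rho x"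
  by (meson mult_left_mono order_trans rho_square_le)

lemma test_fun_integrable:
  assumes "test_fun U \<phi>"
  shows "integrable lborel \<phi>"
proof -
  obtain C where "C \<ge> 0" "\<And>x. cmod (\<phi> x) \<le> C * (rho x)\<^sup>2"
    using test_fun_bound[OF assms] by blast
  then show ?thesis
    by (intro integrable_rho_bound[of \<phi> C]) (auto intro: rho_square_bound simp: test_fun_measurable[OF assms])
qed

section \<open>Gaussian integrals\<close>

text \<open>A rescaling of the characteristic function of the standard normal distribution.\<close>

lemma
  fixes t w :: real
  assumes t: "t > 0"
  shows integrable_cis_gauss_real: "integrable lborel (\<lambda>x. cis (x * w) * complex_of_real (exp (- t * x\<^sup>2)))" (is ?A)
    and integral_cis_gauss_real: "(LINT x|lborel. cis (x * w) * complex_of_real (exp (- t * x\<^sup>2)))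
      = complex_of_real (sqrt (pi / t) * exp (- w\<^sup>2 / (4 * t)))" (is ?B)
proof -
  \<comment> \<open>The exponent - x^2 / 2 of the normal density becomes - t x^2 at the point c
    x.\<close>
  define c where "c = sqrt (2 * t)"
  have c: "c > 0" "c\<^sup>2 = 2 * t" using t by (auto simp: c_def)
  define f where "f = (\<lambda>x. complex_of_real (std_normal_density x) * iexp ((w / c) * x))"
  have fm: "f \<in> borel_measurable borel" by (simp add: f_def)
  have fi: "integrable lborel f"
    by (rule Bochner_Integration.integrable_bound[of _ std_normal_density])
       (auto simp: f_def norm_mult intro: integrable_std_normal_moment[of 0, simplified])
  have "complex_of_real (exp (- ((w / c)\<^sup>2) / 2)) = char std_normal_distribution (w / c)"
    by (simp add: char_std_normal_distribution)
  also have "\<dots> = (LINT x|lborel. f x)"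
    unfolding char_def f_def by (subst integral_density) (auto simp: scaleR_conv_of_real)
  also have "\<dots> = c *\<^sub>R (LINT x|lborel. f (c * x))"
    using lborel_integral_real_affine[of c f 0] c by simp
  finally have *: "(LINT x|lborel. f (c * x)) = complex_of_real (exp (- ((w / c)\<^sup>2) / 2)) / c"
    using c by (simp add: scaleR_conv_of_real)
  have eq: "cis (x * w) * complex_of_real (exp (- t * x\<^sup>2)) = sqrt (2 * pi) * f (c * x)" for x
    using c t by (simp add: f_def normal_density_def cis_conv_exp mult_ac power_mult_distrib)
  show ?A
    unfolding eq using lborel_integrable_real_affine[OF fi, of c 0] c by simp
  have "sqrt (2 * pi) / c = sqrt (pi / t)"
    by (simp add: c_def real_sqrt_divide[symmetric] t)
  moreover have "(w / c)\<^sup>2 / 2 = w\<^sup>2 / (4 * t)"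
    using c t by (simp add: power_divide)
  ultimately have "sqrt (2 * pi) * (exp (- ((w / c)\<^sup>2) / 2) / c) = sqrt (pi / t) * exp (- w\<^sup>2 / (4 * t))"
    by (metis minus_divide_left times_divide_eq_right mult.commute)
  then show ?B
    unfolding eq integral_mult_right_zero * by (simp only: of_real_mult[symmetric] of_real_divide[symmetric])
qed

lemma cis_sum: "finite I \<Longrightarrow> cis (sum f I) = (\<Prod>i\<in>I. cis (f i))"
  by (induction I rule: finite_induct) (auto simp flip: cis_mult)

lemma norm_square_eq_sum_Basis: "(norm x)\<^sup>2 = (\<Sum>i\<in>Basis. (x \<bullet> i)\<^sup>2)"
  by (subst power2_norm_eq_inner, subst euclidean_inner, simp only: power2_eq_square)

lemma cis_inner_gauss_eq_prod:
  "cis (x \<bullet> w) * complex_of_real (exp (- t * (norm x)\<^sup>2))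
    = (\<Prod>i\<in>Basis. cis ((x \<bullet> i) * (w \<bullet> i)) * complex_of_real (exp (- t * (x \<bullet> i)\<^sup>2)))"
proof -
  have "cis (x \<bullet> w) = (\<Prod>i\<in>Basis. cis ((x \<bullet> i) * (w \<bullet> i)))"
    by (subst euclidean_inner, rule cis_sum) simp
  moreover have "exp (- t * (norm x)\<^sup>2) = (\<Prod>i\<in>Basis. exp (- t * (x \<bullet> i)\<^sup>2))"
    by (subst exp_sum[symmetric]) (auto simp: norm_square_eq_sum_Basis sum_distrib_left)
  ultimately show ?thesis by (simp add: prod.distrib)
qed

text \<open>The Fourier transform of exp (- t |x|^2). It is (2 pi)^n times the Gauss-Weierstrass
  heat kernel at time t, since no inverse normalisation is included.\<close>

definition heat :: "real \<Rightarrow> 'a::euclidean_space \<Rightarrow> real" where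
  "heat t w = sqrt (pi / t) ^ DIM('a) * exp (- (norm w)\<^sup>2 / (4 * t))"

lemma
  fixes w :: "'a::euclidean_space"
  assumes t: "t > 0"
  shows integrable_cis_gauss: "integrable lborel (\<lambda>x::'a. cis (x \<bullet> w) * complex_of_real (exp (- t * (norm x)\<^sup>2)))"
    and integral_cis_gauss: "(LINT x|lborel. cis (x \<bullet> w) * complex_of_real (exp (- t * (norm (x::'a))\<^sup>2)))
      = complex_of_real (heat t w)"
proof -
  show "integrable lborel (\<lambda>x::'a. cis (x \<bullet> w) * complex_of_real (exp (- t * (norm x)\<^sup>2)))"
    unfolding cis_inner_gauss_eq_prod by (intro integrable_prod_Basis integrable_cis_gauss_real t)
  have "(LINT x|lborel. cis (x \<bullet> w) * complex_of_real (exp (- t * (norm (x::'a))\<^sup>2)))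
      = (\<Prod>i\<in>(Basis::'a set). complex_of_real (sqrt (pi / t) * exp (- (w \<bullet> i)\<^sup>2 / (4 * t))))"
    unfolding cis_inner_gauss_eq_prod
    by (subst integral_prod_Basis, rule integrable_cis_gauss_real[OF t],
        intro prod.cong refl integral_cis_gauss_real t)
  also have "\<dots> = complex_of_real (heat t w)"
  proof -
    have "exp (- (norm w)\<^sup>2 / (4 * t)) = (\<Prod>i\<in>(Basis::'a set). exp (- (w \<bullet> i)\<^sup>2 / (4 * t)))"
      by (subst exp_sum[symmetric])
         (auto simp: norm_square_eq_sum_Basis sum_divide_distrib sum_negf)
    then show ?thesis
      by (simp add: heat_def prod.distrib)
  qed
  finally show "(LINT x|lborel. cis (x \<bullet> w) * complex_of_real (exp (- t * (norm (x::'a))\<^sup>2))) = complex_of_real (heat t w)" .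
qed

section \<open>The fundamental lemma of the calculus of variations\<close>

text \<open>Dynkin's argument: open boxes are stable under intersection and generate the Borel sets,
  so all Borel integrals of \<open>g\<close> vanish, and densities are unique almost
  everywhere.\<close>

lemma AE_zero_if_box_integrals_zero:
  fixes g :: "'a::euclidean_space \<Rightarrow> real"
  assumes g: "integrable lborel g"
    and box: "\<And>c d. (LINT x:box c d|lborel. g x) = 0"
  shows "AE x in lborel. g x = 0"
proof -
  have si: "set_integrable lborel A g" if "A \<in> sets borel" for A
    unfolding set_integrable_def using that by (intro integrable_mult_indicator g) auto
  \<comment> \<open>The complement step of the induction needs the integral over the whole space; it
    is the limit of the integrals over these boxes.\<close>
  define B where "B n = box (- (real n *\<^sub>R One)) (real n *\<^sub>R One :: 'a)" for n
  have inc: "incseq B"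
    unfolding B_def incseq_def by (auto simp: mem_box) (smt (verit) of_nat_le_iff)+
  have UB: "(\<Union>n. B n) = UNIV"
  proof -
    have "x \<in> (\<Union>n. B n)" for x
    proof -
      obtain n where n: "norm x < real n" using reals_Archimedean2 by blast
      have "\<bar>x \<bullet> i\<bar> < real n" if "i \<in> Basis" for i
        using Basis_le_norm[OF that, of x] n by linarith
      then have "x \<in> B n" by (auto simp: B_def mem_box abs_less_iff) force
      then show ?thesis by blast
    qed
    then show ?thesis by auto
  qed
  have "B n \<in> sets lborel" for n by (simp add: B_def)
  then have "(\<lambda>n. LINT x:B n|lborel. g x) \<longlonglongrightarrow> (LINT x:(\<Union>n. B n)|lborel. g x)"
    by (rule set_integral_cont_up[OF _ inc]) (simp add: UB si)
  then have "(LINT x:UNIV|lborel. g x) = 0"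
    unfolding UB using box by (subst (asm) B_def) (simp only: LIMSEQ_const_iff)
  have "(LINT x:A|lborel. g x) = 0" if "A \<in> sets borel" for A
  proof -
    have "Int_stable (range (\<lambda>(a, b). box a b :: 'a set))"
      by (auto simp: Int_stable_def box_Int_box)
    moreover have "range (\<lambda>(a, b). box a b :: 'a set) \<subseteq> Pow UNIV" by simp
    moreover have "A \<in> sigma_sets UNIV (range (\<lambda>(a, b). box a b))"
      using that by (subst (asm) borel_eq_box) simp
    ultimately show ?thesis
    proof (induction A rule: sigma_sets_induct_disjoint)
      case (compl A)
      then have A: "A \<in> sets borel" by (simp add: borel_eq_box)
      have "(LINT x:A \<union> (UNIV - A)|lborel. g x) = (LINT x:A|lborel. g x) + (LINT x:UNIV - A|lborel. g x)"
        using A by (intro set_integral_Un si) auto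
      with compl \<open>(LINT x:UNIV|lborel. g x) = 0\<close> show ?case by simp
    next
      case (union A)
      then have A: "A i \<in> sets borel" for i by (simp add: borel_eq_box image_subset_iff)
      then have "(LINT x:(\<Union>i. A i)|lborel. g x) = (\<Sum>i. (LINT x:(A i)|lborel. g x))"
        using union(1) by (intro lebesgue_integral_countable_add si) (auto simp: disjoint_family_on_def)
      with union show ?case by simp
    qed (use box in \<open>auto simp: set_lebesgue_integral_def\<close>)
  qed
  then show ?thesis
    using density_unique_real[of lborel g "\<lambda>_. 0"] g by (simp add: set_lebesgue_integral_def)
qed

text \<open>A fixed bump localises \<open>v\<close> to a box inside \<open>U\<close>; a second,
  increasingly steep bump then tests the localised function against indicators of boxes. A countable
  cover of \<open>U\<close> by such boxes glues the null sets together.\<close>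

lemma AE_zero_if_test_integrals_zero:
  fixes v :: "'a::euclidean_space \<Rightarrow> complex"
  assumes U: "open U" and v[measurable]: "v \<in> borel_measurable lborel"
    and int: "\<And>\<phi>. test_fun U \<phi> \<Longrightarrow> integrable lborel (\<lambda>x. v x * \<phi> x)"
    and zero: "\<And>\<phi>. test_fun U \<phi> \<Longrightarrow> (LINT x|lborel. v x * \<phi> x) = 0"
  shows "AE x in lborel. x \<in> U \<longrightarrow> v x = 0"
proof -
  have box: "AE x in lborel. x \<in> cbox a b \<longrightarrow> v x = 0" if ab: "cbox a b \<subseteq> U" for a b
  proof -
    \<comment> \<open>This product is integrable over the whole space although \<open>v\<close> need
      not be, and it vanishes in the open box exactly where \<open>v\<close> does.\<close>
    define g where "g x = v x * complex_of_real (bump 1 a b x)" for x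
    have g: "integrable lborel g"
      unfolding g_def by (intro int test_fun_bump ab) simp
    have gbox: "(LINT x:box c d|lborel. g x) = 0" for c d
    proof -
      have test: "test_fun U (\<lambda>x. complex_of_real (bump 1 a b x) * complex_of_real (bump (real (Suc k)) c d x))" for k
        using test_fun_mult_smooth[OF test_fun_bump[OF _ ab, of 1]
            , of "\<lambda>x. complex_of_real (bump (real (Suc k)) c d x)"]
          test_fun_bump[of "real (Suc k)" c d UNIV]
        by (simp add: test_fun_def mult.commute)
      have z: "(LINT x|lborel. bump (real (Suc k)) c d x *\<^sub>R g x) = 0" for k
        using zero[OF test[of k]] by (simp add: g_def scaleR_conv_of_real mult_ac)
      have "(\<lambda>k. LINT x|lborel. bump (real (Suc k)) c d x *\<^sub>R g x)
              \<longlonglongrightarrow> (LINT x|lborel. indicator (box c d) x *\<^sub>R g x)"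
      proof (rule integral_dominated_convergence[where w = "\<lambda>x. norm (g x)"])
        show "AE x in lborel. (\<lambda>k. bump (real (Suc k)) c d x *\<^sub>R g x) \<longlonglongrightarrow> indicator (box c d) x *\<^sub>R g x"
          by (intro AE_I2 tendsto_scaleR bump_tendsto_indicator tendsto_const)
        show "AE x in lborel. norm (bump (real (Suc k)) c d x *\<^sub>R g x) \<le> norm (g x)" for k
          using bump_bounds[of "real (Suc k)" c d] by (auto intro!: AE_I2 mult_left_le_one_le)
        show "(\<lambda>x. bump (real (Suc k)) c d x *\<^sub>R g x) \<in> borel_measurable lborel" for k
        proof -
          have "integrable lborel (\<lambda>x. bump (real (Suc k)) c d x *\<^sub>R g x)"
            using int[OF test[of k]] by (simp add: g_def scaleR_conv_of_real mult_ac)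
          then show ?thesis by simp
        qed
        show "(\<lambda>x. indicator (box c d) x *\<^sub>R g x) \<in> borel_measurable lborel"
          using borel_measurable_integrable[OF g] by measurable
      qed (use g in auto)
      then show ?thesis
        unfolding z by (simp add: LIMSEQ_const_iff set_lebesgue_integral_def)
    qed
    have si: "set_integrable lborel (box c d) g" for c d
      unfolding set_integrable_def by (intro integrable_mult_indicator g) auto
    have "AE x in lborel. Re (g x) = 0"
    proof (rule AE_zero_if_box_integrals_zero)
      show "(LINT x:box c d|lborel. Re (g x)) = 0" for c d
        using integral_Re[OF si[of c d, unfolded set_integrable_def]] gbox[of c d]
        by (simp add: set_lebesgue_integral_def)
    qed (use g in auto)
    moreover have "AE x in lborel. Im (g x) = 0"
    proof (rule AE_zero_if_box_integrals_zero)
      show "(LINT x:box c d|lborel. Im (g x)) = 0" for c d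
        using integral_Im[OF si[of c d, unfolded set_integrable_def]] gbox[of c d]
        by (simp add: set_lebesgue_integral_def)
    qed (use g in auto)
    \<comment> \<open>On the faces of the box the bump is zero, so \<open>g\<close> says nothing
      about \<open>v\<close> there.\<close>
    moreover have "AE x in lborel. x \<notin> cbox a b - box a b"
      by (rule AE_not_in[OF null_sets_cbox_Diff_box])
    ultimately show ?thesis
    proof eventually_elim
      case (elim x)
      then have "g x = 0" by (simp add: complex_eq_iff)
      with elim(3) show ?case
        using bump_nonzero_iff[of 1 a b x] by (auto simp: g_def)
    qed
  qed
  obtain D where D: "countable D" "D \<subseteq> Pow U" "\<And>X. X \<in> D \<Longrightarrow> \<exists>a b. X = cbox a b" "\<Union>D = U"
    using open_countable_Union_open_cbox[OF U] by metis
  have "AE x in lborel. \<forall>X\<in>D. x \<in> X \<longrightarrow> v x = 0"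
    using D by (subst AE_ball_countable) (auto, metis PowD box subsetD)
  then show ?thesis
    by eventually_elim (use D(4) in auto)
qed


section \<open>The Fourier transform of test functions\<close>

lemma borel_measurable_cis[measurable]: "cis \<in> borel_measurable borel"
  by (intro borel_measurable_continuous_onI continuous_intros)

lemma
  fixes f :: "'a::euclidean_space \<Rightarrow> 'b::euclidean_space \<Rightarrow> complex"
  assumes meas: "(\<lambda>p. f (fst p) (snd p)) \<in> borel_measurable (lborel \<Otimes>\<^sub>M lborel)"
    and g: "integrable lborel g" and h: "integrable lborel h"
    and bound: "\<And>x y. cmod (f x y) \<le> g x * h y"
  shows integrable_pair_dominated: "integrable (lborel \<Otimes>\<^sub>M lborel) (\<lambda>(x, y). f x y)"
    and Fubini_dominated: "(LINT x|lborel. LINT y|lborel. f x y) = (LINT y|lborel. LINT x|lborel. f x y)"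
proof -
  have [measurable]: "g \<in> borel_measurable borel" "h \<in> borel_measurable borel"
    using borel_measurable_integrable[OF g] borel_measurable_integrable[OF h] by simp_all
  have "integrable (lborel \<Otimes>\<^sub>M lborel) (\<lambda>p::'a \<times> 'b. g (fst p) * h (snd p))"
  proof (rule lborel_pair.Fubini_integrable)
    have "integrable lborel (\<lambda>x. norm (g x) * (LINT y|lborel. norm (h y)))"
      using g by (intro integrable_mult_left integrable_norm)
    then show "integrable lborel (\<lambda>x. LINT y|lborel. norm (g (fst (x, y)) * h (snd (x, y))))"
      by (simp add: abs_mult)
  qed (use h in auto)
  then show *: "integrable (lborel \<Otimes>\<^sub>M lborel) (\<lambda>(x, y). f x y)"
    by (rule Bochner_Integration.integrable_bound)
       (use meas bound in \<open>auto simp: case_prod_beta' intro: order.trans[OF _ abs_ge_self]\<close>)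
  show "(LINT x|lborel. LINT y|lborel. f x y) = (LINT y|lborel. LINT x|lborel. f x y)"
    using lborel_pair.Fubini_integral[OF *] by simp
qed

text \<open>Differentiability is asked for only along the segment, because the result also serves
  kernels that are singular at the origin.\<close>

lemma mean_value_line:
  fixes f :: "'a::real_normed_vector \<Rightarrow> 'b::real_inner"
  assumes h: "h > 0" and D: "\<And>t. 0 \<le> t \<Longrightarrow> t \<le> h \<Longrightarrow> (f has_derivative D (x + t *\<^sub>R b)) (at (x + t *\<^sub>R b))"
  obtains t where "0 < t" "t < h" "norm (f (x + h *\<^sub>R b) - f x) \<le> h * norm (D (x + t *\<^sub>R b) b)"
proof -
  have d: "((\<lambda>t. f (x + t *\<^sub>R b)) has_derivative (\<lambda>r. D (x + t *\<^sub>R b) (r *\<^sub>R b))) (at t)"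
    if "0 \<le> t" "t \<le> h" for t
    by (rule has_derivative_compose[of "\<lambda>t. x + t *\<^sub>R b" _ t UNIV f, OF _ D[OF that]])
       (auto intro!: derivative_eq_intros)
  have "\<exists>t\<in>{0<..<h}. norm (f (x + h *\<^sub>R b) - f (x + 0 *\<^sub>R b)) \<le> norm (D (x + t *\<^sub>R b) ((h - 0) *\<^sub>R b))"
    using h d by (intro mvt_general) (auto intro!: has_derivative_continuous continuous_at_imp_continuous_on)
  then obtain t where t: "0 < t" "t < h" "norm (f (x + h *\<^sub>R b) - f x) \<le> norm (D (x + t *\<^sub>R b) (h *\<^sub>R b))"
    by auto
  interpret bounded_linear "D (x + t *\<^sub>R b)"
    using D[of t] t has_derivative_bounded_linear by auto
  show ?thesis
    using t h by (intro that[of t]) (simp_all add: scaleR)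
qed

lemma directional_difference_quotient:
  fixes f :: "'a::real_normed_vector \<Rightarrow> 'b::real_normed_vector"
  assumes "(f has_derivative D) (at x)" "h \<longlonglongrightarrow> 0" "\<And>n. h n \<noteq> (0::real)"
  shows "(\<lambda>n. (1 / h n) *\<^sub>R (f (x + h n *\<^sub>R b) - f x)) \<longlonglongrightarrow> D b"
proof -
  interpret D: bounded_linear D by (rule has_derivative_bounded_linear[OF assms(1)])
  have vd: "((\<lambda>t. f (x + t *\<^sub>R b)) has_vector_derivative D b) (at 0)"
  proof -
    have "((\<lambda>t. f (x + t *\<^sub>R b)) has_derivative (\<lambda>r. D (r *\<^sub>R b))) (at 0)"
      by (rule has_derivative_compose[where g = f]) (auto intro!: derivative_eq_intros assms(1))
    then show ?thesis by (simp add: has_vector_derivative_def D.scaleR)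
  qed
  have "((\<lambda>t. (1 / t) *\<^sub>R (f (x + t *\<^sub>R b) - f x)) \<longlongrightarrow> D b) (at 0)"
  proof -
    have "((\<lambda>t. (1 / \<bar>t\<bar>) *\<^sub>R (f (x + t *\<^sub>R b) - (f x + t *\<^sub>R D b))) \<longlongrightarrow> 0) (at 0)"
      using vd by (simp add: has_vector_derivative_def has_derivative_at2)
    then have "((\<lambda>t. norm ((1 / \<bar>t\<bar>) *\<^sub>R (f (x + t *\<^sub>R b) - (f x + t *\<^sub>R D b)))) \<longlongrightarrow> 0) (at 0)"
      by (rule tendsto_norm_zero)
    moreover have "norm ((1 / \<bar>t\<bar>) *\<^sub>R (f (x + t *\<^sub>R b) - (f x + t *\<^sub>R D b)))
        = norm ((1 / t) *\<^sub>R (f (x + t *\<^sub>R b) - f x) - D b)" if "t \<noteq> 0" for t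
    proof -
      have "(1 / t) *\<^sub>R (f (x + t *\<^sub>R b) - f x) - D b = (1 / t) *\<^sub>R (f (x + t *\<^sub>R b) - (f x + t *\<^sub>R D b))"
        using that by (simp add: algebra_simps)
      then show ?thesis by simp
    qed
    then have "\<forall>\<^sub>F t in at 0. norm ((1 / \<bar>t\<bar>) *\<^sub>R (f (x + t *\<^sub>R b) - (f x + t *\<^sub>R D b)))
        = norm ((1 / t) *\<^sub>R (f (x + t *\<^sub>R b) - f x) - D b)"
      by (auto simp: eventually_at_filter)
    ultimately have "((\<lambda>t. norm ((1 / t) *\<^sub>R (f (x + t *\<^sub>R b) - f x) - D b)) \<longlongrightarrow> 0) (at 0)"
      by (rule Lim_transform_eventually)
    then show ?thesis
      by (auto dest!: tendsto_norm_zero_cancel simp: LIM_zero_iff)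
  qed
  moreover have "filterlim h (at 0) sequentially"
    using assms(2,3) by (auto simp: filterlim_at)
  ultimately show ?thesis by (rule filterlim_compose)
qed

text \<open>By translation invariance each difference quotient integrates to zero; the mean value
  theorem supplies a majorant for the limit.\<close>

lemma integral_directional_derivative_zero:
  fixes f :: "'a::euclidean_space \<Rightarrow> complex"
  assumes f: "test_fun U f" and D: "\<And>x. (f has_derivative D x) (at x)"
    and Db: "test_fun U (\<lambda>x. D x b)" and b: "b \<in> Basis"
  shows "(LINT x|lborel. D x b) = 0"
proof -
  define h where "h n = inverse (real (Suc n))" for n
  have h: "h \<longlonglongrightarrow> 0" "0 < h n" "h n \<le> 1" "h n \<noteq> 0" for n
    using LIMSEQ_inverse_real_of_nat by (auto simp: h_def[abs_def] inverse_le_1_iff)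
  have [measurable]: "f \<in> borel_measurable borel" "(\<lambda>x. D x b) \<in> borel_measurable borel"
    using test_fun_measurable f Db by auto
  obtain C where C: "C \<ge> 0" "\<And>x. cmod (D x b) \<le> C * (rho x)\<^sup>2"
    using test_fun_bound[OF Db] by blast
  define q where "q n x = (1 / h n) *\<^sub>R (f (x + h n *\<^sub>R b) - f x)" for n x
  have q0: "(LINT x|lborel. q n x) = 0" for n
  proof -
    have i: "integrable lborel f" by (rule test_fun_integrable[OF f])
    then have "integrable lborel (\<lambda>x. f (h n *\<^sub>R b + 1 *\<^sub>R x))"
      by (subst integrable_affine_iff) auto
    moreover have "(LINT x|lborel. f (h n *\<^sub>R b + 1 *\<^sub>R x)) = (LINT x|lborel. f x)"
      by (subst integral_affine[of 1 f "h n *\<^sub>R b"]) auto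
    ultimately show ?thesis
      using i by (simp add: q_def add.commute)
  qed
  have "(\<lambda>n. LINT x|lborel. q n x) \<longlonglongrightarrow> (LINT x|lborel. D x b)"
  proof (rule integral_dominated_convergence[where w = "\<lambda>x. C * 2 ^ DIM('a) * 2 * rho x"])
    show "AE x in lborel. (\<lambda>n. q n x) \<longlonglongrightarrow> D x b"
      unfolding q_def by (intro AE_I2 directional_difference_quotient D h)
    show "integrable lborel (\<lambda>x. C * 2 ^ DIM('a) * 2 * rho x)"
      by (intro integrable_mult_right integrable_rho)
    show "AE x in lborel. norm (q n x) \<le> C * 2 ^ DIM('a) * 2 * rho x" for n
    proof (rule AE_I2)
      fix x
      obtain t where t: "0 < t" "t < h n" "norm (f (x + h n *\<^sub>R b) - f x) \<le> h n * norm (D (x + t *\<^sub>R b) b)"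
        using mean_value_line[of "h n" f D x b] D h by blast
      have "t\<^sup>2 \<le> 1" using t h(3)[of n] by (simp add: abs_square_le_1)
      \<comment> \<open>The intermediate point differs from x by t b with t at most 1, so the
        translation inequality costs a factor 1 + t^2, at most 2.\<close>
      have "rho (- t *\<^sub>R b) = (\<Prod>i\<in>Basis. if i = b then 1 / (1 + t\<^sup>2) else 1)"
        unfolding rho_def using b by (intro prod.cong) (auto simp: inner_Basis)
      then have r: "1 / rho (- t *\<^sub>R b) \<le> 2"
        using b \<open>t\<^sup>2 \<le> 1\<close> by simp
      have "norm (q n x) \<le> norm (D (x + t *\<^sub>R b) b)"
        using t(3) h(2)[of n] by (simp add: q_def pos_divide_le_eq mult.commute)
      also have "\<dots> \<le> C * rho (x - (- t *\<^sub>R b))"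
        using rho_square_bound[OF C(2) C(1)] by simp
      also have "\<dots> \<le> C * (2 ^ DIM('a) * rho x * (1 / rho (- t *\<^sub>R b)))"
        using rho_diff_le[of x "- t *\<^sub>R b"] C(1) by (intro mult_left_mono) auto
      also have "\<dots> \<le> C * (2 ^ DIM('a) * rho x * 2)"
        using r C(1) rho_pos[of x] by (intro mult_left_mono mult_nonneg_nonneg) auto
      finally show "norm (q n x) \<le> C * 2 ^ DIM('a) * 2 * rho x" by (simp add: mult_ac)
    qed
  qed (auto simp: q_def)
  then show ?thesis by (simp add: q0 LIMSEQ_const_iff)
qed

lemma has_derivative_cis_inner:
  "((\<lambda>x. cis (x \<bullet> c)) has_derivative (\<lambda>h. \<i> * complex_of_real (h \<bullet> c) * cis (x \<bullet> c))) (at x)"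
proof -
  have "((\<lambda>x. \<i> * complex_of_real (x \<bullet> c)) has_derivative (\<lambda>h. \<i> * complex_of_real (h \<bullet> c))) (at x)"
    by (auto intro!: derivative_eq_intros)
  then have "((\<lambda>x. exp (\<i> * complex_of_real (x \<bullet> c))) has_derivative
      (\<lambda>h. exp (\<i> * complex_of_real (x \<bullet> c)) * (\<i> * complex_of_real (h \<bullet> c)))) (at x)"
    by (rule has_derivative_compose[OF _ DERIV_exp[unfolded has_field_derivative_def]])
  then show ?thesis by (simp add: cis_conv_exp mult_ac)
qed

lemma Ck_cis: "Ck k (\<lambda>x. cis (x \<bullet> c))"
proof (induction k)
  case 0
  show ?case by (auto intro!: continuous_intros)
next
  case (Suc k)
  show ?case
  proof (rule Ck_SucI)
    show "((\<lambda>x. cis (x \<bullet> c)) has_derivative (\<lambda>h. \<i> * complex_of_real (h \<bullet> c) * cis (x \<bullet> c))) (at x)" for x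
      by (rule has_derivative_cis_inner)
    show "Ck k (\<lambda>x. \<i> * complex_of_real (b \<bullet> c) * cis (x \<bullet> c))" for b
      by (intro Ck_mult Ck_const Suc)
  qed
qed

lemma test_fun_cis_mult: "test_fun U \<phi> \<Longrightarrow> test_fun U (\<lambda>x. cis (- (x \<bullet> \<xi>)) * \<phi> x)"
  using test_fun_mult_smooth[of U \<phi> "\<lambda>x. cis (x \<bullet> - \<xi>)"] Ck_cis[of _ "- \<xi>"] by (simp add: smooth_fun_def)

text \<open>Integration by parts: the character times \<phi> is again a test function, so its
  derivative along b integrates to zero, and the product rule splits that integral.\<close>

lemma ft_directional_derivative:
  fixes \<phi> :: "'a::euclidean_space \<Rightarrow> complex"
  assumes \<phi>: "test_fun U \<phi>" and D: "\<And>x. (\<phi> has_derivative D x) (at x)"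
    and Db: "test_fun U (\<lambda>x. D x b)" and b: "b \<in> Basis"
  shows "ft (\<lambda>x. D x b) \<xi> = \<i> * complex_of_real (\<xi> \<bullet> b) * ft \<phi> \<xi>"
proof -
  define e where "e x = cis (- (x \<bullet> \<xi>))" for x
  have De: "(e has_derivative (\<lambda>h. - \<i> * complex_of_real (h \<bullet> \<xi>) * e x)) (at x)" for x
    using has_derivative_cis_inner[of "- \<xi>" x] by (simp add: e_def[abs_def])
  define E where "E x h = e x * D x h + - \<i> * complex_of_real (h \<bullet> \<xi>) * e x * \<phi> x" for x h
  have E: "((\<lambda>x. e x * \<phi> x) has_derivative E x) (at x)" for x
    unfolding E_def by (rule has_derivative_mult[OF De D])
  have Eb: "test_fun U (\<lambda>x. E x b)"
    using test_fun_add[OF test_fun_cis_mult[OF Db, of \<xi>]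
        test_fun_cmult[OF test_fun_cis_mult[OF \<phi>, of \<xi>], of "- \<i> * complex_of_real (b \<bullet> \<xi>)"]]
    by (simp add: E_def e_def mult_ac)
  have e\<phi>: "test_fun U (\<lambda>x. e x * \<phi> x)" unfolding e_def by (rule test_fun_cis_mult[OF \<phi>])
  have "integrable lborel (\<lambda>x. e x * D x b)" "integrable lborel (\<lambda>x. e x * \<phi> x)"
    using test_fun_integrable[OF test_fun_cis_mult] Db \<phi> unfolding e_def by blast+
  moreover have "(LINT x|lborel. E x b) = 0"
    by (rule integral_directional_derivative_zero[OF e\<phi> E Eb b])
  ultimately show ?thesis
    by (simp add: E_def ft_def e_def[symmetric] mult.assoc inner_commute)
qed

lemma cmod_ft_le:
  assumes "integrable lborel \<phi>"
  shows "cmod (ft \<phi> \<xi>) \<le> (LINT x|lborel. cmod (\<phi> x))"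
  unfolding ft_def by (rule order.trans[OF integral_norm_bound]) (simp add: norm_mult)

text \<open>Subtracting the second derivative along b multiplies the transform by 1 + (\<xi> . b)^2.
  The operator is applied once for each direction in \<open>A\<close>.\<close>

lemma ft_polynomial_multiple:
  fixes \<phi> :: "'a::euclidean_space \<Rightarrow> complex"
  assumes "test_fun U \<phi>" "finite A" "A \<subseteq> Basis"
  shows "\<exists>\<psi>. test_fun U \<psi> \<and> (\<forall>\<xi>. ft \<psi> \<xi> = complex_of_real (\<Prod>i\<in>A. 1 + (\<xi> \<bullet> i)\<^sup>2) * ft \<phi> \<xi>)"
  using assms(2,3)
proof (induction A rule: finite_induct)
  case empty
  then show ?case using assms by auto
next
  case (insert b A)
  then have b: "b \<in> Basis" by auto
  from insert obtain \<psi> where \<psi>: "test_fun U \<psi>"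
      "\<And>\<xi>. ft \<psi> \<xi> = complex_of_real (\<Prod>i\<in>A. 1 + (\<xi> \<bullet> i)\<^sup>2) * ft \<phi> \<xi>" by auto
  obtain D where D: "\<And>x. (\<psi> has_derivative D x) (at x)" "test_fun U (\<lambda>x. D x b)"
    using test_fun_derivative[OF \<psi>(1)] b by metis
  obtain E where E: "\<And>x. ((\<lambda>x. D x b) has_derivative E x) (at x)" "test_fun U (\<lambda>x. E x b)"
    using test_fun_derivative[OF D(2)] b by metis
  have e: "ft (\<lambda>x. E x b) \<xi> = - complex_of_real ((\<xi> \<bullet> b)\<^sup>2) * ft \<psi> \<xi>" for \<xi>
    unfolding ft_directional_derivative[OF D(2) E b] ft_directional_derivative[OF \<psi>(1) D b]
    by (simp add: power2_eq_square mult_ac)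
  have t: "test_fun U (\<lambda>x. \<psi> x + -1 * E x b)"
    by (rule test_fun_add[OF \<psi>(1) test_fun_cmult[OF E(2)]])
  have "ft (\<lambda>x. \<psi> x + -1 * E x b) \<xi> = ft \<psi> \<xi> - ft (\<lambda>x. E x b) \<xi>" for \<xi>
    using test_fun_integrable[OF test_fun_cis_mult[OF \<psi>(1)]] test_fun_integrable[OF test_fun_cis_mult[OF E(2)]]
    by (simp add: ft_def right_diff_distrib)
  then have "ft (\<lambda>x. \<psi> x + -1 * E x b) \<xi> = complex_of_real (\<Prod>i\<in>insert b A. 1 + (\<xi> \<bullet> i)\<^sup>2) * ft \<phi> \<xi>" for \<xi>
    using insert.hyps by (simp add: e \<psi>(2) algebra_simps)
  with t show ?case by blast
qed

text \<open>The product of all factors 1 + (\<xi> . b)^2 is 1 / \<open>rho\<close>. Applying the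
  differential operator twice gives a test function \<theta> whose transform is ft \<phi> divided by
  the square of \<open>rho\<close>, and transforms of integrable functions are bounded.\<close>

lemma ft_test_fun_bound:
  fixes \<phi> :: "'a::euclidean_space \<Rightarrow> complex"
  assumes "test_fun U \<phi>"
  obtains C where "C \<ge> 0" "\<And>\<xi>. cmod (ft \<phi> \<xi>) \<le> C * (rho \<xi>)\<^sup>2"
proof -
  obtain \<psi> where \<psi>: "test_fun U \<psi>"
      "\<And>\<xi>. ft \<psi> \<xi> = complex_of_real (\<Prod>i\<in>Basis. 1 + (\<xi> \<bullet> i)\<^sup>2) * ft \<phi> \<xi>"
    using ft_polynomial_multiple[OF assms finite_Basis] by blast
  obtain \<theta> where \<theta>: "test_fun U \<theta>"
      "\<And>\<xi>. ft \<theta> \<xi> = complex_of_real (\<Prod>i\<in>Basis. 1 + (\<xi> \<bullet> i)\<^sup>2) * ft \<psi> \<xi>"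
    using ft_polynomial_multiple[OF \<psi>(1) finite_Basis] by blast
  have r: "(\<Prod>i\<in>Basis. 1 + (\<xi> \<bullet> i)\<^sup>2) = 1 / rho \<xi>" for \<xi> :: 'a
    by (simp add: rho_def prod_dividef)
  show ?thesis
  proof
    show "0 \<le> (LINT x|lborel. cmod (\<theta> x))" by simp
    fix \<xi> :: 'a
    have "ft \<phi> \<xi> = complex_of_real ((rho \<xi>)\<^sup>2) * ft \<theta> \<xi>"
      unfolding \<theta>(2) \<psi>(2) r by (simp add: power2_eq_square)
    then have "cmod (ft \<phi> \<xi>) = (rho \<xi>)\<^sup>2 * cmod (ft \<theta> \<xi>)"
      by (simp add: norm_mult norm_power)
    then show "cmod (ft \<phi> \<xi>) \<le> (LINT x|lborel. cmod (\<theta> x)) * (rho \<xi>)\<^sup>2"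
      using cmod_ft_le[OF test_fun_integrable[OF \<theta>(1)], of \<xi>]
      by (simp add: mult.commute mult_left_mono)
  qed
qed

lemma cmod_cis_Taylor: "cmod (cis a - 1 - \<i> * complex_of_real a) \<le> a\<^sup>2 / 2"
  using iexp_approx1[of a 1] by (simp add: cis_conv_exp power2_eq_square algebra_simps)

text \<open>The second-order Taylor estimate of \<open>cis\<close> bounds the remainder by |h|^2
  times the second moment \<open>M\<close> of \<phi>, which is finite by the decay of
  \<phi>.\<close>

lemma ft_has_derivative:
  fixes \<phi> :: "'a::euclidean_space \<Rightarrow> complex"
  assumes \<phi>: "test_fun U \<phi>"
  shows "(ft \<phi> has_derivative (\<lambda>h. \<Sum>b\<in>Basis. complex_of_real (h \<bullet> b) *
            ft (\<lambda>x. - \<i> * complex_of_real (x \<bullet> b) * \<phi> x) \<xi>)) (at \<xi>)"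
proof -
  have [measurable]: "\<phi> \<in> borel_measurable borel" by (rule test_fun_measurable[OF \<phi>])
  obtain C where C: "C \<ge> 0" "\<And>x. cmod (\<phi> x) \<le> C * (rho x)\<^sup>2"
    using test_fun_bound[OF \<phi>] by blast
  have tb: "test_fun U (\<lambda>x. - \<i> * complex_of_real (x \<bullet> b) * \<phi> x)" for b
    by (intro test_fun_mult_smooth[OF \<phi>]) (simp only: smooth_fun_def, intro allI Ck_mult Ck_const Ck_inner)
  define L where "L h = (\<Sum>b\<in>Basis. complex_of_real (h \<bullet> b) * ft (\<lambda>x. - \<i> * complex_of_real (x \<bullet> b) * \<phi> x) \<xi>)" for h
  define M where "M = (LINT x|lborel. (norm x)\<^sup>2 * cmod (\<phi> x))"
  have iM: "integrable lborel (\<lambda>x. (norm x)\<^sup>2 * cmod (\<phi> x))"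
  proof (rule integrable_rho_bound)
    fix x
    have "(norm x)\<^sup>2 * cmod (\<phi> x) \<le> 1 / rho x * (C * (rho x)\<^sup>2)"
      using one_plus_norm_le_inverse_rho[of x] C(2)[of x] rho_pos[of x]
      by (intro mult_mono) auto
    then show "norm ((norm x)\<^sup>2 * cmod (\<phi> x)) \<le> C * rho x"
      by (simp add: power2_eq_square)
  qed auto
  have Lint: "integrable lborel (\<lambda>x. cis (- (x \<bullet> \<xi>)) * (- \<i> * complex_of_real (x \<bullet> h)) * \<phi> x)"
    and L: "L h = (LINT x|lborel. cis (- (x \<bullet> \<xi>)) * (- \<i> * complex_of_real (x \<bullet> h)) * \<phi> x)" for h
  proof -
    have eq: "cis (- (x \<bullet> \<xi>)) * (- \<i> * complex_of_real (x \<bullet> h)) * \<phi> x =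
      (\<Sum>b\<in>Basis. complex_of_real (h \<bullet> b) * (cis (- (x \<bullet> \<xi>)) * (- \<i> * complex_of_real (x \<bullet> b) * \<phi> x)))" for x
      by (subst euclidean_inner[of x h])
         (simp add: of_real_sum sum_distrib_left sum_distrib_right mult_ac sum_negf)
    show "integrable lborel (\<lambda>x. cis (- (x \<bullet> \<xi>)) * (- \<i> * complex_of_real (x \<bullet> h)) * \<phi> x)"
      unfolding eq
      by (intro Bochner_Integration.integrable_sum integrable_mult_right test_fun_integrable[OF test_fun_cis_mult[OF tb]])
    show "L h = (LINT x|lborel. cis (- (x \<bullet> \<xi>)) * (- \<i> * complex_of_real (x \<bullet> h)) * \<phi> x)"
      unfolding eq L_def ft_def
      by (subst Bochner_Integration.integral_sum)
         (intro integrable_mult_right test_fun_integrable[OF test_fun_cis_mult[OF tb]], simp)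
  qed
  have bd: "cmod (ft \<phi> (\<xi> + h) - ft \<phi> \<xi> - L h) \<le> M * (norm h)\<^sup>2" for h
  proof -
    have i: "integrable lborel (\<lambda>x. cis (- (x \<bullet> \<eta>)) * \<phi> x)" for \<eta>
      by (rule test_fun_integrable[OF test_fun_cis_mult[OF \<phi>]])
    have eq: "ft \<phi> (\<xi> + h) - ft \<phi> \<xi> - L h = (LINT x|lborel. cis (- (x \<bullet> (\<xi> + h))) * \<phi> x
        - cis (- (x \<bullet> \<xi>)) * \<phi> x - cis (- (x \<bullet> \<xi>)) * (- \<i> * complex_of_real (x \<bullet> h)) * \<phi> x)"
      unfolding L ft_def using i Lint by (simp del: mult_minus_left mult_minus_right)
    have ce: "cis (- (x \<bullet> (\<xi> + h))) = cis (- (x \<bullet> \<xi>)) * cis (- (x \<bullet> h))" for x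
      by (simp add: cis_mult inner_add_right)
    note eq
    also have "(LINT x|lborel. cis (- (x \<bullet> (\<xi> + h))) * \<phi> x
        - cis (- (x \<bullet> \<xi>)) * \<phi> x - cis (- (x \<bullet> \<xi>)) * (- \<i> * complex_of_real (x \<bullet> h)) * \<phi> x)
      = (LINT x|lborel. cis (- (x \<bullet> \<xi>)) * (cis (- (x \<bullet> h)) - 1 - \<i> * complex_of_real (- (x \<bullet> h))) * \<phi> x)"
      unfolding ce by (intro Bochner_Integration.integral_cong refl) (simp add: algebra_simps)
    also have "cmod \<dots> \<le> (LINT x|lborel. (norm h)\<^sup>2 * ((norm x)\<^sup>2 * cmod (\<phi> x)))"
    proof (rule order.trans[OF integral_norm_bound integral_mono])
      fix x :: 'a
      have "(- (x \<bullet> h))\<^sup>2 / 2 \<le> (norm x)\<^sup>2 * (norm h)\<^sup>2"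
      proof -
        have "(x \<bullet> h)\<^sup>2 \<le> (norm x)\<^sup>2 * (norm h)\<^sup>2"
          using Cauchy_Schwarz_ineq[of x h] by (simp only: power2_norm_eq_inner)
        moreover have "0 \<le> (x \<bullet> h)\<^sup>2" by simp
        ultimately show ?thesis unfolding power2_minus by linarith
      qed
      then have "cmod (cis (- (x \<bullet> h)) - 1 - \<i> * complex_of_real (- (x \<bullet> h))) \<le> (norm x)\<^sup>2 * (norm h)\<^sup>2"
        using cmod_cis_Taylor[of "- (x \<bullet> h)"] by linarith
      then have "cmod (cis (- (x \<bullet> h)) - 1 - \<i> * complex_of_real (- (x \<bullet> h))) * cmod (\<phi> x)
          \<le> (norm x)\<^sup>2 * (norm h)\<^sup>2 * cmod (\<phi> x)"
        by (rule mult_right_mono) simp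
      then show "cmod (cis (- (x \<bullet> \<xi>)) * (cis (- (x \<bullet> h)) - 1 - \<i> * complex_of_real (- (x \<bullet> h))) * \<phi> x)
          \<le> (norm h)\<^sup>2 * ((norm x)\<^sup>2 * cmod (\<phi> x))"
        by (simp add: norm_mult mult_ac)
    next
      have "integrable lborel (\<lambda>x. cis (- (x \<bullet> (\<xi> + h))) * \<phi> x
        - cis (- (x \<bullet> \<xi>)) * \<phi> x - cis (- (x \<bullet> \<xi>)) * (- \<i> * complex_of_real (x \<bullet> h)) * \<phi> x)"
        by (intro Bochner_Integration.integrable_diff i Lint)
      then have "integrable lborel (\<lambda>x. cis (- (x \<bullet> \<xi>)) * (cis (- (x \<bullet> h)) - 1 - \<i> * complex_of_real (- (x \<bullet> h))) * \<phi> x)"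
        unfolding ce by (rule Bochner_Integration.integrable_cong[THEN iffD1, rotated 2]) (simp_all add: algebra_simps)
      then show "integrable lborel (\<lambda>x. cmod (cis (- (x \<bullet> \<xi>)) * (cis (- (x \<bullet> h)) - 1 - \<i> * complex_of_real (- (x \<bullet> h))) * \<phi> x))"
        by (rule integrable_norm)
    qed (intro integrable_mult_right iM)
    also have "\<dots> = M * (norm h)\<^sup>2" by (simp add: M_def mult.commute)
    finally show ?thesis .
  qed
  have "(ft \<phi> has_derivative L) (at \<xi>)"
  proof (rule has_derivativeI_sandwich[where e = 1 and H = "\<lambda>y. M * norm (y - \<xi>)"])
    show "bounded_linear L"
      unfolding L_def
      by (intro bounded_linear_sum)
         (rule bounded_linear_compose[OF bounded_linear_mult_left
            bounded_linear_compose[OF bounded_linear_of_real bounded_linear_inner_left]])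
    show "norm (ft \<phi> y - ft \<phi> \<xi> - L (y - \<xi>)) / norm (y - \<xi>) \<le> M * norm (y - \<xi>)" if "y \<noteq> \<xi>" for y
      using bd[of "y - \<xi>"] that by (simp add: pos_divide_le_eq power2_eq_square mult.assoc)
    show "((\<lambda>y. M * norm (y - \<xi>)) \<longlongrightarrow> 0) (at \<xi>)"
      by (auto intro!: tendsto_eq_intros)
  qed simp
  then show ?thesis by (simp add: L_def[abs_def])
qed

text \<open>The partial derivatives of ft \<phi> are transforms of - i (x . b) \<phi>, which are
  test functions again. Smoothness is needed so that a cut-off of a transform is a test
  function.\<close>

lemma Ck_ft: "test_fun U \<phi> \<Longrightarrow> Ck k (ft \<phi>)"
proof (induction k arbitrary: \<phi>)
  case 0
  then show ?case
    using ft_has_derivative[OF 0] by (auto intro!: continuous_at_imp_continuous_on has_derivative_continuous)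
next
  case (Suc k)
  have tb: "test_fun U (\<lambda>x. - \<i> * complex_of_real (x \<bullet> b) * \<phi> x)" for b
    by (intro test_fun_mult_smooth[OF Suc.prems]) (simp only: smooth_fun_def, intro allI Ck_mult Ck_const Ck_inner)
  show ?case
  proof (rule Ck_SucI[OF ft_has_derivative[OF Suc.prems]])
    fix c :: 'a assume c: "c \<in> Basis"
    have "(\<Sum>b\<in>Basis. complex_of_real (c \<bullet> b) * ft (\<lambda>x. - \<i> * complex_of_real (x \<bullet> b) * \<phi> x) \<xi>)
        = ft (\<lambda>x. - \<i> * complex_of_real (x \<bullet> c) * \<phi> x) \<xi>" for \<xi>
      using c by (simp add: inner_Basis if_distrib[of complex_of_real] mult_if_delta cong: if_cong)
    then show "Ck k (\<lambda>\<xi>. \<Sum>b\<in>Basis. complex_of_real (c \<bullet> b) * ft (\<lambda>x. - \<i> * complex_of_real (x \<bullet> b) * \<phi> x) \<xi>)"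
      using Suc.IH[OF tb[of c]] by simp
  qed
qed

lemma ft_measurable: "test_fun U \<phi> \<Longrightarrow> ft \<phi> \<in> borel_measurable borel"
  using Ck_ft[of U \<phi> 0] by (intro borel_measurable_continuous_onI) simp

lemma ft_integrable:
  assumes "test_fun U \<phi>"
  shows "integrable lborel (ft \<phi>)"
proof -
  obtain C where "C \<ge> 0" "\<And>x. cmod (ft \<phi> x) \<le> C * (rho x)\<^sup>2"
    using ft_test_fun_bound[OF assms] by blast
  then show ?thesis
    by (intro integrable_rho_bound[of "ft \<phi>" C]) (auto intro: rho_square_bound simp: ft_measurable[OF assms])
qed

section \<open>Fourier inversion by Gaussian summability\<close>

lemma ft_exchange:
  fixes \<phi> \<psi> :: "'a::euclidean_space \<Rightarrow> complex"
  assumes \<phi>: "integrable lborel \<phi>" and \<psi>: "integrable lborel \<psi>"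
  shows "(LINT x|lborel. \<phi> x * ft \<psi> x) = (LINT \<xi>|lborel. ft \<phi> \<xi> * \<psi> \<xi>)"
proof -
  have [measurable]: "\<phi> \<in> borel_measurable borel" "\<psi> \<in> borel_measurable borel"
    using borel_measurable_integrable \<phi> \<psi> by auto
  have "(LINT x|lborel. \<phi> x * ft \<psi> x) = (LINT x|lborel. LINT \<xi>|lborel. \<phi> x * (cis (- (\<xi> \<bullet> x)) * \<psi> \<xi>))"
    by (simp add: ft_def)
  also have "\<dots> = (LINT \<xi>|lborel. LINT x|lborel. \<phi> x * (cis (- (\<xi> \<bullet> x)) * \<psi> \<xi>))"
    by (rule Fubini_dominated[OF _ integrable_norm[OF \<phi>] integrable_norm[OF \<psi>]]) (simp_all add: norm_mult)
  also have "\<dots> = (LINT \<xi>|lborel. LINT x|lborel. cis (- (x \<bullet> \<xi>)) * \<phi> x * \<psi> \<xi>)"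
    by (simp add: mult_ac inner_commute)
  finally show ?thesis by (simp add: ft_def)
qed

text \<open>The transform of the Gaussian modulated by y is the heat kernel centred at y. Letting t
  tend to 0 gives the inversion formula; integrating in t against t^(-1-s) gives the Riesz
  kernel.\<close>

lemma gauss_ft_eq_heat:
  fixes \<phi> :: "'a::euclidean_space \<Rightarrow> complex"
  assumes t: "t > 0" and \<phi>: "integrable lborel \<phi>"
  shows "(LINT \<xi>|lborel. cis (\<xi> \<bullet> y) * complex_of_real (exp (- t * (norm \<xi>)\<^sup>2)) * ft \<phi> \<xi>)
    = (LINT x|lborel. \<phi> x * complex_of_real (heat t (y - x)))"
proof -
  define g where "g \<xi> = cis (\<xi> \<bullet> y) * complex_of_real (exp (- t * (norm \<xi>)\<^sup>2))" for \<xi>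
  have g: "integrable lborel g"
    unfolding g_def by (rule integrable_cis_gauss[OF t])
  have "(LINT \<xi>|lborel. g \<xi> * ft \<phi> \<xi>) = (LINT x|lborel. ft g x * \<phi> x)"
    by (rule ft_exchange[OF g \<phi>])
  moreover have "ft g x = complex_of_real (heat t (y - x))" for x
  proof -
    have "ft g x = (LINT \<xi>|lborel. cis (\<xi> \<bullet> (y - x)) * complex_of_real (exp (- t * (norm \<xi>)\<^sup>2)))"
      unfolding ft_def g_def
      by (intro Bochner_Integration.integral_cong refl) (simp add: cis_mult inner_diff_right flip: mult.assoc)
    then show ?thesis by (simp only: integral_cis_gauss[OF t])
  qed
  ultimately show ?thesis by (simp add: g_def mult.commute)
qed

lemma Fourier_inversion:
  fixes \<phi> :: "'a::euclidean_space \<Rightarrow> complex"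
  assumes \<phi>: "test_fun U \<phi>"
  shows "(LINT \<xi>|lborel. cis (\<xi> \<bullet> y) * ft \<phi> \<xi>) = complex_of_real ((2 * pi) ^ DIM('a)) * \<phi> y"
proof -
  have [measurable]: "\<phi> \<in> borel_measurable borel" "ft \<phi> \<in> borel_measurable borel"
    using test_fun_measurable[OF \<phi>] ft_measurable[OF \<phi>] by auto
  obtain C where C: "C \<ge> 0" "\<And>x. cmod (\<phi> x) \<le> C * (rho x)\<^sup>2"
    using test_fun_bound[OF \<phi>] by blast
  have C': "cmod (\<phi> x) \<le> C" for x
    using rho_square_bound[OF C(2,1), of x] mult_left_mono[OF rho_le_1 C(1), of x] by simp
  define h where "h n = inverse (real (Suc n))" for n
  have h: "h \<longlonglongrightarrow> 0" "h n > 0" for n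
    using LIMSEQ_inverse_real_of_nat by (auto simp: h_def[abs_def])
  define I where "I n = (LINT \<xi>|lborel. cis (\<xi> \<bullet> y) * complex_of_real (exp (- (h n)\<^sup>2 * (norm \<xi>)\<^sup>2)) * ft \<phi> \<xi>)" for n
  have 1: "I \<longlonglongrightarrow> (LINT \<xi>|lborel. cis (\<xi> \<bullet> y) * complex_of_real (exp (- 0\<^sup>2 * (norm \<xi>)\<^sup>2)) * ft \<phi> \<xi>)"
    unfolding I_def
  proof (rule integral_dominated_convergence[where w = "\<lambda>\<xi>. cmod (ft \<phi> \<xi>)"])
    show "AE \<xi> in lborel. (\<lambda>n. cis (\<xi> \<bullet> y) * complex_of_real (exp (- (h n)\<^sup>2 * (norm \<xi>)\<^sup>2)) * ft \<phi> \<xi>)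
      \<longlonglongrightarrow> cis (\<xi> \<bullet> y) * complex_of_real (exp (- 0\<^sup>2 * (norm \<xi>)\<^sup>2)) * ft \<phi> \<xi>"
      by (intro AE_I2 tendsto_intros h)
    show "AE \<xi> in lborel. norm (cis (\<xi> \<bullet> y) * complex_of_real (exp (- (h n)\<^sup>2 * (norm \<xi>)\<^sup>2)) * ft \<phi> \<xi>) \<le> cmod (ft \<phi> \<xi>)" for n
      by (intro AE_I2) (simp add: norm_mult mult_left_le_one_le)
  qed (use integrable_norm[OF ft_integrable[OF \<phi>]] in auto)
  \<comment> \<open>The substitution x = y - 2 h z turns the heat kernel at time h^2 into the fixed
    Gaussian exp (- |z|^2). Choosing the time as a square keeps roots out of the scaling.\<close>
  define J where "J n = (LINT z|lborel. complex_of_real (exp (- (norm z)\<^sup>2)) * \<phi> (y + (- 2 * h n) *\<^sub>R z))" for n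
  have gi: "integrable lborel (\<lambda>z::'a. complex_of_real (exp (- (norm z)\<^sup>2)))"
    and gv: "(LINT z|lborel. complex_of_real (exp (- (norm (z::'a))\<^sup>2))) = complex_of_real (sqrt pi ^ DIM('a))"
    using integrable_cis_gauss[of 1 "0::'a"] integral_cis_gauss[of 1 "0::'a"] by (simp_all add: heat_def)
  have "J \<longlonglongrightarrow> (LINT z|lborel. complex_of_real (exp (- (norm z)\<^sup>2)) * \<phi> (y + (- 2 * 0) *\<^sub>R z))"
    unfolding J_def
  proof (rule integral_dominated_convergence[where w = "\<lambda>z. exp (- (norm z)\<^sup>2) * C"])
    have "isCont \<phi> x" for x
      using test_fun_continuous[OF \<phi>, of UNIV] by (simp add: continuous_on_eq_continuous_at)
    then show "AE z in lborel. (\<lambda>n. complex_of_real (exp (- (norm z)\<^sup>2)) * \<phi> (y + (- 2 * h n) *\<^sub>R z))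
      \<longlonglongrightarrow> complex_of_real (exp (- (norm z)\<^sup>2)) * \<phi> (y + (- 2 * 0) *\<^sub>R z)"
      by (intro AE_I2 tendsto_intros isCont_tendsto_compose[of _ \<phi>] h)
    show "integrable lborel (\<lambda>z::'a. exp (- (norm z)\<^sup>2) * C)"
      using integrable_norm[OF gi] by (intro integrable_mult_left) simp
    show "AE z in lborel. norm (complex_of_real (exp (- (norm z)\<^sup>2)) * \<phi> (y + (- 2 * h n) *\<^sub>R z)) \<le> exp (- (norm z)\<^sup>2) * C" for n
      using C' by (intro AE_I2) (simp add: norm_mult)
  qed auto
  then have J: "J \<longlonglongrightarrow> complex_of_real (sqrt pi ^ DIM('a)) * \<phi> y"
    using gi gv by simp
  have IJ: "I n = complex_of_real ((2 * sqrt pi) ^ DIM('a)) * J n" for n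
  proof -
    have heat_eq: "heat ((h n)\<^sup>2) (y - (y + (- 2 * h n) *\<^sub>R z)) = (sqrt pi / h n) ^ DIM('a) * exp (- (norm z)\<^sup>2)" for z
      using h(2)[of n] by (simp add: heat_def real_sqrt_divide power_mult_distrib)
    have "I n = (LINT x|lborel. \<phi> x * complex_of_real (heat ((h n)\<^sup>2) (y - x)))"
      unfolding I_def using h(2)[of n] by (intro gauss_ft_eq_heat test_fun_integrable[OF \<phi>]) simp
    also have "\<dots> = \<bar>- 2 * h n\<bar> ^ DIM('a) *\<^sub>R (LINT z|lborel. \<phi> (y + (- 2 * h n) *\<^sub>R z)
        * complex_of_real (heat ((h n)\<^sup>2) (y - (y + (- 2 * h n) *\<^sub>R z))))"
      by (rule integral_affine) (use h(2)[of n] in \<open>auto simp: heat_def\<close>)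
    also have "(LINT z|lborel. \<phi> (y + (- 2 * h n) *\<^sub>R z)
        * complex_of_real (heat ((h n)\<^sup>2) (y - (y + (- 2 * h n) *\<^sub>R z)))) = complex_of_real ((sqrt pi / h n) ^ DIM('a)) * J n"
    proof -
      have "complex_of_real ((sqrt pi / h n) ^ DIM('a)) * J n = (LINT z|lborel. complex_of_real ((sqrt pi / h n) ^ DIM('a)) *
          (complex_of_real (exp (- (norm z)\<^sup>2)) * \<phi> (y + (- 2 * h n) *\<^sub>R z)))"
        unfolding J_def by (rule integral_mult_right_zero[symmetric])
      also have "\<dots> = (LINT z|lborel. \<phi> (y + (- 2 * h n) *\<^sub>R z)
        * complex_of_real (heat ((h n)\<^sup>2) (y - (y + (- 2 * h n) *\<^sub>R z))))"
        by (intro Bochner_Integration.integral_cong refl) (simp only: heat_eq of_real_mult, simp only: mult_ac)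
      finally show ?thesis ..
    qed
    finally have "I n = (\<bar>- 2 * h n\<bar> ^ DIM('a) * (sqrt pi / h n) ^ DIM('a)) *\<^sub>R J n"
      by (simp add: scaleR_conv_of_real mult.assoc)
    also have "\<bar>- 2 * h n\<bar> ^ DIM('a) * (sqrt pi / h n) ^ DIM('a) = (2 * sqrt pi) ^ DIM('a)"
    proof -
      have "\<bar>- 2 * h n\<bar> * (sqrt pi / h n) = 2 * sqrt pi"
        using h(2)[of n] by (simp add: abs_mult)
      then show ?thesis by (metis power_mult_distrib)
    qed
    finally show ?thesis by (simp add: scaleR_conv_of_real)
  qed
  have "I \<longlonglongrightarrow> complex_of_real ((2 * sqrt pi) ^ DIM('a)) * (complex_of_real (sqrt pi ^ DIM('a)) * \<phi> y)"
    unfolding IJ by (intro tendsto_intros J)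
  \<comment> \<open>The first factor collects the Jacobian and the prefactor of the heat kernel, the
    second is the mass of exp (- |z|^2).\<close>
  moreover have "(2 * sqrt pi) ^ DIM('a) * sqrt pi ^ DIM('a) = (2 * pi) ^ DIM('a)"
  proof -
    have "2 * sqrt pi * sqrt pi = 2 * pi" by simp
    then show ?thesis by (metis power_mult_distrib)
  qed
  ultimately have "I \<longlonglongrightarrow> complex_of_real ((2 * pi) ^ DIM('a)) * \<phi> y"
    by (metis mult.assoc of_real_mult)
  with 1 show ?thesis using LIMSEQ_unique by fastforce
qed

lemma test_fun_L2:
  assumes "test_fun U \<phi>"
  shows "L2 \<phi>"
  unfolding L2_def
proof
  show "\<phi> \<in> borel_measurable lborel" using test_fun_measurable[OF assms] by simp
  obtain C where C: "C \<ge> 0" "\<And>x. cmod (\<phi> x) \<le> C * (rho x)\<^sup>2"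
    using test_fun_bound[OF assms] by blast
  show "integrable lborel (\<lambda>x. (cmod (\<phi> x))\<^sup>2)"
  proof (rule integrable_rho_bound)
    fix x
    have "(cmod (\<phi> x))\<^sup>2 \<le> (C * rho x)\<^sup>2"
      using rho_square_bound[OF C(2,1), of x] by (intro power_mono) auto
    also have "\<dots> \<le> C\<^sup>2 * rho x"
      using rho_square_le[of x] by (simp add: power_mult_distrib mult_left_mono)
    finally show "norm ((cmod (\<phi> x))\<^sup>2) \<le> C\<^sup>2 * rho x" by simp
  qed (use test_fun_measurable[OF assms] in auto)
qed

lemma is_ft_test_fun:
  fixes \<phi> :: "'a::euclidean_space \<Rightarrow> complex"
  assumes \<phi>: "test_fun U \<phi>"
  shows "is_ft \<phi> (ft \<phi>)"
  unfolding is_ft_def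
proof (intro conjI allI impI)
  show "ft \<phi> \<in> borel_measurable lborel" using ft_measurable[OF \<phi>] by simp
  fix \<psi> :: "'a \<Rightarrow> complex" assume \<psi>: "test_fun UNIV \<psi>"
  have *: "integrable lborel (\<lambda>x. f x * ft g x)"
    if f: "integrable lborel f" and g: "test_fun V g" for V and f g :: "'a \<Rightarrow> complex"
  proof -
    have [measurable]: "f \<in> borel_measurable borel" "ft g \<in> borel_measurable borel"
      using borel_measurable_integrable[OF f] ft_measurable[OF g] by auto
    show ?thesis
      using cmod_ft_le[OF test_fun_integrable[OF g]]
      by (intro Bochner_Integration.integrable_bound[OF integrable_mult_left[OF integrable_norm[OF f], of "LINT x|lborel. cmod (g x)"]])
         (auto simp: norm_mult intro!: mult_left_mono)
  qed
  show "integrable lborel (\<lambda>x. \<phi> x * ft \<psi> x)" by (rule *[OF test_fun_integrable[OF \<phi>] \<psi>])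
  show "integrable lborel (\<lambda>\<xi>. ft \<phi> \<xi> * \<psi> \<xi>)"
    using *[OF test_fun_integrable[OF \<psi>] \<phi>] by (simp add: mult.commute)
  show "(LINT x|lborel. \<phi> x * ft \<psi> x) = (LINT \<xi>|lborel. ft \<phi> \<xi> * \<psi> \<xi>)"
    by (intro ft_exchange test_fun_integrable[OF \<phi>] test_fun_integrable[OF \<psi>])
qed (rule test_fun_L2[OF \<phi>])


section \<open>Supports of elements of Hs_tilde\<close>

text \<open>\<open>FT\<close> is a choice among transforms; agreement almost everywhere lets any
  known transform replace it inside an integral.\<close>

lemma is_ft_unique:
  assumes "is_ft u g" "is_ft u h"
  shows "AE \<xi> in lborel. g \<xi> = h \<xi>"
proof -
  have "AE \<xi> in lborel. \<xi> \<in> UNIV \<longrightarrow> g \<xi> - h \<xi> = 0"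
    using assms by (intro AE_zero_if_test_integrals_zero) (auto simp: is_ft_def left_diff_distrib)
  then show ?thesis by simp
qed

lemma is_ft_FT: "is_ft u g \<Longrightarrow> is_ft u (FT u)"
  unfolding FT_def by (metis someI)

lemma cmod_diff_square_le: "(cmod (a - b))\<^sup>2 \<le> 2 * (cmod a)\<^sup>2 + 2 * (cmod b)\<^sup>2"
proof -
  have "(cmod (a - b))\<^sup>2 \<le> (cmod a + cmod b)\<^sup>2"
    by (intro power_mono norm_triangle_ineq4) simp
  also have "\<dots> \<le> 2 * (cmod a)\<^sup>2 + 2 * (cmod b)\<^sup>2"
    using sum_squares_bound[of "cmod a" "cmod b"] by (simp add: power2_sum)
  finally show ?thesis .
qed

lemma integrable_weighted_diff:
  assumes [measurable]: "g \<in> borel_measurable lborel" "h \<in> borel_measurable lborel" "w \<in> borel_measurable lborel"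
    and w: "\<And>x. w x \<ge> 0"
    and "integrable lborel (\<lambda>x. w x * (cmod (g x))\<^sup>2)" "integrable lborel (\<lambda>x. w x * (cmod (h x))\<^sup>2)"
  shows "integrable lborel (\<lambda>x. w x * (cmod (g x - h x))\<^sup>2)"
proof (rule Bochner_Integration.integrable_bound)
  show "integrable lborel (\<lambda>x. 2 * (w x * (cmod (g x))\<^sup>2) + 2 * (w x * (cmod (h x))\<^sup>2))"
    by (intro Bochner_Integration.integrable_add integrable_mult_right assms)
  show "AE x in lborel. norm (w x * (cmod (g x - h x))\<^sup>2) \<le> norm (2 * (w x * (cmod (g x))\<^sup>2) + 2 * (w x * (cmod (h x))\<^sup>2))"
  proof (rule AE_I2)
    fix x
    have "w x * (cmod (g x - h x))\<^sup>2 \<le> w x * (2 * (cmod (g x))\<^sup>2 + 2 * (cmod (h x))\<^sup>2)"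
      by (intro mult_left_mono cmod_diff_square_le w)
    then show "norm (w x * (cmod (g x - h x))\<^sup>2) \<le> norm (2 * (w x * (cmod (g x))\<^sup>2) + 2 * (w x * (cmod (h x))\<^sup>2))"
      using w[of x] by (simp add: algebra_simps)
  qed
qed measurable

lemma is_ft_diff:
  assumes "is_ft u g" "is_ft v h"
  shows "is_ft (\<lambda>x. u x - v x) (\<lambda>\<xi>. g \<xi> - h \<xi>)"
proof -
  have "L2 (\<lambda>x. u x - v x)"
    using assms integrable_weighted_diff[of u v "\<lambda>_. 1"] by (auto simp: is_ft_def L2_def)
  then show ?thesis
    using assms by (auto simp: is_ft_def left_diff_distrib)
qed

lemma integrable_weighted_ft_test_fun:
  fixes \<phi> :: "'a::euclidean_space \<Rightarrow> complex"
  assumes \<phi>: "test_fun U \<phi>" and s: "s \<le> 1"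
  shows "integrable lborel (\<lambda>\<xi>. (1 + (norm \<xi>)\<^sup>2) powr s * (cmod (ft \<phi> \<xi>))\<^sup>2)"
proof -
  have [measurable]: "ft \<phi> \<in> borel_measurable borel" by (rule ft_measurable[OF \<phi>])
  obtain C where C: "C \<ge> 0" "\<And>\<xi>. cmod (ft \<phi> \<xi>) \<le> C * (rho \<xi>)\<^sup>2"
    using ft_test_fun_bound[OF \<phi>] by blast
  show ?thesis
  proof (rule integrable_rho_bound)
    fix \<xi> :: 'a
    have "(1 + (norm \<xi>)\<^sup>2) powr s \<le> (1 + (norm \<xi>)\<^sup>2) powr 1"
      using s by (intro powr_mono) auto
    also have "\<dots> \<le> 1 / rho \<xi>"
      using one_plus_norm_le_inverse_rho[of \<xi>] by (simp add: add_nonneg_nonneg)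
    finally have "(1 + (norm \<xi>)\<^sup>2) powr s * (cmod (ft \<phi> \<xi>))\<^sup>2 \<le> 1 / rho \<xi> * (C * rho \<xi>)\<^sup>2"
      using rho_pos[of \<xi>] rho_square_bound[OF C(2,1), of \<xi>] by (intro mult_mono power_mono) auto
    then show "norm ((1 + (norm \<xi>)\<^sup>2) powr s * (cmod (ft \<phi> \<xi>))\<^sup>2) \<le> C\<^sup>2 * rho \<xi>"
      by (simp add: power2_eq_square)
  qed measurable
qed

text \<open>For s >= 0 the weight (1 + |\<xi>|^2)^s is at least 1, so smallness in H^s is smallness
  of the transform in L2.\<close>

lemma FT_L2_le_hs_norm:
  fixes u :: "'a::euclidean_space \<Rightarrow> complex"
  assumes s: "0 \<le> s" "s \<le> 1" and u: "Hs s u" and \<phi>: "test_fun U \<phi>"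
  defines "v \<equiv> \<lambda>x. u x - \<phi> x"
  shows "is_ft v (FT v)" "integrable lborel (\<lambda>\<xi>. (cmod (FT v \<xi>))\<^sup>2)"
    "(LINT \<xi>|lborel. (cmod (FT v \<xi>))\<^sup>2) \<le> (hs_norm s v)\<^sup>2"
proof -
  let ?w = "\<lambda>\<xi>::'a. (1 + (norm \<xi>)\<^sup>2) powr s"
  obtain g where g: "is_ft u g" "integrable lborel (\<lambda>\<xi>. ?w \<xi> * (cmod (g \<xi>))\<^sup>2)"
    using u by (auto simp: Hs_def)
  have v: "is_ft v (\<lambda>\<xi>. g \<xi> - ft \<phi> \<xi>)"
    unfolding v_def by (rule is_ft_diff[OF g(1) is_ft_test_fun[OF \<phi>]])
  show F: "is_ft v (FT v)" by (rule is_ft_FT[OF v])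
  then have m[measurable]: "FT v \<in> borel_measurable borel" by (simp add: is_ft_def)
  \<comment> \<open>Integrability has to be secured first: for a non-integrable function the
    integral has the default value 0, and \<open>hs_norm s v\<close> would then bound
    nothing.\<close>
  have "integrable lborel (\<lambda>\<xi>. ?w \<xi> * (cmod (g \<xi> - ft \<phi> \<xi>))\<^sup>2)"
    using g ft_measurable[OF \<phi>]
    by (intro integrable_weighted_diff integrable_weighted_ft_test_fun[OF \<phi>] s) (auto simp: is_ft_def)
  then have i: "integrable lborel (\<lambda>\<xi>. ?w \<xi> * (cmod (FT v \<xi>))\<^sup>2)"
    by (rule integrable_cong_AE_imp) (use is_ft_unique[OF v F] in \<open>auto elim: eventually_mono\<close>)
  have le: "(cmod (FT v \<xi>))\<^sup>2 \<le> ?w \<xi> * (cmod (FT v \<xi>))\<^sup>2" for \<xi>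
    using s ge_one_powr_ge_zero[of "1 + (norm \<xi>)\<^sup>2" s] by (simp add: mult_le_cancel_right1)
  show i2: "integrable lborel (\<lambda>\<xi>. (cmod (FT v \<xi>))\<^sup>2)"
    by (rule Bochner_Integration.integrable_bound[OF i]) (use le in auto)
  have "(LINT \<xi>|lborel. (cmod (FT v \<xi>))\<^sup>2) \<le> (LINT \<xi>|lborel. ?w \<xi> * (cmod (FT v \<xi>))\<^sup>2)"
    by (rule integral_mono[OF i2 i le])
  then show "(LINT \<xi>|lborel. (cmod (FT v \<xi>))\<^sup>2) \<le> (hs_norm s v)\<^sup>2"
    by (simp add: hs_norm_def)
qed

section \<open>Test functions as limits of Fourier transforms\<close>

lemma rho_scale_ge: "\<bar>h\<bar> \<le> 1 \<Longrightarrow> rho x \<le> rho (h *\<^sub>R x)"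
proof -
  assume "\<bar>h\<bar> \<le> 1"
  then have "(h * a)\<^sup>2 \<le> a\<^sup>2" for a
    by (simp add: power_mult_distrib abs_square_le_1 mult_left_le_one_le)
  then show ?thesis
    unfolding rho_def by (intro prod_mono) (auto intro!: frac_le add_pos_nonneg)
qed

lemma test_fun_uminus:
  assumes "test_fun U \<kappa>"
  shows "test_fun UNIV (\<lambda>x. \<kappa> (- x))"
proof (rule test_funI)
  have "Ck k (\<lambda>x. f (- x))" if "\<And>j. Ck j f" for k and f :: "'a \<Rightarrow> complex"
    using that
  proof (induction k arbitrary: f)
    case 0
    have "continuous_on UNIV f" using 0[of 0] by simp
    then show ?case by (auto intro!: continuous_on_compose2[of UNIV f] continuous_intros)
  next
    case (Suc k)
    have d: "(f has_derivative frechet_derivative f (at x)) (at x)" for x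
      using Suc.prems[of "Suc 0"] by (simp add: frechet_derivative_works)
    show ?case
    proof (rule Ck_SucI)
      show "((\<lambda>x. f (- x)) has_derivative (\<lambda>h. frechet_derivative f (at (- x)) (- h))) (at x)" for x
        by (rule has_derivative_compose[of uminus _ x UNIV f, OF _ d]) (auto intro!: derivative_eq_intros)
      fix b :: 'a assume b: "b \<in> Basis"
      have "Ck j (\<lambda>x. frechet_derivative f (at x) b)" for j
        using Suc.prems[of "Suc j"] b by simp
      then have "Ck k (\<lambda>x. -1 * frechet_derivative f (at (- x)) b)"
        by (intro Ck_mult Ck_const Suc.IH)
      moreover have "frechet_derivative f (at y) (- b) = -1 * frechet_derivative f (at y) b" for y
        using linear_neg[OF has_derivative_linear[OF d[of y]]] by simp
      ultimately show "Ck k (\<lambda>x. frechet_derivative f (at (- x)) (- b))" by simp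
    qed
  qed
  then show "smooth_fun (\<lambda>x. \<kappa> (- x))"
    using assms by (auto simp: test_fun_def smooth_fun_def)
  show "compact (uminus ` csupport \<kappa>)"
    using test_fun_compact[OF assms] by (rule compact_negations)
  show "x \<in> uminus ` csupport \<kappa>" if "\<kappa> (- x) \<noteq> 0" for x
    using in_csupport[of \<kappa>, OF that] by (metis image_eqI minus_minus)
qed simp

text \<open>A test function \<open>\<kappa>\<close> is, up to a constant, the limit of the Fourier transforms of
  \<open>\<eta> (h \<xi>) * ft \<kappa> (- \<xi>)\<close>, where \<open>\<eta>\<close> is a cut-off and \<open>h\<close> tends to zero. This replaces
  Plancherel's theorem, since the relation \<open>is_ft\<close> only tests against compactly supported functions.\<close>

lemma test_fun_ft_approximation:
  fixes \<kappa> :: "'a::euclidean_space \<Rightarrow> complex"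
  assumes \<kappa>: "test_fun U \<kappa>"
  obtains C c and \<psi> :: "nat \<Rightarrow> 'a \<Rightarrow> complex" where "C \<ge> 0" "c \<noteq> 0"
    "\<And>n. test_fun UNIV (\<psi> n)" "\<And>n \<xi>. cmod (\<psi> n \<xi>) \<le> C * rho \<xi>"
    "\<And>n x. cmod (ft (\<psi> n) x) \<le> C * rho x" "\<And>x. (\<lambda>n. ft (\<psi> n) x) \<longlonglongrightarrow> c * \<kappa> x"
proof -
  \<comment> \<open>Two applications of \<open>ft\<close> reflect the argument; reflecting \<kappa>
    beforehand compensates for this.\<close>
  define \<kappa>' where "\<kappa>' = (\<lambda>x. \<kappa> (- x))"
  have \<kappa>': "test_fun UNIV \<kappa>'" unfolding \<kappa>'_def by (rule test_fun_uminus[OF \<kappa>])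
  define \<eta> :: "'a \<Rightarrow> complex" where "\<eta> = (\<lambda>x. complex_of_real (bump 1 (- One) One x))"
  have \<eta>: "test_fun UNIV \<eta>" unfolding \<eta>_def by (rule test_fun_bump) auto
  have \<eta>1: "cmod (\<eta> x) \<le> 1" for x
    using bump_bounds[of 1 "- One" One x] by (simp add: \<eta>_def)
  have "\<eta> 0 \<noteq> 0"
    using bump_nonzero_iff[of 1 "- One" One "0::'a"] by (simp add: \<eta>_def mem_box)
  have [measurable]: "\<kappa> \<in> borel_measurable borel" "\<kappa>' \<in> borel_measurable borel" "\<eta> \<in> borel_measurable borel"
      "ft \<eta> \<in> borel_measurable borel" "ft \<kappa>' \<in> borel_measurable borel"
    using test_fun_measurable ft_measurable \<kappa> \<kappa>' \<eta> by auto
  \<comment> \<open>By inversion at 0 this mass is (2 pi)^n \<eta> 0, which is nonzero because 0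
    lies in the open box of the bump.\<close>
  define c where "c = (LINT z|lborel. ft \<eta> z)"
  have "c = complex_of_real ((2 * pi) ^ DIM('a)) * \<eta> 0"
    using Fourier_inversion[OF \<eta>, of 0] by (simp add: c_def)
  with \<open>\<eta> 0 \<noteq> 0\<close> have c: "c \<noteq> 0" by simp
  obtain C1 where C1: "C1 \<ge> 0" "\<And>\<xi>. cmod (ft \<kappa>' \<xi>) \<le> C1 * (rho \<xi>)\<^sup>2"
    using ft_test_fun_bound[OF \<kappa>'] by blast
  obtain C2 where C2: "C2 \<ge> 0" "\<And>\<xi>. cmod (ft \<eta> \<xi>) \<le> C2 * (rho \<xi>)\<^sup>2"
    using ft_test_fun_bound[OF \<eta>] by blast
  obtain C3 where C3: "C3 \<ge> 0" "\<And>\<xi>. cmod (\<kappa> \<xi>) \<le> C3 * (rho \<xi>)\<^sup>2"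
    using test_fun_bound[OF \<kappa>] by blast
  define h where "h n = inverse (real (Suc n))" for n
  have h: "h \<longlonglongrightarrow> 0" "h n > 0" "h n \<le> 1" for n
    using LIMSEQ_inverse_real_of_nat by (auto simp: h_def[abs_def] inverse_le_1_iff)
  define \<psi> where "\<psi> n \<xi> = ft \<kappa>' \<xi> * \<eta> (h n *\<^sub>R \<xi>)" for n \<xi>
  \<comment> \<open>The transform of a product is a convolution: the scaled cut-off contributes an
    approximate identity built from ft \<eta>. The substitution y = - x + h z produces a Jacobian
    that cancels the scaling factor of that transform.\<close>
  have eq: "ft (\<psi> n) x = (LINT z|lborel. ft \<eta> z * \<kappa> (x - h n *\<^sub>R z))" for n x
  proof -
    define g where "g \<xi> = cis (- (\<xi> \<bullet> x)) * \<eta> (h n *\<^sub>R \<xi>)" for \<xi>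
    have "integrable lborel (\<lambda>\<xi>. \<eta> (0 + h n *\<^sub>R \<xi>))"
      using test_fun_integrable[OF \<eta>] h(2)[of n] by (subst integrable_affine_iff) auto
    then have g: "integrable lborel g"
      by (rule Bochner_Integration.integrable_bound) (auto simp: g_def[abs_def] norm_mult)
    have "ft (\<psi> n) x = (LINT \<xi>|lborel. g \<xi> * ft \<kappa>' \<xi>)"
      by (simp add: ft_def[of "\<psi> n"] \<psi>_def g_def mult_ac)
    also have "\<dots> = (LINT y|lborel. ft g y * \<kappa>' y)"
      by (rule ft_exchange[OF g test_fun_integrable[OF \<kappa>']])
    also have "\<dots> = \<bar>h n\<bar> ^ DIM('a) *\<^sub>R (LINT z|lborel. ft g (- x + h n *\<^sub>R z) * \<kappa>' (- x + h n *\<^sub>R z))"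
    proof (rule integral_affine)
      show "(\<lambda>y. ft g y * \<kappa>' y) \<in> borel_measurable lborel"
        unfolding ft_def g_def by measurable
    qed (use h(2)[of n] in auto)
    also have "(LINT z|lborel. ft g (- x + h n *\<^sub>R z) * \<kappa>' (- x + h n *\<^sub>R z))
        = (LINT z|lborel. (1 / h n ^ DIM('a)) *\<^sub>R (ft \<eta> z * \<kappa> (x - h n *\<^sub>R z)))"
    proof (intro Bochner_Integration.integral_cong refl)
      fix z
      have "ft \<eta> z = \<bar>h n\<bar> ^ DIM('a) *\<^sub>R (LINT \<xi>|lborel. cis (- ((0 + h n *\<^sub>R \<xi>) \<bullet> z)) * \<eta> (0 + h n *\<^sub>R \<xi>))"
        unfolding ft_def using h(2)[of n] by (intro integral_affine) auto
      moreover have "ft g (- x + h n *\<^sub>R z) = (LINT \<xi>|lborel. cis (- ((0 + h n *\<^sub>R \<xi>) \<bullet> z)) * \<eta> (0 + h n *\<^sub>R \<xi>))"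
        unfolding ft_def g_def
        by (intro Bochner_Integration.integral_cong refl)
           (simp add: cis_mult inner_add_right inner_diff_right flip: mult.assoc)
      ultimately have "ft g (- x + h n *\<^sub>R z) = (1 / h n ^ DIM('a)) *\<^sub>R ft \<eta> z"
        using h(2)[of n] by simp
      then show "ft g (- x + h n *\<^sub>R z) * \<kappa>' (- x + h n *\<^sub>R z) = (1 / h n ^ DIM('a)) *\<^sub>R (ft \<eta> z * \<kappa> (x - h n *\<^sub>R z))"
        by (simp add: \<kappa>'_def)
    qed
    finally show ?thesis using h(2)[of n] by simp
  qed
  define K where "K = C2 * C3 * 2 ^ DIM('a)"
  have K: "K \<ge> 0" using C2(1) C3(1) by (simp add: K_def)
  \<comment> \<open>Of the two factors \<open>rho z\<close> bounding ft \<eta>, one absorbs the loss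
    1 / \<open>rho z\<close> from translating \<kappa>, the other remains integrable in z. Hence a
    bound in x uniform in n.\<close>
  have bound: "cmod (ft \<eta> z * \<kappa> (x - h n *\<^sub>R z)) \<le> K * rho x * rho z" for x z n
  proof -
    have "cmod (\<kappa> (x - h n *\<^sub>R z)) \<le> C3 * rho (x - h n *\<^sub>R z)"
      by (rule rho_square_bound[OF C3(2,1)])
    also have "\<dots> \<le> C3 * (2 ^ DIM('a) * rho x / rho (h n *\<^sub>R z))"
      by (intro mult_left_mono rho_diff_le C3)
    also have "\<dots> \<le> C3 * (2 ^ DIM('a) * rho x / rho z)"
      using rho_scale_ge[of "h n" z] h(2)[of n] h(3)[of n] rho_pos less_imp_le[OF rho_pos]
      by (intro mult_left_mono C3 divide_left_mono mult_nonneg_nonneg mult_pos_pos) auto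
    finally have "cmod (ft \<eta> z * \<kappa> (x - h n *\<^sub>R z)) \<le> C2 * (rho z)\<^sup>2 * (C3 * (2 ^ DIM('a) * rho x / rho z))"
      unfolding norm_mult using C2 by (intro mult_mono) auto
    also have "\<dots> = K * rho x * rho z"
      by (simp add: K_def power2_eq_square)
    finally show ?thesis .
  qed
  show ?thesis
  proof (rule that[of "max C1 (K * (LINT z|lborel. rho (z::'a)))" c \<psi>])
    show "max C1 (K * (LINT z|lborel. rho (z::'a))) \<ge> 0" using C1 by simp
    show "c \<noteq> 0" by (rule c)
    show "test_fun UNIV (\<psi> n)" for n
    proof -
      \<comment> \<open>Dilating a bump gives another bump, with steepness h on the box enlarged by
        1 / h, so compact support persists.\<close>
      have "\<eta> (h n *\<^sub>R \<xi>) = complex_of_real (bump (h n) (- ((1 / h n) *\<^sub>R One)) ((1 / h n) *\<^sub>R One) \<xi>)" for \<xi>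
        unfolding \<eta>_def bump_def using h(2)[of n]
        by (auto intro!: arg_cong[where f = complex_of_real] prod.cong arg_cong2[where f = "(*)"]
              arg_cong[where f = "flatexp 0"] simp: algebra_simps)
      moreover have "test_fun UNIV (\<lambda>\<xi>. complex_of_real (bump (h n) (- ((1 / h n) *\<^sub>R One)) ((1 / h n) *\<^sub>R One) \<xi>))"
        using h(2) by (intro test_fun_bump) auto
      ultimately show ?thesis
        unfolding \<psi>_def using Ck_ft[OF \<kappa>'] by (intro test_fun_mult_smooth) (simp_all add: smooth_fun_def)
    qed
    show "cmod (\<psi> n \<xi>) \<le> max C1 (K * (LINT z|lborel. rho (z::'a))) * rho \<xi>" for n \<xi>
    proof -
      have "cmod (\<psi> n \<xi>) \<le> cmod (ft \<kappa>' \<xi>)"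
        using \<eta>1[of "h n *\<^sub>R \<xi>"] by (simp add: \<psi>_def norm_mult mult_left_le)
      also have "\<dots> \<le> C1 * rho \<xi>" by (rule rho_square_bound[OF C1(2,1)])
      also have "\<dots> \<le> max C1 (K * (LINT z|lborel. rho (z::'a))) * rho \<xi>"
        using less_imp_le[OF rho_pos] by (intro mult_right_mono) auto
      finally show ?thesis .
    qed
    show "cmod (ft (\<psi> n) x) \<le> max C1 (K * (LINT z|lborel. rho (z::'a))) * rho x" for n x
    proof -
      have "cmod (ft (\<psi> n) x) \<le> (LINT z|lborel. cmod (ft \<eta> z * \<kappa> (x - h n *\<^sub>R z)))"
        unfolding eq by (rule integral_norm_bound)
      also have "\<dots> \<le> (LINT z|lborel. K * rho x * rho (z::'a))"
      proof (rule integral_mono)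
        show "integrable lborel (\<lambda>z. cmod (ft \<eta> z * \<kappa> (x - h n *\<^sub>R z)))"
          by (intro integrable_norm integrable_rho_bound[where C = "K * rho x"] bound) simp
      qed (auto intro!: integrable_mult_right integrable_rho bound)
      also have "\<dots> = K * (LINT z|lborel. rho (z::'a)) * rho x" by simp
      also have "\<dots> \<le> max C1 (K * (LINT z|lborel. rho (z::'a))) * rho x"
        using less_imp_le[OF rho_pos] by (intro mult_right_mono) auto
      finally show ?thesis .
    qed
    show "(\<lambda>n. ft (\<psi> n) x) \<longlonglongrightarrow> c * \<kappa> x" for x
    proof -
      have "(\<lambda>n. LINT z|lborel. ft \<eta> z * \<kappa> (x - h n *\<^sub>R z)) \<longlonglongrightarrow> (LINT z|lborel. ft \<eta> z * \<kappa> (x - 0 *\<^sub>R z))"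
      proof (rule integral_dominated_convergence[where w = "\<lambda>z. K * rho x * rho z"])
        have "isCont \<kappa> x" for x
          using test_fun_continuous[OF \<kappa>, of UNIV] by (simp add: continuous_on_eq_continuous_at)
        then show "AE z in lborel. (\<lambda>n. ft \<eta> z * \<kappa> (x - h n *\<^sub>R z)) \<longlonglongrightarrow> ft \<eta> z * \<kappa> (x - 0 *\<^sub>R z)"
          by (intro AE_I2 tendsto_intros isCont_tendsto_compose[of _ \<kappa>] h)
        show "AE z in lborel. norm (ft \<eta> z * \<kappa> (x - h n *\<^sub>R z)) \<le> K * rho x * rho z" for n
          using bound by simp
      qed (auto intro!: integrable_mult_right integrable_rho)
      then show ?thesis by (simp add: eq c_def)
    qed
  qed
qed

lemma mult_le_sum_squares: "cmod a * cmod b \<le> (cmod a)\<^sup>2 + (cmod b)\<^sup>2"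
proof -
  have "0 \<le> cmod a * cmod b" by simp
  then show ?thesis
    using sum_squares_bound[of "cmod a" "cmod b"] by linarith
qed

lemma integrable_L2_mult:
  assumes "L2 u" "L2 v"
  shows "integrable lborel (\<lambda>x. u x * v x)"
proof (rule Bochner_Integration.integrable_bound)
  show "integrable lborel (\<lambda>x. (cmod (u x))\<^sup>2 + (cmod (v x))\<^sup>2)"
    using assms by (simp add: L2_def)
  show "(\<lambda>x. u x * v x) \<in> borel_measurable lborel"
    using assms by (auto simp: L2_def)
  show "AE x in lborel. norm (u x * v x) \<le> norm ((cmod (u x))\<^sup>2 + (cmod (v x))\<^sup>2)"
    using mult_le_sum_squares by (auto simp: norm_mult)
qed

lemma L2_rho_bound:
  assumes "f \<in> borel_measurable lborel" "\<And>x. cmod (f x) \<le> C * rho x"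
  shows "L2 f"
  unfolding L2_def
proof
  show "integrable lborel (\<lambda>x. (cmod (f x))\<^sup>2)"
  proof (rule integrable_rho_bound)
    fix x
    have "(cmod (f x))\<^sup>2 \<le> (C * rho x)\<^sup>2"
      using assms(2)[of x] by (intro power_mono) auto
    also have "\<dots> \<le> C\<^sup>2 * rho x"
      using rho_square_le[of x] by (simp add: power_mult_distrib mult_left_mono)
    finally show "norm ((cmod (f x))\<^sup>2) \<le> C\<^sup>2 * rho x" by simp
  qed (use assms(1) in auto)
qed (rule assms(1))

text \<open>An approximating \<phi> supported in \<Omega> is invisible to a test function \<kappa>
  supported in V, so the pairing of u with \<kappa> equals that of u - \<phi>. Replacing \<kappa> by
  the transforms ft (\<psi> n) moves this pairing to the Fourier side, where the H^s norm controls
  it.\<close>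

lemma Hs_tilde_AE_zero:
  fixes u :: "'a::euclidean_space \<Rightarrow> complex"
  assumes s: "0 \<le> s" "s \<le> 1" and u: "Hs_tilde s \<Omega> u" and V: "open V" "V \<inter> \<Omega> = {}"
  shows "AE x in lborel. x \<in> V \<longrightarrow> u x = 0"
proof (rule AE_zero_if_test_integrals_zero[OF V(1)])
  have Hs: "Hs s u" using u by (simp add: Hs_tilde_def)
  then have L2u: "L2 u" by (auto simp: Hs_def is_ft_def)
  then show "u \<in> borel_measurable lborel" by (simp add: L2_def)
  fix \<kappa> :: "'a \<Rightarrow> complex" assume \<kappa>: "test_fun V \<kappa>"
  show int: "integrable lborel (\<lambda>x. u x * \<kappa> x)"
    by (intro integrable_L2_mult L2u test_fun_L2[OF \<kappa>])
  obtain C c and \<psi> :: "nat \<Rightarrow> 'a \<Rightarrow> complex" where C: "C \<ge> 0" "c \<noteq> 0"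
    "\<And>n. test_fun UNIV (\<psi> n)" "\<And>n \<xi>. cmod (\<psi> n \<xi>) \<le> C * rho \<xi>"
    "\<And>n x. cmod (ft (\<psi> n) x) \<le> C * rho x" "\<And>x. (\<lambda>n. ft (\<psi> n) x) \<longlonglongrightarrow> c * \<kappa> x"
    using test_fun_ft_approximation[OF \<kappa>] by blast
  define M where "M = (LINT \<xi>|lborel. (C * rho (\<xi>::'a))\<^sup>2)"
  have iM: "integrable lborel (\<lambda>\<xi>::'a. (C * rho \<xi>)\<^sup>2)"
  proof -
    have "cmod (complex_of_real (C * rho x)) = C * rho x" for x :: 'a
      using C(1) less_imp_le[OF rho_pos[of x]] by (simp add: norm_mult)
    then show ?thesis
      using L2_rho_bound[of "\<lambda>x::'a. complex_of_real (C * rho x)" C]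
      by (simp only: L2_def) simp
  qed
  \<comment> \<open>Only \<phi> depends on \<epsilon>; the functions \<psi> n and the constants
    \<open>C\<close>, \<open>c\<close>, \<open>M\<close> were fixed before, so \<epsilon> can tend
    to 0 at the end.\<close>
  have "cmod (c * (LINT x|lborel. u x * \<kappa> x)) \<le> \<epsilon> * (1 + M)" if \<epsilon>: "\<epsilon> > 0" for \<epsilon>
  proof -
    obtain \<phi> where \<phi>: "test_fun \<Omega> \<phi>" "hs_norm s (\<lambda>x. u x - \<phi> x) < \<epsilon>"
      using u \<epsilon> by (auto simp: Hs_tilde_def)
    define v where "v = (\<lambda>x. u x - \<phi> x)"
    note FT = FT_L2_le_hs_norm[OF s Hs \<phi>(1), folded v_def]
    have L2v: "L2 v" using FT(1) by (simp add: is_ft_def)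
    have [measurable]: "v \<in> borel_measurable borel" "FT v \<in> borel_measurable borel" "\<kappa> \<in> borel_measurable borel"
      "\<psi> n \<in> borel_measurable borel" "ft (\<psi> n) \<in> borel_measurable borel" for n
      using L2v FT(1) test_fun_measurable[OF \<kappa>] test_fun_measurable[OF C(3)] ft_measurable[OF C(3)]
      by (auto simp: L2_def is_ft_def)
    have "0 \<le> hs_norm s v" by (simp add: hs_norm_def)
    then have "(hs_norm s v)\<^sup>2 \<le> \<epsilon>\<^sup>2" using \<phi>(2) by (intro power_mono) (auto simp: v_def)
    with FT(3) have F: "(LINT \<xi>|lborel. (cmod (FT v \<xi>))\<^sup>2) \<le> \<epsilon>\<^sup>2" by linarith
    have b: "cmod (LINT x|lborel. v x * ft (\<psi> n) x) \<le> \<epsilon> * (1 + M)" for n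
    proof -
      have "(LINT x|lborel. v x * ft (\<psi> n) x) = (LINT \<xi>|lborel. FT v \<xi> * \<psi> n \<xi>)"
        using FT(1) C(3)[of n] by (simp add: is_ft_def)
      also have "cmod \<dots> \<le> (LINT \<xi>|lborel. (1 / \<epsilon>) * (cmod (FT v \<xi>))\<^sup>2 + \<epsilon> * (C * rho \<xi>)\<^sup>2)"
      proof (rule order.trans[OF integral_norm_bound integral_mono])
        show "integrable lborel (\<lambda>\<xi>. cmod (FT v \<xi> * \<psi> n \<xi>))"
          using FT(1) C(3)[of n] by (simp add: is_ft_def)
        show "integrable lborel (\<lambda>\<xi>. (1 / \<epsilon>) * (cmod (FT v \<xi>))\<^sup>2 + \<epsilon> * (C * rho \<xi>)\<^sup>2)"
          by (intro Bochner_Integration.integrable_add integrable_mult_right FT(2) iM)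
        fix \<xi>
        have "cmod (FT v \<xi> * \<psi> n \<xi>) \<le> cmod (FT v \<xi>) * (C * rho \<xi>)"
          using C(4) by (simp add: norm_mult mult_left_mono)
        \<comment> \<open>Young's inequality with weights 1 / \<epsilon> and \<epsilon>: the
          transform of v has squared L2 norm at most \<epsilon>^2, so both terms integrate to
          O(\<epsilon>).\<close>
        also have "\<dots> \<le> (1 / \<epsilon>) * (cmod (FT v \<xi>))\<^sup>2 + \<epsilon> * (C * rho \<xi>)\<^sup>2"
        proof -
          define p q where "p = cmod (FT v \<xi>)" and "q = C * rho \<xi>"
          have pq: "p \<ge> 0" "q \<ge> 0"
            using C(1) less_imp_le[OF rho_pos[of \<xi>]] by (auto simp: p_def q_def)
          have "2 * (p * (\<epsilon> * q)) \<le> p\<^sup>2 + (\<epsilon> * q)\<^sup>2"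
            using sum_squares_bound[of p "\<epsilon> * q"] by (simp add: mult.assoc)
          moreover have "0 \<le> p * (\<epsilon> * q)" using pq \<epsilon> by simp
          ultimately have "\<epsilon> * (p * q) \<le> p\<^sup>2 + \<epsilon>\<^sup>2 * q\<^sup>2"
            by (simp add: power_mult_distrib algebra_simps)
          then have "(\<epsilon> * (p * q)) / \<epsilon> \<le> (p\<^sup>2 + \<epsilon>\<^sup>2 * q\<^sup>2) / \<epsilon>"
            using \<epsilon> by (intro divide_right_mono) auto
          then show ?thesis
            unfolding p_def[symmetric] q_def[symmetric]
            using \<epsilon> by (simp add: add_divide_distrib power2_eq_square)
        qed
        finally show "cmod (FT v \<xi> * \<psi> n \<xi>) \<le> (1 / \<epsilon>) * (cmod (FT v \<xi>))\<^sup>2 + \<epsilon> * (C * rho \<xi>)\<^sup>2" .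
      qed
      also have "\<dots> = (1 / \<epsilon>) * (LINT \<xi>|lborel. (cmod (FT v \<xi>))\<^sup>2) + \<epsilon> * M"
        unfolding M_def using FT(2) iM
        by (subst Bochner_Integration.integral_add) (auto simp del: times_divide_eq_left)
      also have "\<dots> \<le> (1 / \<epsilon>) * \<epsilon>\<^sup>2 + \<epsilon> * M"
        using F \<epsilon> by (intro add_right_mono mult_left_mono) auto
      also have "\<dots> = \<epsilon> * (1 + M)"
        using \<epsilon> by (simp add: power2_eq_square algebra_simps)
      finally show ?thesis .
    qed
    have "(\<lambda>n. LINT x|lborel. v x * ft (\<psi> n) x) \<longlonglongrightarrow> (LINT x|lborel. v x * (c * \<kappa> x))"
    proof (rule integral_dominated_convergence[where w = "\<lambda>x. (cmod (v x))\<^sup>2 + (C * rho x)\<^sup>2"])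
      show "AE x in lborel. (\<lambda>n. v x * ft (\<psi> n) x) \<longlonglongrightarrow> v x * (c * \<kappa> x)"
        by (intro AE_I2 tendsto_intros C)
      show "integrable lborel (\<lambda>x. (cmod (v x))\<^sup>2 + (C * rho x)\<^sup>2)"
        using L2v iM by (auto simp: L2_def)
      show "AE x in lborel. norm (v x * ft (\<psi> n) x) \<le> (cmod (v x))\<^sup>2 + (C * rho x)\<^sup>2" for n
      proof (rule AE_I2)
        fix x
        have "norm (v x * ft (\<psi> n) x) \<le> (cmod (v x))\<^sup>2 + (cmod (ft (\<psi> n) x))\<^sup>2"
          using mult_le_sum_squares by (simp add: norm_mult)
        also have "\<dots> \<le> (cmod (v x))\<^sup>2 + (C * rho x)\<^sup>2"
          using C(5) by (intro add_left_mono power_mono) auto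
        finally show "norm (v x * ft (\<psi> n) x) \<le> (cmod (v x))\<^sup>2 + (C * rho x)\<^sup>2" .
      qed
    qed auto
    then have "cmod (LINT x|lborel. v x * (c * \<kappa> x)) \<le> \<epsilon> * (1 + M)"
      by (intro LIMSEQ_le_const2[OF tendsto_norm]) (auto intro: b)
    \<comment> \<open>On V the function \<phi> vanishes, off V the function \<kappa> does.\<close>
    moreover have "v x * (c * \<kappa> x) = c * (u x * \<kappa> x)" for x
      using test_fun_outside[OF \<phi>(1), of x] test_fun_outside[OF \<kappa>, of x] V(2)
      by (cases "x \<in> V") (auto simp: v_def)
    ultimately show ?thesis by simp
  qed
  note bound = this
  have M: "M \<ge> 0" unfolding M_def by simp
  have "cmod (c * (LINT x|lborel. u x * \<kappa> x)) \<le> 0"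
  proof (rule field_le_epsilon)
    fix e :: real assume "e > 0"
    then show "cmod (c * (LINT x|lborel. u x * \<kappa> x)) \<le> 0 + e"
      using bound[of "e / (1 + M)"] M by (simp add: add_nonneg_eq_0_iff)
  qed
  then show "(LINT x|lborel. u x * \<kappa> x) = 0"
    using C(2) by simp
qed


section \<open>The fractional Laplacian off the support of a test function\<close>

text \<open>The density of the Levy measure of an s-stable subordinator, up to a constant. The
  indicator extends it to the line, so that t ranges over \<open>lborel\<close> in Fubini's
  theorem.\<close>

definition frac_weight :: "real \<Rightarrow> real \<Rightarrow> real" where
  "frac_weight s t = indicator {0<..} t * t powr (- 1 - s)"

lemma frac_weight_measurable[measurable]: "frac_weight s \<in> borel_measurable borel"
  unfolding frac_weight_def[abs_def] by measurable

lemma frac_weight_nonneg: "0 \<le> frac_weight s t"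
  by (simp add: frac_weight_def)

text \<open>Near 0 the integrand is t^(-s), integrable since s < 1; at infinity it is t^(-1-s),
  integrable since s > 0.\<close>

lemma integrable_frac_weight_min:
  assumes s: "0 < s" "s < 1"
  shows "integrable lborel (\<lambda>t. frac_weight s t * min 1 t)"
proof -
  have *: "integrable lborel (\<lambda>t::real. indicator A t * t powr a)"
    if "(\<lambda>t. t powr a) integrable_on A" "A \<in> sets borel" for A a
  proof -
    have "(\<lambda>t. t powr a) absolutely_integrable_on A"
      by (rule nonnegative_absolutely_integrable_1[OF that(1)]) simp
    then have "integrable lebesgue (\<lambda>t. indicator A t * t powr a)"
      by (simp add: set_integrable_def)
    then show ?thesis
      using that(2) by (subst (asm) integrable_completion) auto
  qed
  have 1: "integrable lborel (\<lambda>t::real. indicator {0..1} t * t powr (- s))"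
    using s has_integral_powr_from_0[of "- s" 1] by (intro *) (auto simp: integrable_on_def)
  have 2: "integrable lborel (\<lambda>t::real. indicator {1..} t * t powr (- 1 - s))"
    using s has_integral_powr_to_inf[of "- 1 - s" 1] by (intro *) (auto simp: integrable_on_def)
  show ?thesis
  proof (rule Bochner_Integration.integrable_bound[OF Bochner_Integration.integrable_add[OF 1 2]])
    show "AE t in lborel. norm (frac_weight s t * min 1 t)
      \<le> norm (indicator {0..1} t * t powr (- s) + indicator {1..} t * t powr (- 1 - s))"
    proof (rule AE_I2)
      fix t :: real
      consider "t \<le> 0" | "0 < t" "t < 1" | "1 \<le> t" by linarith
      then show "norm (frac_weight s t * min 1 t)
        \<le> norm (indicator {0..1} t * t powr (- s) + indicator {1..} t * t powr (- 1 - s))"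
      proof cases
        case 2
        then have "t powr (- 1 - s) * t = t powr (- s)"
          using powr_add[of t "- 1 - s" 1] by simp
        with 2 show ?thesis by (simp add: frac_weight_def)
      qed (simp_all add: frac_weight_def indicator_def)
    qed
  qed simp
qed

text \<open>Homogeneity of t^(-1-s) dt under dilation. Both |\<xi>|^(2 s) and |z|^(-n-2s) arise from
  it, with \<mu> = |\<xi>|^2 and \<mu> = 4 / |z|^2, leaving constants that depend only on s and
  n.\<close>

lemma
  assumes \<mu>: "\<mu> > 0" and F[measurable]: "F \<in> borel_measurable borel"
  shows integrable_frac_weight_scale: "integrable lborel (\<lambda>t. frac_weight s t * F t)
      \<Longrightarrow> integrable lborel (\<lambda>t. frac_weight s t * F (\<mu> * t))"
    and integral_frac_weight_scale: "(LINT t|lborel. frac_weight s t * F (\<mu> * t))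
      = \<mu> powr s * (LINT t|lborel. frac_weight s t * F t)"
proof -
  have eq: "frac_weight s t * F (\<mu> * t) = \<mu> powr (1 + s) * (frac_weight s (0 + \<mu> * t) * F (0 + \<mu> * t))" for t
  proof (cases "t > 0")
    case True
    have "\<mu> powr (1 + s) * \<mu> powr (- 1 - s) = 1"
      using \<mu> powr_add[of \<mu> "1 + s" "- 1 - s"] by simp
    then show ?thesis
      using True \<mu> by (simp add: frac_weight_def powr_mult)
  qed (use \<mu> in \<open>auto simp: frac_weight_def zero_less_mult_iff\<close>)
  show "integrable lborel (\<lambda>t. frac_weight s t * F (\<mu> * t))" if "integrable lborel (\<lambda>t. frac_weight s t * F t)"
    unfolding eq using lborel_integrable_real_affine[OF that, of \<mu> 0] \<mu> by (intro integrable_mult_right) simp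
  have "(LINT t|lborel. frac_weight s t * F t) = \<mu> * (LINT t|lborel. frac_weight s (0 + \<mu> * t) * F (0 + \<mu> * t))"
    using lborel_integral_real_affine[of \<mu> "\<lambda>t. frac_weight s t * F t" 0] \<mu> by simp
  moreover have "(LINT t|lborel. frac_weight s t * F (\<mu> * t))
      = \<mu> powr (1 + s) * (LINT t|lborel. frac_weight s (0 + \<mu> * t) * F (0 + \<mu> * t))"
    unfolding eq by (rule integral_mult_right_zero)
  moreover have "\<mu> powr (1 + s) = \<mu> powr s * \<mu>"
    using \<mu> by (simp add: powr_add)
  ultimately show "(LINT t|lborel. frac_weight s t * F (\<mu> * t)) = \<mu> powr s * (LINT t|lborel. frac_weight s t * F t)"
    by simp
qed

text \<open>Strict positivity makes the constants in front of |\<xi>|^(2 s) and of the Riesz kernel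
  nonzero, so one can divide by the former and cancel the latter.\<close>

lemma
  assumes s: "0 < s" "s < 1" and F[measurable]: "F \<in> borel_measurable borel"
    and bound: "\<And>t. t > 0 \<Longrightarrow> 0 < F t \<and> F t \<le> K * min 1 t"
  shows integrable_frac_weight: "integrable lborel (\<lambda>t. frac_weight s t * F t)"
    and integral_frac_weight_pos: "0 < (LINT t|lborel. frac_weight s t * F t)"
proof -
  have nn: "0 \<le> frac_weight s t * F t" for t
    using bound[of t] by (cases "t > 0") (auto simp: frac_weight_def)
  show i: "integrable lborel (\<lambda>t. frac_weight s t * F t)"
  proof (rule Bochner_Integration.integrable_bound[OF integrable_mult_right[OF integrable_frac_weight_min[OF s], of K]])
    show "AE t in lborel. norm (frac_weight s t * F t) \<le> norm (K * (frac_weight s t * min 1 t))"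
    proof (rule AE_I2)
      fix t
      have "frac_weight s t * F t \<le> K * (frac_weight s t * min 1 t)"
        using bound[of t] by (cases "t > 0") (auto simp: frac_weight_def mult.left_commute intro!: mult_left_mono)
      then show "norm (frac_weight s t * F t) \<le> norm (K * (frac_weight s t * min 1 t))"
        using nn[of t] by (simp only: real_norm_def abs_of_nonneg)
    qed
  qed simp
  show "0 < (LINT t|lborel. frac_weight s t * F t)"
  proof (rule ccontr)
    assume "\<not> 0 < (LINT t|lborel. frac_weight s t * F t)"
    moreover have "0 \<le> (LINT t|lborel. frac_weight s t * F t)"
      using nn by (intro integral_nonneg_AE) simp
    ultimately have "AE t in lborel. frac_weight s t * F t = 0"
      using integral_nonneg_eq_0_iff_AE[OF i] nn by simp
    then have "AE t in lborel. t \<notin> {0<..<1::real}"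
    proof eventually_elim
      case (elim t)
      then show ?case using bound[of t] by (auto simp: frac_weight_def)
    qed
    then have "{0<..<1::real} \<in> null_sets lborel"
      by (subst AE_iff_null_sets) auto
    then show False by (simp add: null_sets_def)
  qed
qed

text \<open>The heat kernel in the self-similar variable 4 t / |z|^2, stripped of the factor (sqrt
  (4 pi) / |z|)^n.\<close>

definition heat_profile :: "nat \<Rightarrow> real \<Rightarrow> real" where
  "heat_profile n t = sqrt (1 / t) ^ n * exp (- 1 / t)"

lemma heat_profile_bound:
  assumes "t > 0"
  shows "0 < heat_profile n t \<and> heat_profile n t \<le> (2 + fact n + fact (n + 1)) * min 1 t"
proof
  show "0 < heat_profile n t" using assms by (simp add: heat_profile_def)
  define y where "y = 1 / t"
  have y: "y > 0" using assms by (simp add: y_def)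
  \<comment> \<open>Since min 1 t is at least 1 / (1 + y), it suffices to bound (1 + y) (1 + y^n)
    exp (- y); its four monomials are bounded by 0!, 1!, n! and (n + 1)!.\<close>
  define K :: real where "K = 2 + fact n + fact (n + 1)"
  have e: "y ^ k * exp (- y) \<le> fact k" for k
    using power_div_fact_le_exp[of y k] y by (simp add: exp_minus field_simps)
  have "sqrt y ^ n \<le> 1 + y ^ n"
  proof (cases "y \<le> 1")
    case True
    then have "sqrt y ^ n \<le> 1" using y by (intro power_le_one) auto
    then show ?thesis using y by (simp add: add_increasing2)
  next
    case False
    then have "sqrt y \<le> y" using sqrt_le_D[of y] real_le_lsqrt[of y y] by (auto intro!: real_le_lsqrt simp: power2_eq_square)
    then have "sqrt y ^ n \<le> y ^ n" using y by (intro power_mono) auto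
    then show ?thesis by simp
  qed
  then have "sqrt y ^ n * ((1 + y) * exp (- y)) \<le> (1 + y ^ n) * ((1 + y) * exp (- y))"
    using y by (intro mult_right_mono) auto
  also have "\<dots> = y ^ 0 * exp (- y) + y ^ 1 * exp (- y) + y ^ n * exp (- y) + y ^ (n + 1) * exp (- y)"
    by (simp add: algebra_simps)
  also have "\<dots> \<le> fact 0 + fact 1 + fact n + fact (n + 1)"
    by (intro add_mono e)
  finally have "(1 + y) * heat_profile n t \<le> K"
    by (simp add: heat_profile_def y_def K_def mult_ac)
  then have "heat_profile n t \<le> K / (1 + y)"
    using y by (simp add: field_simps)
  also have "K / (1 + y) \<le> K * min 1 t"
  proof -
    have "1 / (1 + y) \<le> 1" "1 / (1 + y) \<le> t"
      using y assms by (auto simp: y_def field_simps)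
    then have "K * (1 / (1 + y)) \<le> K * min 1 t"
      by (intro mult_left_mono) (auto simp: K_def)
    then show ?thesis by simp
  qed
  finally show "heat_profile n t \<le> (2 + fact n + fact (n + 1)) * min 1 t" by (simp add: K_def)
qed

lemma heat_eq_heat_profile:
  fixes z :: "'a::euclidean_space"
  assumes "t > 0" "z \<noteq> 0"
  shows "heat t z = (sqrt (4 * pi) / norm z) ^ DIM('a) * heat_profile DIM('a) (4 / (norm z)\<^sup>2 * t)"
proof -
  have "sqrt (pi / t) = sqrt (4 * pi) / norm z * sqrt (1 / (4 / (norm z)\<^sup>2 * t))"
    using assms by (simp add: real_sqrt_divide real_sqrt_mult)
  moreover have "- (norm z)\<^sup>2 / (4 * t) = - 1 / (4 / (norm z)\<^sup>2 * t)"
    using assms by simp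
  ultimately show ?thesis
    unfolding heat_def heat_profile_def by (simp only: power_mult_distrib mult.assoc)
qed

lemma
  fixes z :: "'a::euclidean_space" and s :: real
  assumes s: "0 < s" "s < 1"
  defines "B \<equiv> (LINT t|lborel. frac_weight s t * heat_profile DIM('a) t)"
  shows integrable_frac_weight_heat: "z \<noteq> 0 \<Longrightarrow> integrable lborel (\<lambda>t. frac_weight s t * heat t z)"
    and integral_frac_weight_heat: "z \<noteq> 0 \<Longrightarrow> (LINT t|lborel. frac_weight s t * heat t z)
      = B * sqrt (4 * pi) ^ DIM('a) * 4 powr s * norm z powr (- (DIM('a) + 2 * s))"
    and frac_weight_heat_constant_pos: "B * sqrt (4 * pi) ^ DIM('a) * 4 powr s > 0"
proof -
  have [measurable]: "heat_profile DIM('a) \<in> borel_measurable borel"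
    unfolding heat_profile_def[abs_def] by measurable
  have i: "integrable lborel (\<lambda>t. frac_weight s t * heat_profile DIM('a) t)"
    by (rule integrable_frac_weight[OF s]) (simp, rule heat_profile_bound)
  have "B > 0"
    unfolding B_def by (rule integral_frac_weight_pos[OF s]) (simp, rule heat_profile_bound)
  then show "B * sqrt (4 * pi) ^ DIM('a) * 4 powr s > 0" by simp
  assume z: "z \<noteq> 0"
  define \<mu> where "\<mu> = 4 / (norm z)\<^sup>2"
  have \<mu>: "\<mu> > 0" using z by (simp add: \<mu>_def)
  have eq: "frac_weight s t * heat t z
      = (sqrt (4 * pi) / norm z) ^ DIM('a) * (frac_weight s t * heat_profile DIM('a) (\<mu> * t))" for t
    using heat_eq_heat_profile[of t z] z by (cases "t > 0") (simp_all add: frac_weight_def \<mu>_def)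
  show "integrable lborel (\<lambda>t. frac_weight s t * heat t z)"
    unfolding eq by (intro integrable_mult_right integrable_frac_weight_scale i \<mu>) auto
  have "(LINT t|lborel. frac_weight s t * heat t z) = (sqrt (4 * pi) / norm z) ^ DIM('a) * (\<mu> powr s * B)"
    unfolding eq integral_mult_right_zero B_def by (subst integral_frac_weight_scale[OF \<mu>]) auto
  also have "\<mu> powr s = 4 powr s * norm z powr (- (2 * s))"
    using z by (simp add: \<mu>_def powr_divide powr_minus_divide powr_powr flip: powr_numeral)
  also have "(sqrt (4 * pi) / norm z) ^ DIM('a) = sqrt (4 * pi) ^ DIM('a) * norm z powr (- real DIM('a))"
    using z by (simp add: power_divide powr_minus_divide powr_realpow)
  also have "sqrt (4 * pi) ^ DIM('a) * norm z powr (- real DIM('a)) * (4 powr s * norm z powr (- (2 * s)) * B)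
      = B * sqrt (4 * pi) ^ DIM('a) * 4 powr s * (norm z powr (- real DIM('a)) * norm z powr (- (2 * s)))"
    by (simp only: mult_ac)
  also have "norm z powr (- real DIM('a)) * norm z powr (- (2 * s)) = norm z powr (- (DIM('a) + 2 * s))"
    by (simp add: powr_add[symmetric])
  finally show "(LINT t|lborel. frac_weight s t * heat t z)
      = B * sqrt (4 * pi) ^ DIM('a) * 4 powr s * norm z powr (- (DIM('a) + 2 * s))" .
qed

lemma frac_weight_exp:
  fixes s :: real
  assumes s: "0 < s" "s < 1"
  defines "A \<equiv> (LINT t|lborel. frac_weight s t * (1 - exp (- t)))"
  shows "A > 0" and "r \<ge> 0 \<Longrightarrow> (LINT t|lborel. frac_weight s t * (1 - exp (- (r\<^sup>2 * t)))) = A * r powr (2 * s)"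
proof -
  have b: "0 < 1 - exp (- t) \<and> 1 - exp (- t) \<le> 1 * min 1 t" if "t > 0" for t :: real
    using that exp_ge_add_one_self[of "- t"] by auto
  show "A > 0"
    unfolding A_def by (rule integral_frac_weight_pos[OF s]) (simp, rule b)
  assume r: "r \<ge> 0"
  show "(LINT t|lborel. frac_weight s t * (1 - exp (- (r\<^sup>2 * t)))) = A * r powr (2 * s)"
  proof (cases "r = 0")
    case False
    with r have "r > 0" by simp
    then have "(LINT t|lborel. frac_weight s t * (1 - exp (- (r\<^sup>2 * t)))) = (r\<^sup>2) powr s * A"
      unfolding A_def by (intro integral_frac_weight_scale[where F = "\<lambda>t. 1 - exp (- t)"]) auto
    also have "(r\<^sup>2) powr s = r powr (2 * s)"
      using \<open>r > 0\<close> by (simp add: powr_powr flip: powr_numeral)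
    finally show ?thesis by (simp add: mult.commute)
  qed simp
qed

text \<open>Subordination: \<open>|\<xi>|^(2 s)\<close> is a multiple of the integral of
  \<open>(1 - exp (- t |\<xi>|^2)) t^(- 1 - s)\<close> over \<open>t > 0\<close>. Off the support the first term
  contributes nothing, and the heat kernel integrates to the Riesz kernel.\<close>

lemma frac_lap_test_off_support:
  fixes s :: real
  assumes s: "0 < s" "s < 1"
  shows "\<exists>c>0. \<forall>U (\<phi> :: 'a::euclidean_space \<Rightarrow> complex) y d. test_fun U \<phi> \<longrightarrow> d > 0 \<longrightarrow> (\<forall>x. \<phi> x \<noteq> 0 \<longrightarrow> d \<le> norm (y - x)) \<longrightarrow>
      frac_lap_test s \<phi> y = - (complex_of_real c * (LINT x|lborel. \<phi> x * complex_of_real (norm (y - x) powr (- (DIM('a) + 2 * s)))))"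
proof -
  define A where "A = (LINT t|lborel. frac_weight s t * (1 - exp (- t)))"
  have A: "A > 0" unfolding A_def by (rule frac_weight_exp[OF s])
  define B where "B = (LINT t|lborel. frac_weight s t * heat_profile DIM('a) t) * sqrt (4 * pi) ^ DIM('a) * 4 powr s"
  have B: "B > 0" unfolding B_def by (rule frac_weight_heat_constant_pos[OF s])
  define p where "p = (2 * pi) ^ DIM('a)"
  have p: "p > 0" by (simp add: p_def)
  show ?thesis
  proof (intro exI[of _ "B / (A * p)"] conjI allI impI)
    show "B / (A * p) > 0" using A B p by simp
    fix U and \<phi> :: "'a \<Rightarrow> complex" and y :: 'a and d :: real
    assume \<phi>: "test_fun U \<phi>" and d: "d > 0" and "\<forall>x. \<phi> x \<noteq> 0 \<longrightarrow> d \<le> norm (y - x)"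
    then have off: "\<And>x. \<phi> x \<noteq> 0 \<Longrightarrow> d \<le> norm (y - x)" by blast
    have [measurable]: "\<phi> \<in> borel_measurable borel" "ft \<phi> \<in> borel_measurable borel"
      using test_fun_measurable[OF \<phi>] ft_measurable[OF \<phi>] by auto
    have "\<phi> y = 0" using off[of y] d by force
    obtain C where C: "C \<ge> 0" "\<And>\<xi>. cmod (ft \<phi> \<xi>) \<le> C * (rho \<xi>)\<^sup>2"
      using ft_test_fun_bound[OF \<phi>] by blast
    define G where "G \<xi> t = complex_of_real (frac_weight s t * (1 - exp (- ((norm \<xi>)\<^sup>2 * t)))) * (cis (\<xi> \<bullet> y) * ft \<phi> \<xi>)" for \<xi> t
    have i1: "integrable lborel (\<lambda>\<xi>. (1 + (norm \<xi>)\<^sup>2) * cmod (ft \<phi> \<xi>))"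
    proof (rule integrable_rho_bound)
      fix \<xi> :: 'a
      have "(1 + (norm \<xi>)\<^sup>2) * cmod (ft \<phi> \<xi>) \<le> 1 / rho \<xi> * (C * (rho \<xi>)\<^sup>2)"
        using one_plus_norm_le_inverse_rho[of \<xi>] C rho_pos[of \<xi>] by (intro mult_mono) auto
      then show "norm ((1 + (norm \<xi>)\<^sup>2) * cmod (ft \<phi> \<xi>)) \<le> C * rho \<xi>"
        by (simp add: power2_eq_square abs_mult)
    qed measurable
    \<comment> \<open>A product majorant for the first exchange of integrals: linear in t near 0 at
      the price of |\<xi>|^2, bounded for large t.\<close>
    have G_bound: "cmod (G \<xi> t) \<le> ((1 + (norm \<xi>)\<^sup>2) * cmod (ft \<phi> \<xi>)) * (frac_weight s t * min 1 t)" for \<xi> t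
    proof (cases "t > 0")
      case True
      define r where "r = (norm \<xi>)\<^sup>2"
      have r: "r \<ge> 0" by (simp add: r_def)
      have "1 - exp (- (r * t)) \<le> min 1 (r * t)"
        using exp_ge_add_one_self[of "- (r * t)"] by auto
      also have "\<dots> \<le> (1 + r) * min 1 t"
        using True r by (auto simp: min_def mult_left_le algebra_simps add_increasing2 intro: order.trans)
      finally have 1: "1 - exp (- (r * t)) \<le> (1 + r) * min 1 t" .
      have 0: "0 \<le> 1 - exp (- (r * t))" using r True by simp
      have "cmod (G \<xi> t) = frac_weight s t * (1 - exp (- (r * t))) * cmod (ft \<phi> \<xi>)"
        using 0 frac_weight_nonneg[of s t]
        unfolding G_def r_def norm_mult norm_of_real abs_mult norm_cis by (simp only: abs_of_nonneg mult_1_left)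
      also have "\<dots> \<le> frac_weight s t * ((1 + r) * min 1 t) * cmod (ft \<phi> \<xi>)"
        using 1 frac_weight_nonneg[of s t] by (intro mult_right_mono mult_left_mono) auto
      finally show ?thesis by (simp add: r_def mult_ac)
    qed (simp add: G_def frac_weight_def)
    define R where "R = (LINT \<xi>|lborel. cis (y \<bullet> \<xi>) * (complex_of_real (norm \<xi> powr (2 * s)) * ft \<phi> \<xi>))"
    \<comment> \<open>The heat kernel is radial and decreasing in |z|, so its value at
      \<open>d *\<^sub>R b\<close>, a vector of norm d, dominates it on the support of
      \<phi>.\<close>
    obtain b :: 'a where b: "b \<in> Basis" using nonempty_Basis by blast
    have "complex_of_real A * R = (LINT \<xi>|lborel. LINT t|lborel. G \<xi> t)"
    proof -
      have "(LINT t|lborel. G \<xi> t) = complex_of_real A * (cis (y \<bullet> \<xi>) * (complex_of_real (norm \<xi> powr (2 * s)) * ft \<phi> \<xi>))" for \<xi>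
      proof -
        have "(LINT t|lborel. G \<xi> t) = complex_of_real (LINT t|lborel. frac_weight s t * (1 - exp (- ((norm \<xi>)\<^sup>2 * t)))) * (cis (\<xi> \<bullet> y) * ft \<phi> \<xi>)"
          unfolding G_def by (simp only: integral_mult_left_zero integral_complex_of_real)
        also have "(LINT t|lborel. frac_weight s t * (1 - exp (- ((norm \<xi>)\<^sup>2 * t)))) = A * norm \<xi> powr (2 * s)"
          unfolding A_def by (rule frac_weight_exp(2)[OF s]) simp
        finally show ?thesis by (simp add: mult_ac inner_commute)
      qed
      then show ?thesis by (simp only: R_def integral_mult_right_zero)
    qed
    also have "\<dots> = (LINT t|lborel. LINT \<xi>|lborel. G \<xi> t)"
      by (rule Fubini_dominated[OF _ i1 integrable_frac_weight_min[OF s] G_bound]) (simp add: G_def)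
    also have "\<dots> = (LINT t|lborel. LINT x|lborel. - (\<phi> x * complex_of_real (frac_weight s t * heat t (y - x))))"
    proof (rule Bochner_Integration.integral_cong[OF refl])
      fix t :: real
      show "(LINT \<xi>|lborel. G \<xi> t) = (LINT x|lborel. - (\<phi> x * complex_of_real (frac_weight s t * heat t (y - x))))"
      proof (cases "t > 0")
        case True
        have j1: "integrable lborel (\<lambda>\<xi>. cis (\<xi> \<bullet> y) * ft \<phi> \<xi>)"
          by (rule Bochner_Integration.integrable_bound[OF ft_integrable[OF \<phi>]]) (auto simp: norm_mult)
        have j2: "integrable lborel (\<lambda>\<xi>. cis (\<xi> \<bullet> y) * complex_of_real (exp (- t * (norm \<xi>)\<^sup>2)) * ft \<phi> \<xi>)"
          by (rule Bochner_Integration.integrable_bound[OF ft_integrable[OF \<phi>]])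
             (use True in \<open>auto simp: norm_mult mult_left_le_one_le\<close>)
        have "(LINT \<xi>|lborel. G \<xi> t) = (LINT \<xi>|lborel. complex_of_real (frac_weight s t) * (cis (\<xi> \<bullet> y) * ft \<phi> \<xi>
            - cis (\<xi> \<bullet> y) * complex_of_real (exp (- t * (norm \<xi>)\<^sup>2)) * ft \<phi> \<xi>))"
          by (intro Bochner_Integration.integral_cong refl) (simp add: G_def algebra_simps)
        also have "\<dots> = complex_of_real (frac_weight s t) * ((LINT \<xi>|lborel. cis (\<xi> \<bullet> y) * ft \<phi> \<xi>)
            - (LINT \<xi>|lborel. cis (\<xi> \<bullet> y) * complex_of_real (exp (- t * (norm \<xi>)\<^sup>2)) * ft \<phi> \<xi>))"
          unfolding integral_mult_right_zero using j1 j2 by (subst Bochner_Integration.integral_diff) auto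
        \<comment> \<open>Inversion returns a multiple of \<phi> y, which is 0; only the heat term
          survives.\<close>
        also have "\<dots> = - (complex_of_real (frac_weight s t) * (LINT x|lborel. \<phi> x * complex_of_real (heat t (y - x))))"
          unfolding gauss_ft_eq_heat[OF True test_fun_integrable[OF \<phi>]] Fourier_inversion[OF \<phi>]
          using \<open>\<phi> y = 0\<close> by simp
        also have "\<dots> = (LINT x|lborel. - (\<phi> x * complex_of_real (frac_weight s t * heat t (y - x))))"
          by (simp only: integral_minus integral_mult_right_zero[symmetric] of_real_mult mult_ac)
        finally show ?thesis .
      qed (simp add: G_def frac_weight_def)
    qed
    \<comment> \<open>The distance d is essential for this exchange: at z = 0 the weight times the
      heat kernel is not integrable in t near 0.\<close>
    also have "\<dots> = (LINT x|lborel. LINT t|lborel. - (\<phi> x * complex_of_real (frac_weight s t * heat t (y - x))))"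
    proof (rule Fubini_dominated)
      show "integrable lborel (\<lambda>t. frac_weight s t * heat t (d *\<^sub>R b))"
        using d b by (intro integrable_frac_weight_heat s) auto
      show "integrable lborel (\<lambda>x. cmod (\<phi> x))"
        by (intro integrable_norm test_fun_integrable[OF \<phi>])
      fix t x
      show "cmod (- (\<phi> x * complex_of_real (frac_weight s t * heat t (y - x)))) \<le> frac_weight s t * heat t (d *\<^sub>R b) * cmod (\<phi> x)"
      proof (cases "\<phi> x = 0 \<or> t \<le> 0")
        case False
        then have t: "t > 0" and "d \<le> norm (y - x)" using off by auto
        then have "d\<^sup>2 \<le> (norm (y - x))\<^sup>2" using d by (intro power_mono) auto
        then have "- (norm (y - x))\<^sup>2 / (4 * t) \<le> - (norm (d *\<^sub>R b))\<^sup>2 / (4 * t)"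
          using t b by (intro divide_right_mono) auto
        then have "heat t (y - x) \<le> heat t (d *\<^sub>R b)"
          unfolding heat_def using t by (intro mult_left_mono) auto
        moreover have "0 \<le> heat t (y - x)" using t by (simp add: heat_def)
        ultimately have "\<bar>frac_weight s t * heat t (y - x)\<bar> \<le> frac_weight s t * heat t (d *\<^sub>R b)"
          using frac_weight_nonneg[of s t] by (simp add: abs_mult mult_left_mono)
        then have "\<bar>frac_weight s t * heat t (y - x)\<bar> * cmod (\<phi> x) \<le> frac_weight s t * heat t (d *\<^sub>R b) * cmod (\<phi> x)"
          by (rule mult_right_mono) simp
        then show ?thesis by (simp only: norm_minus_cancel norm_mult norm_of_real mult.commute)
      qed (auto simp: frac_weight_def)
    qed (simp add: heat_def)
    also have "\<dots> = (LINT x|lborel. - (complex_of_real B * (\<phi> x * complex_of_real (norm (y - x) powr (- (DIM('a) + 2 * s))))))"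
    proof (rule Bochner_Integration.integral_cong[OF refl])
      fix x
      show "(LINT t|lborel. - (\<phi> x * complex_of_real (frac_weight s t * heat t (y - x))))
        = - (complex_of_real B * (\<phi> x * complex_of_real (norm (y - x) powr (- (DIM('a) + 2 * s)))))"
      proof (cases "\<phi> x = 0")
        case False
        then have "y - x \<noteq> 0" using off[of x] d by auto
        then show ?thesis
          unfolding integral_minus integral_mult_right_zero integral_complex_of_real
            integral_frac_weight_heat[OF s \<open>y - x \<noteq> 0\<close>] B_def[symmetric]
          by (simp only: of_real_mult mult.left_commute)
      qed simp
    qed
    also have "\<dots> = - (complex_of_real B * (LINT x|lborel. \<phi> x * complex_of_real (norm (y - x) powr (- (DIM('a) + 2 * s)))))"
      by (simp only: integral_minus integral_mult_right_zero)
    finally have "R = - (complex_of_real (B / A) * (LINT x|lborel. \<phi> x * complex_of_real (norm (y - x) powr (- (DIM('a) + 2 * s)))))"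
      using A by (simp add: field_simps)
    then show "frac_lap_test s \<phi> y = - (complex_of_real (B / (A * p)) * (LINT x|lborel. \<phi> x * complex_of_real (norm (y - x) powr (- (DIM('a) + 2 * s)))))"
      by (simp add: frac_lap_test_def ift_def R_def[symmetric] p_def)
  qed
qed


section \<open>Vanishing of Riesz potentials\<close>

text \<open>The degree is explicit because it fixes the power of the norm that accompanies
  \<open>P\<close>. The rule \<open>mult\<close> adds one coordinate factor, which is what one
  derivative of a norm power produces.\<close>

inductive homogeneous :: "nat \<Rightarrow> ('a::euclidean_space \<Rightarrow> real) \<Rightarrow> bool" where
  const: "homogeneous 0 (\<lambda>w. c)"
| mult: "b \<in> Basis \<Longrightarrow> homogeneous m P \<Longrightarrow> homogeneous (Suc m) (\<lambda>w. (w \<bullet> b) * P w)"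
| add: "homogeneous m P \<Longrightarrow> homogeneous m Q \<Longrightarrow> homogeneous m (\<lambda>w. P w + Q w)"

lemma homogeneous_scaleR: "homogeneous m P \<Longrightarrow> P (c *\<^sub>R w) = c ^ m * P w"
  by (induction rule: homogeneous.induct) (auto simp: algebra_simps)

lemma homogeneous_0_const: "homogeneous 0 P \<Longrightarrow> P w = P 0"
  using homogeneous_scaleR[of 0 P 0 w] by simp

lemma homogeneous_cmult: "homogeneous m P \<Longrightarrow> homogeneous m (\<lambda>w. c * P w)"
proof (induction rule: homogeneous.induct)
  case (const d)
  show ?case by (rule homogeneous.const)
next
  case (mult b m P)
  have "homogeneous (Suc m) (\<lambda>w. (w \<bullet> b) * (c * P w))" by (intro homogeneous.mult mult)
  then show ?case by (simp add: mult.left_commute)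
next
  case (add m P Q)
  have "homogeneous m (\<lambda>w. c * P w + c * Q w)" by (intro homogeneous.add add)
  then show ?case by (simp add: distrib_left)
qed

lemma homogeneous_mult: "homogeneous m P \<Longrightarrow> homogeneous k Q \<Longrightarrow> homogeneous (m + k) (\<lambda>w. P w * Q w)"
proof (induction rule: homogeneous.induct)
  case (const c)
  then show ?case by (simp add: homogeneous_cmult)
next
  case (mult b m P)
  have "homogeneous (Suc (m + k)) (\<lambda>w. (w \<bullet> b) * (P w * Q w))" by (intro homogeneous.mult mult)
  then show ?case by (simp add: mult.assoc)
next
  case (add m P P')
  have "homogeneous (m + k) (\<lambda>w. P w * Q w + P' w * Q w)" by (intro homogeneous.add add)
  then show ?case by (simp add: distrib_right)
qed

text \<open>In degree 0 the derivative is zero, which truncated subtraction in \<open>m - 1\<close>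
  would not express; the descent in the degree stops there.\<close>

lemma homogeneous_derivative:
  "homogeneous m P \<Longrightarrow> \<exists>D. (\<forall>w. (P has_derivative D w) (at w)) \<and>
     (\<forall>b\<in>Basis. if m = 0 then \<forall>w. D w b = 0 else homogeneous (m - 1) (\<lambda>w. D w b))"
proof (induction rule: homogeneous.induct)
  case (const c)
  show ?case by (rule exI[of _ "\<lambda>_ _. 0"]) auto
next
  case (mult b m P)
  then obtain D where D: "\<And>w. (P has_derivative D w) (at w)"
      "\<And>c. c \<in> Basis \<Longrightarrow> if m = 0 then \<forall>w. D w c = 0 else homogeneous (m - 1) (\<lambda>w. D w c)" by blast
  have 1: "((\<lambda>w. (w \<bullet> b) * P w) has_derivative (\<lambda>h. (w \<bullet> b) * D w h + (h \<bullet> b) * P w)) (at w)" for w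
    by (rule has_derivative_mult[OF _ D(1)]) (auto intro!: derivative_eq_intros)
  have "homogeneous m (\<lambda>w. (w \<bullet> b) * D w c + (c \<bullet> b) * P w)" if c: "c \<in> Basis" for c
  proof (cases m)
    case 0
    then show ?thesis using D(2)[OF c] homogeneous_cmult[OF mult.hyps(2)] by simp
  next
    case (Suc k)
    then have "homogeneous (Suc k) (\<lambda>w. (w \<bullet> b) * D w c)"
      using D(2)[OF c] by (intro homogeneous.mult mult) simp
    then show ?thesis
      unfolding Suc[symmetric] by (intro homogeneous.add homogeneous_cmult mult)
  qed
  with 1 show ?case by (intro exI[of _ "\<lambda>w h. (w \<bullet> b) * D w h + (h \<bullet> b) * P w"]) simp
next
  case (add m P Q)
  then obtain D E where D: "\<And>w. (P has_derivative D w) (at w)"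
      "\<And>c. c \<in> Basis \<Longrightarrow> if m = 0 then \<forall>w. D w c = 0 else homogeneous (m - 1) (\<lambda>w. D w c)"
    and E: "\<And>w. (Q has_derivative E w) (at w)"
      "\<And>c. c \<in> Basis \<Longrightarrow> if m = 0 then \<forall>w. E w c = 0 else homogeneous (m - 1) (\<lambda>w. E w c)" by blast
  show ?case
    by (rule exI[of _ "\<lambda>w h. D w h + E w h"])
       (use D E in \<open>auto intro!: has_derivative_add homogeneous.add\<close>)
qed

lemma homogeneous_continuous: "homogeneous m P \<Longrightarrow> continuous_on S P"
  using homogeneous_derivative has_derivative_continuous continuous_at_imp_continuous_on by metis

lemma homogeneous_bound: "homogeneous m P \<Longrightarrow> \<exists>C\<ge>0. \<forall>w. \<bar>P w\<bar> \<le> C * norm w ^ m"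
proof (induction rule: homogeneous.induct)
  case (const c)
  show ?case by (rule exI[of _ "\<bar>c\<bar>"]) auto
next
  case (mult b m P)
  then obtain C where C: "C \<ge> 0" "\<And>w. \<bar>P w\<bar> \<le> C * norm w ^ m" by blast
  have "\<bar>(w \<bullet> b) * P w\<bar> \<le> C * norm w ^ Suc m" for w
  proof -
    have "\<bar>w \<bullet> b\<bar> * \<bar>P w\<bar> \<le> norm w * (C * norm w ^ m)"
      using C Basis_le_norm[OF mult.hyps(1)] by (intro mult_mono) auto
    then show ?thesis by (simp add: abs_mult mult.left_commute)
  qed
  then show ?case using C by blast
next
  case (add m P Q)
  then obtain C D where "C \<ge> 0" "D \<ge> 0" "\<And>w. \<bar>P w\<bar> \<le> C * norm w ^ m" "\<And>w. \<bar>Q w\<bar> \<le> D * norm w ^ m"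
    by blast
  then show ?case
    by (intro exI[of _ "C + D"]) (auto simp: distrib_right intro: order.trans[OF abs_triangle_ineq add_mono])
qed

text \<open>These are all real polynomials, presented so that each summand keeps a degree: a
  homogeneous part of degree m is paired with its own norm power.\<close>

inductive homogeneous_sum :: "('a::euclidean_space \<Rightarrow> real) \<Rightarrow> bool" where
  homogeneous: "homogeneous m P \<Longrightarrow> homogeneous_sum P"
| add: "homogeneous_sum P \<Longrightarrow> homogeneous_sum Q \<Longrightarrow> homogeneous_sum (\<lambda>w. P w + Q w)"

lemma homogeneous_sum_mult:
  assumes "homogeneous_sum P" "homogeneous_sum Q"
  shows "homogeneous_sum (\<lambda>w. P w * Q w)"
  using assms
proof (induction arbitrary: Q rule: homogeneous_sum.induct)
  case (homogeneous m P)
  from homogeneous(2) show ?case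
  proof (induction rule: homogeneous_sum.induct)
    case (homogeneous k Q)
    show ?case by (rule homogeneous_sum.homogeneous[OF homogeneous_mult]) fact+
  next
    case (add Q Q')
    have "homogeneous_sum (\<lambda>w. P w * Q w + P w * Q' w)" by (intro homogeneous_sum.add add)
    then show ?case by (simp add: distrib_left)
  qed
next
  case (add P P')
  have "homogeneous_sum (\<lambda>w. P w * Q w + P' w * Q w)" by (intro homogeneous_sum.add add)
  then show ?case by (simp add: distrib_right)
qed

lemma homogeneous_sum_polynomial:
  fixes p :: "'a::euclidean_space \<Rightarrow> real"
  shows "real_polynomial_function p \<Longrightarrow> homogeneous_sum p"
proof (induction rule: real_polynomial_function.induct)
  case (linear f)
  interpret bounded_linear f by fact
  have f: "f w = (\<Sum>b\<in>Basis. (w \<bullet> b) * f b)" for w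
    by (subst euclidean_representation[of w, symmetric]) (simp only: sum scaleR real_scaleR_def)
  have "homogeneous_sum (\<lambda>w. \<Sum>b\<in>B. (w \<bullet> b) * f b)" if "finite B" "B \<subseteq> Basis" for B
    using that
    by (induction B rule: finite_induct)
       (auto intro!: homogeneous_sum.add homogeneous_sum.homogeneous[OF homogeneous.const]
          homogeneous_sum.homogeneous[OF homogeneous.mult[OF _ homogeneous.const]])
  moreover have "f = (\<lambda>w. \<Sum>b\<in>Basis. (w \<bullet> b) * f b)" by (rule ext) (rule f)
  ultimately show ?case using finite_Basis order_refl by metis
next
  case (const c)
  show ?case by (rule homogeneous_sum.homogeneous[OF homogeneous.const])
qed (auto intro: homogeneous_sum.add homogeneous_sum_mult)

lemma has_derivative_norm_powr:
  fixes w :: "'a::euclidean_space" and a :: real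
  assumes w: "w \<noteq> 0"
  shows "((\<lambda>w. norm w powr (- a)) has_derivative (\<lambda>h. - a * norm w powr (- a - 2) * (w \<bullet> h))) (at w)"
proof -
  have "((\<lambda>w. norm w powr (- a)) has_derivative (\<lambda>h. - a * norm w powr (- a - 1) * (h \<bullet> sgn w))) (at w)"
    by (rule has_derivative_compose[OF has_derivative_norm[OF w]
          has_real_derivative_powr[unfolded has_field_derivative_def]]) (use w in simp)
  moreover have "(\<lambda>h. - a * norm w powr (- a - 1) * (h \<bullet> sgn w)) = (\<lambda>h. - a * norm w powr (- a - 2) * (w \<bullet> h))"
  proof (rule ext)
    fix h
    have "norm w powr (- a - 1) = norm w powr (- a - 2) * norm w"
    proof -
      have e: "- a - 1 = (- a - 2) + 1" by simp
      show ?thesis unfolding e powr_add using w by simp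
    qed
    then show "- a * norm w powr (- a - 1) * (h \<bullet> sgn w) = - a * norm w powr (- a - 2) * (w \<bullet> h)"
      using w by (simp add: sgn_div_norm inner_commute)
  qed
  ultimately show ?thesis by (simp only:)
qed

section \<open>Kernels annihilated by v for all x in a small ball\<close>

context
  fixes v :: "'a::euclidean_space \<Rightarrow> complex" and x0 :: 'a and r :: real
  assumes r: "r > 0"
    and v_measurable[measurable]: "v \<in> borel_measurable borel"
    and v_zero: "\<And>y. norm (y - x0) < 2 * r \<Longrightarrow> v y = 0"
    and v_integrable: "integrable lborel (\<lambda>y. cmod (v y) / (1 + norm (y - x0)) ^ DIM('a))"
begin

text \<open>The decay is required only for |w| >= r, because y - x never enters the ball of radius r
  when v y is nonzero and x lies in \<open>ball x0 r\<close>. A singularity at 0 is therefore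
  allowed.\<close>

definition admissible :: "('a \<Rightarrow> real) \<Rightarrow> bool" where
  "admissible K \<longleftrightarrow> K \<in> borel_measurable borel \<and>
     (\<exists>C\<ge>0. \<forall>w. r \<le> norm w \<longrightarrow> \<bar>K w\<bar> \<le> C / norm w ^ DIM('a))"

text \<open>The identity is demanded on a whole open ball so that it can be differentiated in
  x.\<close>

definition annihilates :: "('a \<Rightarrow> real) \<Rightarrow> bool" where
  "annihilates K \<longleftrightarrow> (\<forall>x\<in>ball x0 r. (LINT y|lborel. v y * complex_of_real (K (y - x))) = 0)"

lemma distance_bounds:
  assumes x: "x \<in> ball x0 r" and y: "2 * r \<le> norm (y - x0)"
  shows "r \<le> norm (y - x)" "1 / norm (y - x) ^ k \<le> (2 + 1 / r) ^ k / (1 + norm (y - x0)) ^ k"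
proof -
  have "norm (x - x0) < r" using x by (simp add: dist_norm norm_minus_commute)
  moreover have "norm (y - x0) \<le> norm (y - x) + norm (x - x0)"
    using norm_triangle_ineq[of "y - x" "x - x0"] by simp
  ultimately have w: "r \<le> norm (y - x)" "norm (y - x0) \<le> 2 * norm (y - x)" using y by linarith+
  then show "r \<le> norm (y - x)" by simp
  \<comment> \<open>This and |y - x0| <= 2 |y - x| add up to the constant 2 + 1 / r.\<close>
  have "1 \<le> norm (y - x) / r" using w r by simp
  then have "1 + norm (y - x0) \<le> (2 + 1 / r) * norm (y - x)"
    using w by (simp add: distrib_right)
  then have "(1 + norm (y - x0)) ^ k \<le> ((2 + 1 / r) * norm (y - x)) ^ k"
    by (intro power_mono) auto
  moreover have "0 < norm (y - x) ^ k" "0 < (1 + norm (y - x0)) ^ k"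
    using w r by (auto intro!: zero_less_power add_pos_nonneg)
  moreover have "1 / W \<le> B / A" if "A \<le> B * W" "0 < W" "0 < A" for A B W :: real
    using that by (simp add: field_simps)
  ultimately show "1 / norm (y - x) ^ k \<le> (2 + 1 / r) ^ k / (1 + norm (y - x0)) ^ k"
    unfolding power_mult_distrib by blast
qed

lemma admissible_bound:
  assumes "admissible K"
  obtains C where "C \<ge> 0" "\<And>x y. x \<in> ball x0 r \<Longrightarrow> 2 * r \<le> norm (y - x0) \<Longrightarrow> \<bar>K (y - x)\<bar> \<le> C / (1 + norm (y - x0)) ^ DIM('a)"
proof -
  obtain C where C: "C \<ge> 0" "\<And>w. r \<le> norm w \<Longrightarrow> \<bar>K w\<bar> \<le> C / norm w ^ DIM('a)"
    using assms by (auto simp: admissible_def)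
  show ?thesis
  proof
    show "C * (2 + 1 / r) ^ DIM('a) \<ge> 0" using C r by simp
    fix x y assume xy: "x \<in> ball x0 r" "2 * r \<le> norm (y - x0)"
    have "\<bar>K (y - x)\<bar> \<le> C * (1 / norm (y - x) ^ DIM('a))"
      using C(2)[OF distance_bounds(1)[OF xy]] by simp
    also have "\<dots> \<le> C * ((2 + 1 / r) ^ DIM('a) / (1 + norm (y - x0)) ^ DIM('a))"
      by (intro mult_left_mono distance_bounds(2)[OF xy] C)
    finally show "\<bar>K (y - x)\<bar> \<le> C * (2 + 1 / r) ^ DIM('a) / (1 + norm (y - x0)) ^ DIM('a)" by simp
  qed
qed

text \<open>The majorant is free of x, hence usable for limits in x: continuity of the potential and
  Fubini later rely on it.\<close>

lemma admissible_dominated: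
  assumes "admissible K"
  obtains C where "C \<ge> 0" "\<And>x y. x \<in> ball x0 r \<Longrightarrow>
    cmod (v y * complex_of_real (K (y - x))) \<le> C * (cmod (v y) / (1 + norm (y - x0)) ^ DIM('a))"
proof -
  obtain C where C: "C \<ge> 0" "\<And>x y. x \<in> ball x0 r \<Longrightarrow> 2 * r \<le> norm (y - x0) \<Longrightarrow> \<bar>K (y - x)\<bar> \<le> C / (1 + norm (y - x0)) ^ DIM('a)"
    using admissible_bound[OF assms] by blast
  have "cmod (v y * complex_of_real (K (y - x))) \<le> C * (cmod (v y) / (1 + norm (y - x0)) ^ DIM('a))"
    if x: "x \<in> ball x0 r" for x y
  proof (cases "2 * r \<le> norm (y - x0)")
    case True
    have "cmod (v y) * \<bar>K (y - x)\<bar> \<le> cmod (v y) * (C / (1 + norm (y - x0)) ^ DIM('a))"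
      by (intro mult_left_mono C(2) x True) simp
    then show ?thesis by (simp add: norm_mult mult.commute)
  qed (simp add: v_zero)
  with C(1) show ?thesis by (rule that)
qed

lemma admissible_integrable:
  assumes K: "admissible K" and x: "x \<in> ball x0 r"
  shows "integrable lborel (\<lambda>y. v y * complex_of_real (K (y - x)))"
proof -
  have [measurable]: "K \<in> borel_measurable borel" using K by (simp add: admissible_def)
  obtain C where C: "C \<ge> 0" "\<And>x y. x \<in> ball x0 r \<Longrightarrow>
    cmod (v y * complex_of_real (K (y - x))) \<le> C * (cmod (v y) / (1 + norm (y - x0)) ^ DIM('a))"
    using admissible_dominated[OF K] by blast
  show ?thesis
  proof (rule Bochner_Integration.integrable_bound[OF integrable_mult_right[OF v_integrable, of C]])
    show "AE y in lborel. norm (v y * complex_of_real (K (y - x)))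
        \<le> norm (C * (cmod (v y) / (1 + norm (y - x0)) ^ DIM('a)))"
      unfolding real_norm_def by (intro AE_I2 order.trans[OF C(2)[OF x] abs_ge_self])
  qed simp
qed

lemma admissible_norm_powr:
  fixes a :: real
  assumes "homogeneous m P" "real DIM('a) + real m \<le> a"
  shows "admissible (\<lambda>w. norm w powr (- a) * P w)"
  unfolding admissible_def
proof
  have [measurable]: "P \<in> borel_measurable borel"
    by (intro borel_measurable_continuous_onI homogeneous_continuous[OF assms(1)])
  show "(\<lambda>w. norm w powr (- a) * P w) \<in> borel_measurable borel" by measurable
  obtain C where C: "C \<ge> 0" "\<And>w. \<bar>P w\<bar> \<le> C * norm w ^ m"
    using homogeneous_bound[OF assms(1)] by blast
  \<comment> \<open>The decay beyond |w|^(-n); on |w| >= r it is bounded by r^(-e).\<close>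
  define e where "e = a - m - DIM('a)"
  have e: "e \<ge> 0" using assms(2) by (simp add: e_def)
  have "\<bar>norm w powr (- a) * P w\<bar> \<le> C * r powr (- e) / norm w ^ DIM('a)" if w: "r \<le> norm w" for w :: 'a
  proof -
    have w0: "norm w > 0" using w r by linarith
    have "\<bar>norm w powr (- a) * P w\<bar> \<le> norm w powr (- a) * (C * norm w ^ m)"
      unfolding abs_mult using C by (intro mult_mono) auto
    also have "\<dots> = C * (norm w powr (- a) * norm w powr m)"
      using w0 by (simp add: powr_realpow)
    also have "norm w powr (- a) * norm w powr m = norm w powr (- e) * norm w powr (- real DIM('a))"
      by (simp add: powr_add[symmetric] e_def)
    also have "norm w powr (- real DIM('a)) = 1 / norm w ^ DIM('a)"
      using w0 by (simp add: powr_minus_divide powr_realpow)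
    also have "C * (norm w powr (- e) * (1 / norm w ^ DIM('a))) \<le> C * (r powr (- e) * (1 / norm w ^ DIM('a)))"
      using e r w C by (intro mult_left_mono mult_right_mono powr_mono2') auto
    finally show ?thesis by simp
  qed
  then show "\<exists>C\<ge>0. \<forall>w. r \<le> norm w \<longrightarrow> \<bar>norm w powr (- a) * P w\<bar> \<le> C / norm w ^ DIM('a)"
    using C(1) by (intro exI[of _ "C * r powr (- e)"]) simp
qed

lemma annihilates_add:
  assumes "admissible K" "admissible L" "annihilates K" "annihilates L"
  shows "annihilates (\<lambda>w. K w + L w)"
  unfolding annihilates_def
proof
  fix x assume x: "x \<in> ball x0 r"
  show "(LINT y|lborel. v y * complex_of_real (K (y - x) + L (y - x))) = 0"
    using admissible_integrable[OF assms(1) x] admissible_integrable[OF assms(2) x] assms(3,4) x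
    by (simp add: distrib_left annihilates_def)
qed

lemma annihilates_cmult: "annihilates K \<Longrightarrow> annihilates (\<lambda>w. c * K w)"
  unfolding annihilates_def by (simp add: mult.left_commute)

lemma admissible_cmult:
  assumes "admissible K"
  shows "admissible (\<lambda>w. c * K w)"
proof -
  obtain C where C: "C \<ge> 0" "\<And>w. r \<le> norm w \<Longrightarrow> \<bar>K w\<bar> \<le> C / norm w ^ DIM('a)"
    using assms by (auto simp: admissible_def)
  have "\<bar>c * K w\<bar> \<le> \<bar>c\<bar> * C / norm w ^ DIM('a)" if "r \<le> norm w" for w
    using mult_left_mono[OF C(2)[OF that], of "\<bar>c\<bar>"] by (simp add: abs_mult)
  then show ?thesis
    using assms C(1) unfolding admissible_def by (intro conjI exI[of _ "\<bar>c\<bar> * C"]) auto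
qed

lemma admissible_add:
  assumes "admissible K" "admissible L"
  shows "admissible (\<lambda>w. K w + L w)"
proof -
  obtain C1 C2 where C: "C1 \<ge> 0" "C2 \<ge> 0" "\<And>w. r \<le> norm w \<Longrightarrow> \<bar>K w\<bar> \<le> C1 / norm w ^ DIM('a)"
      "\<And>w. r \<le> norm w \<Longrightarrow> \<bar>L w\<bar> \<le> C2 / norm w ^ DIM('a)"
    using assms by (auto simp: admissible_def)
  have "\<bar>K w + L w\<bar> \<le> (C1 + C2) / norm w ^ DIM('a)" if "r \<le> norm w" for w
    using C(3,4)[OF that] abs_triangle_ineq[of "K w" "L w"] by (simp add: add_divide_distrib)
  then show ?thesis
    using assms C(1,2) unfolding admissible_def by (intro conjI exI[of _ "C1 + C2"]) auto
qed

lemma admissible_zero: "admissible (\<lambda>w. 0)"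
  unfolding admissible_def by (auto intro!: exI[of _ 0])

lemma annihilates_zero: "annihilates (\<lambda>w. 0)"
  by (simp add: annihilates_def)

lemma annihilates_sum:
  "finite I \<Longrightarrow> (\<And>i. i \<in> I \<Longrightarrow> admissible (K i)) \<Longrightarrow> (\<And>i. i \<in> I \<Longrightarrow> annihilates (K i))
    \<Longrightarrow> annihilates (\<lambda>w. \<Sum>i\<in>I. K i w)"
proof -
  assume I: "finite I" "\<And>i. i \<in> I \<Longrightarrow> admissible (K i)" "\<And>i. i \<in> I \<Longrightarrow> annihilates (K i)"
  show ?thesis
    unfolding annihilates_def
  proof
    fix x assume x: "x \<in> ball x0 r"
    have "(LINT y|lborel. v y * complex_of_real (\<Sum>i\<in>I. K i (y - x)))
        = (\<Sum>i\<in>I. LINT y|lborel. v y * complex_of_real (K i (y - x)))"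
      unfolding of_real_sum sum_distrib_left
      by (rule Bochner_Integration.integral_sum) (intro admissible_integrable I x)
    also have "\<dots> = 0"
      using I(3) x by (intro sum.neutral) (auto simp: annihilates_def)
    finally show "(LINT y|lborel. v y * complex_of_real (\<Sum>i\<in>I. K i (y - x))) = 0" .
  qed
qed

text \<open>Difference quotients in x combine the vanishing integrals at two points of the ball, so
  they integrate to zero; dominated convergence gives the derivative.\<close>

lemma annihilates_derivative:
  assumes K: "admissible K" and D: "\<And>w. w \<noteq> 0 \<Longrightarrow> (K has_derivative D w) (at w)"
    and b: "b \<in> Basis" and Db: "admissible (\<lambda>w. D w b)" and zero: "annihilates K"
  shows "annihilates (\<lambda>w. D w b)"
  unfolding annihilates_def
proof
  fix x assume x: "x \<in> ball x0 r"
  have [measurable]: "K \<in> borel_measurable borel" "(\<lambda>w. D w b) \<in> borel_measurable borel"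
    using K Db by (auto simp: admissible_def)
  \<comment> \<open>Half the distance to the sphere keeps all shifted points x + t b inside the
    ball.\<close>
  define \<epsilon> where "\<epsilon> = (r - dist x0 x) / 2"
  have \<epsilon>: "\<epsilon> > 0" using x by (simp add: \<epsilon>_def)
  have x': "x + t *\<^sub>R b \<in> ball x0 r" if "0 \<le> t" "t \<le> \<epsilon>" for t
  proof -
    have "dist x0 (x + t *\<^sub>R b) \<le> dist x0 x + norm (t *\<^sub>R b)"
      using dist_triangle[of x0 "x + t *\<^sub>R b" x] by (simp add: dist_norm)
    also have "\<dots> < r" using that b x by (simp add: \<epsilon>_def)
    finally show ?thesis by simp
  qed
  define h where "h n = \<epsilon> * inverse (real (Suc n))" for n
  have "h \<longlonglongrightarrow> \<epsilon> * 0"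
    unfolding h_def[abs_def] by (intro tendsto_mult tendsto_const LIMSEQ_inverse_real_of_nat)
  then have h: "h \<longlonglongrightarrow> 0" "h n > 0" "h n \<le> \<epsilon>" "h n \<noteq> 0" for n
    using \<epsilon> by (auto simp: h_def field_simps)
  obtain C where C: "C \<ge> 0" "\<And>x y. x \<in> ball x0 r \<Longrightarrow> 2 * r \<le> norm (y - x0) \<Longrightarrow> \<bar>D (y - x) b\<bar> \<le> C / (1 + norm (y - x0)) ^ DIM('a)"
    using admissible_bound[OF Db] by blast
  have neg: "D w (- b) = - D w b" if "w \<noteq> 0" for w
    using linear_neg[OF has_derivative_linear[OF D[OF that]]] .
  define q where "q n y = (1 / h n) *\<^sub>R (K (y - (x + h n *\<^sub>R b)) - K (y - x))" for n y
  have q0: "(LINT y|lborel. v y * complex_of_real (q n y)) = 0" for n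
  proof -
    have xh: "x + h n *\<^sub>R b \<in> ball x0 r" by (intro x' h less_imp_le[OF h(2)])
    have "(LINT y|lborel. v y * complex_of_real (q n y)) = (LINT y|lborel. complex_of_real (1 / h n) *
        (v y * complex_of_real (K (y - (x + h n *\<^sub>R b))) - v y * complex_of_real (K (y - x))))"
      by (intro Bochner_Integration.integral_cong refl) (simp add: q_def diff_divide_distrib right_diff_distrib)
    also have "\<dots> = 0"
      unfolding integral_mult_right_zero
      using admissible_integrable[OF K xh] admissible_integrable[OF K x] zero x xh
      by (subst Bochner_Integration.integral_diff) (auto simp: annihilates_def)
    finally show ?thesis .
  qed
  have nz: "y - x \<noteq> 0" if "2 * r \<le> norm (y - x0)" "x \<in> ball x0 r" for x y
    using distance_bounds(1)[OF that(2,1)] r by auto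
  \<comment> \<open>Moving x along b moves w = y - x along - b, hence the sign.\<close>
  have "(\<lambda>n. LINT y|lborel. v y * complex_of_real (q n y)) \<longlonglongrightarrow> (LINT y|lborel. v y * complex_of_real (- D (y - x) b))"
  proof (rule integral_dominated_convergence[where w = "\<lambda>y. C * (cmod (v y) / (1 + norm (y - x0)) ^ DIM('a))"])
    show "AE y in lborel. (\<lambda>n. v y * complex_of_real (q n y)) \<longlonglongrightarrow> v y * complex_of_real (- D (y - x) b)"
    proof (rule AE_I2)
      fix y
      show "(\<lambda>n. v y * complex_of_real (q n y)) \<longlonglongrightarrow> v y * complex_of_real (- D (y - x) b)"
      proof (cases "2 * r \<le> norm (y - x0)")
        case True
        note y = nz[OF True x]
        have "(\<lambda>n. (1 / h n) *\<^sub>R (K ((y - x) + h n *\<^sub>R (- b)) - K (y - x))) \<longlonglongrightarrow> D (y - x) (- b)"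
          by (rule directional_difference_quotient[OF D[OF y] h(1,4)])
        then have "(\<lambda>n. q n y) \<longlonglongrightarrow> - D (y - x) b"
          unfolding neg[OF y] by (simp add: q_def diff_diff_eq)
        then show ?thesis by (intro tendsto_intros)
      qed (simp add: v_zero)
    qed
    show "integrable lborel (\<lambda>y. C * (cmod (v y) / (1 + norm (y - x0)) ^ DIM('a)))"
      by (intro integrable_mult_right v_integrable)
    show "AE y in lborel. norm (v y * complex_of_real (q n y)) \<le> C * (cmod (v y) / (1 + norm (y - x0)) ^ DIM('a))" for n
    proof (rule AE_I2)
      fix y
      show "norm (v y * complex_of_real (q n y)) \<le> C * (cmod (v y) / (1 + norm (y - x0)) ^ DIM('a))"
      proof (cases "2 * r \<le> norm (y - x0)")
        case True
        have nz': "y - x + t *\<^sub>R (- b) \<noteq> 0" if "0 \<le> t" "t \<le> h n" for t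
          using nz[OF True x'[of t]] that h(3)[of n] by (simp add: algebra_simps)
        obtain t where t: "0 < t" "t < h n"
          "norm (K (y - x + h n *\<^sub>R (- b)) - K (y - x)) \<le> h n * norm (D (y - x + t *\<^sub>R (- b)) (- b))"
          using mean_value_line[of "h n" K D "y - x" "- b"] h(2) D nz' by blast
        have tb: "x + t *\<^sub>R b \<in> ball x0 r" using t h(3)[of n] by (intro x') auto
        have "\<bar>q n y\<bar> = norm (K (y - x + h n *\<^sub>R (- b)) - K (y - x)) / h n"
          using h(2)[of n] by (simp add: q_def abs_mult diff_diff_eq)
        also have "\<dots> \<le> norm (D (y - x + t *\<^sub>R (- b)) (- b))"
          using t(3) h(2)[of n] by (simp add: pos_divide_le_eq mult.commute)
        also have "\<dots> = \<bar>D (y - (x + t *\<^sub>R b)) b\<bar>"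
          using neg[OF nz'[of t]] t by (simp add: diff_diff_eq)
        also have "\<dots> \<le> C / (1 + norm (y - x0)) ^ DIM('a)" by (rule C(2)[OF tb True])
        finally have "cmod (v y) * \<bar>q n y\<bar> \<le> cmod (v y) * (C / (1 + norm (y - x0)) ^ DIM('a))"
          by (rule mult_left_mono) simp
        then show ?thesis by (simp add: norm_mult mult.commute)
      qed (simp add: v_zero)
    qed
  qed (auto simp: q_def)
  then show "(LINT y|lborel. v y * complex_of_real (D (y - x) b)) = 0"
    by (simp add: q0 LIMSEQ_const_iff)
qed

section \<open>From the Riesz kernel to polynomials in w / |w|^2\<close>

context
  fixes \<alpha> :: real
  assumes \<alpha>: "DIM('a) < \<alpha>" and base: "annihilates (\<lambda>w. norm w powr (- \<alpha>))"
begin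

text \<open>The product rule leaves two terms. Once the one with the derivative of \<open>P\<close>
  is known to be annihilated, so is the other, its coefficient - a being nonzero.\<close>

lemma annihilates_norm_powr_derivative:
  fixes a :: real
  assumes P: "homogeneous m P" and a: "real DIM('a) + real m \<le> a" and b: "b \<in> Basis"
    and D: "\<And>w. (P has_derivative D w) (at w)"
    and Da: "admissible (\<lambda>w. norm w powr (- a) * D w b)"
    and zero: "annihilates (\<lambda>w. norm w powr (- a) * P w)" "annihilates (\<lambda>w. norm w powr (- a) * D w b)"
  shows "annihilates (\<lambda>w. norm w powr (- (a + 2)) * ((w \<bullet> b) * P w))"
proof -
  define E where "E w h = norm w powr (- a) * D w h + - a * norm w powr (- a - 2) * (w \<bullet> h) * P w" for w h
  have E: "((\<lambda>w. norm w powr (- a) * P w) has_derivative E w) (at w)" if "w \<noteq> 0" for w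
    unfolding E_def by (rule has_derivative_mult[OF has_derivative_norm_powr[OF that] D])
  have Eb: "E w b = norm w powr (- a) * D w b + (- a) * (norm w powr (- (a + 2)) * ((w \<bullet> b) * P w))" for w
    by (simp add: E_def algebra_simps)
  have adm: "admissible (\<lambda>w. norm w powr (- (a + 2)) * ((w \<bullet> b) * P w))"
    by (rule admissible_norm_powr[OF homogeneous.mult[OF b P]]) (use a in simp)
  have admE: "admissible (\<lambda>w. E w b)"
    unfolding Eb by (intro admissible_add admissible_cmult adm Da)
  have "annihilates (\<lambda>w. E w b)"
    by (rule annihilates_derivative[OF admissible_norm_powr[OF P a] E b admE zero(1)])
  then have "annihilates (\<lambda>w. E w b + (-1) * (norm w powr (- a) * D w b))"
    by (intro annihilates_add admE admissible_cmult Da annihilates_cmult zero(2))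
  then have "annihilates (\<lambda>w. (- (1 / a)) * (E w b + (-1) * (norm w powr (- a) * D w b)))"
    by (rule annihilates_cmult)
  moreover have "a \<noteq> 0" using a DIM_positive[where 'a='a] by linarith
  ultimately show ?thesis by (simp add: Eb)
qed

text \<open>The Laplacian of \<open>|w|^(- a)\<close> is \<open>a (a + 2 - n) |w|^(- a - 2)\<close>, and \<open>a + 2 > n\<close>.\<close>

lemma annihilates_norm_powr: "annihilates (\<lambda>w. norm w powr (- (\<alpha> + 2 * real k)))"
proof (induction k)
  case 0
  then show ?case using base by simp
next
  case (Suc k)
  define a where "a = \<alpha> + 2 * real k"
  have a: "DIM('a) < a" using \<alpha> by (simp add: a_def)
  have h0: "homogeneous 0 (\<lambda>w::'a. 1)" by (rule homogeneous.const)
  have 1: "annihilates (\<lambda>w. norm w powr (- (a + 2)) * ((w \<bullet> b) * 1))" if b: "b \<in> Basis" for b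
  proof (rule annihilates_norm_powr_derivative[OF h0 _ b, where D = "\<lambda>_ _. 0"])
    show "annihilates (\<lambda>w. norm w powr (- a) * 1)" using Suc by (simp add: a_def)
  qed (use a in \<open>auto simp: admissible_zero annihilates_zero\<close>)
  have h1: "homogeneous 1 (\<lambda>w::'a. (w \<bullet> b) * 1)" if "b \<in> Basis" for b
    using homogeneous.mult[OF that h0] by simp
  \<comment> \<open>\<open>E b\<close> is the derivative along b of |w|^(-a-2) (w . b), that is, the
    second derivative of |w|^(-a) divided by - a. Summing over b gives the Laplacian up to this
    factor.\<close>
  define E where "E b w = norm w powr (- (a + 2)) + - (a + 2) * norm w powr (- (a + 2) - 2) * (w \<bullet> b) * (w \<bullet> b)" for b w :: 'a
  have adm: "admissible (\<lambda>w. norm w powr (- (a + 2)) * ((w \<bullet> b) * 1))" if "b \<in> Basis" for b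
    by (rule admissible_norm_powr[OF h1[OF that]]) (use a in simp)
  have admE: "admissible (E b)" and annE: "annihilates (E b)" if b: "b \<in> Basis" for b
  proof -
    have h2: "homogeneous 2 (\<lambda>w::'a. (w \<bullet> b) * ((w \<bullet> b) * 1))"
      using homogeneous.mult[OF b h1[OF b]] by (simp add: numeral_2_eq_2)
    have Eeq: "E b = (\<lambda>w. norm w powr (- (a + 2)) * 1
        + (- (a + 2)) * (norm w powr (- (a + 2 + 2)) * ((w \<bullet> b) * ((w \<bullet> b) * 1))))"
      by (simp add: E_def fun_eq_iff algebra_simps)
    show admE: "admissible (E b)"
      unfolding Eeq
      by (intro admissible_add admissible_cmult admissible_norm_powr[OF h0] admissible_norm_powr[OF h2])
         (use a in auto)
    define D where "D w h = norm w powr (- (a + 2)) * (h \<bullet> b) + - (a + 2) * norm w powr (- (a + 2) - 2) * (w \<bullet> h) * (w \<bullet> b)" for w h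
    have "((\<lambda>w. norm w powr (- (a + 2)) * ((w \<bullet> b) * 1)) has_derivative D w) (at w)" if "w \<noteq> 0" for w
      unfolding D_def mult_1_right
      by (rule has_derivative_mult[OF has_derivative_norm_powr[OF that]]) (auto intro!: derivative_eq_intros)
    moreover have "(\<lambda>w. D w b) = E b"
      using b by (simp add: D_def E_def[abs_def] fun_eq_iff)
    ultimately show "annihilates (E b)"
      using annihilates_derivative[OF adm[OF b], of D b] b admE 1[OF b] by simp
  qed
  have "annihilates (\<lambda>w. \<Sum>b\<in>Basis. E b w)"
    by (intro annihilates_sum admE annE) auto
  moreover have "(\<Sum>b\<in>Basis. E b w) = (DIM('a) - (a + 2)) * norm w powr (- (a + 2))" for w
  proof (cases "w = 0")
    case False
    have "norm w powr (- (a + 2) - 2) * (norm w)\<^sup>2 = norm w powr (- (a + 2))"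
    proof -
      have e: "- (a + 2) = (- (a + 2) - 2) + 2" by simp
      show ?thesis by (subst (2) e, subst powr_add) (use False in simp)
    qed
    moreover have "(\<Sum>b\<in>Basis. E b w) = DIM('a) * norm w powr (- (a + 2)) - (a + 2) * (norm w powr (- (a + 2) - 2) * (norm w)\<^sup>2)"
    proof -
      have "(\<Sum>b\<in>Basis. E b w) = (\<Sum>b\<in>Basis. norm w powr (- (a + 2)) + (- (a + 2) * norm w powr (- (a + 2) - 2)) * (w \<bullet> b)\<^sup>2)"
        by (simp only: E_def power2_eq_square mult.assoc)
      also have "\<dots> = DIM('a) * norm w powr (- (a + 2)) + (- (a + 2) * norm w powr (- (a + 2) - 2)) * (norm w)\<^sup>2"
        by (simp only: sum.distrib sum_distrib_left[symmetric] norm_square_eq_sum_Basis[symmetric] sum_constant)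
      finally show ?thesis by (simp only: mult_minus_left mult.assoc add_uminus_conv_diff)
    qed
    ultimately show ?thesis by (simp add: algebra_simps)
  qed (simp add: E_def)
  ultimately have "annihilates (\<lambda>w. (DIM('a) - (a + 2)) * norm w powr (- (a + 2)))" by simp
  \<comment> \<open>The coefficient n - (a + 2) is negative because a > n, so division by it is
    legitimate.\<close>
  then have "annihilates (\<lambda>w. (1 / (DIM('a) - (a + 2))) * ((DIM('a) - (a + 2)) * norm w powr (- (a + 2))))"
    by (rule annihilates_cmult)
  moreover have "(1 / (DIM('a) - (a + 2))) * ((DIM('a) - (a + 2)) * t) = t" for t :: real
    using a by simp
  moreover have "\<alpha> + 2 * real (Suc k) = a + 2" by (simp add: a_def)
  ultimately show ?case by (simp only:)
qed

text \<open>Strong induction on the degree for all k at once. Passing from degree l to l + 1 leaves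
  a term of degree l - 1 with an unchanged norm power, which is the claim for k + 1 in place of
  k.\<close>

lemma annihilates_homogeneous:
  "homogeneous m P \<Longrightarrow> annihilates (\<lambda>w. norm w powr (- (\<alpha> + 2 * real k + 2 * real m)) * P w)"
proof (induction m arbitrary: P k rule: less_induct)
  case (less m)
  show ?case
  proof (cases m)
    case 0
    then have P0: "P w = P 0" for w using less.prems homogeneous_0_const by blast
    have eq: "norm w powr (- (\<alpha> + 2 * real k + 2 * real m)) * P w = P 0 * norm w powr (- (\<alpha> + 2 * real k))" for w
      using 0 by (subst P0) simp
    show ?thesis
      unfolding eq by (rule annihilates_cmult[OF annihilates_norm_powr])
  next
    case (Suc l)
    \<comment> \<open>A structural induction inside a fixed degree: \<open>P\<close> may be a sum,
      and only summands of the form (w . b) P' reduce to lower degree. The equation for n excludes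
      constants.\<close>
    have "n = Suc l \<Longrightarrow> annihilates (\<lambda>w. norm w powr (- (\<alpha> + 2 * real k + 2 * real n)) * P w)"
      if "homogeneous n P" for n P
      using that
    proof (induction rule: homogeneous.induct)
      case (mult b m' P)
      then have P: "homogeneous l P" by simp
      define a where "a = \<alpha> + 2 * real k + 2 * real l"
      have a: "real DIM('a) + real l \<le> a" using \<alpha> by (simp add: a_def)
      obtain D where D: "\<And>w. (P has_derivative D w) (at w)"
        "\<And>c. c \<in> Basis \<Longrightarrow> if l = 0 then \<forall>w. D w c = 0 else homogeneous (l - 1) (\<lambda>w. D w c)"
        using homogeneous_derivative[OF P] by blast
      have Da: "admissible (\<lambda>w. norm w powr (- a) * D w b) \<and> annihilates (\<lambda>w. norm w powr (- a) * D w b)"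
      proof (cases "l = 0")
        case True
        then show ?thesis using D(2)[OF mult.hyps(1)] admissible_zero annihilates_zero by simp
      next
        case False
        then have h: "homogeneous (l - 1) (\<lambda>w. D w b)" using D(2)[OF mult.hyps(1)] by simp
        have ann: "annihilates (\<lambda>w. norm w powr (- (\<alpha> + 2 * real (k + 1) + 2 * real (l - 1))) * D w b)"
          by (rule less.IH[OF _ h]) (use Suc in simp)
        \<comment> \<open>One degree less is traded for one more in k; l is nonzero here, so the
          subtraction is not truncated.\<close>
        have e: "\<alpha> + 2 * real (k + 1) + 2 * real (l - 1) = a"
          using False by (simp add: a_def of_nat_diff)
        show ?thesis
          using admissible_norm_powr[OF h, of a] a ann[unfolded e] by simp
      qed
      have "annihilates (\<lambda>w. norm w powr (- a) * P w)"
        unfolding a_def by (rule less.IH[OF _ P]) (simp add: Suc)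
      from annihilates_norm_powr_derivative[OF P a mult.hyps(1) D(1) conjunct1[OF Da] this conjunct2[OF Da]]
      show ?case using mult.prems by (simp add: a_def algebra_simps)
    next
      case (add m' P Q)
      have adm: "admissible (\<lambda>w. norm w powr (- (\<alpha> + 2 * real k + 2 * real m')) * F w)" if "homogeneous m' F" for F
        by (rule admissible_norm_powr[OF that]) (use \<alpha> in simp)
      have "annihilates (\<lambda>w. norm w powr (- (\<alpha> + 2 * real k + 2 * real m')) * P w
          + norm w powr (- (\<alpha> + 2 * real k + 2 * real m')) * Q w)"
        using add by (intro annihilates_add adm) auto
      then show ?case by (simp add: distrib_left)
    qed simp
    from this[OF less.prems Suc] show ?thesis .
  qed
qed

section \<open>The Kelvin transform and polynomial approximation\<close>

text \<open>The map from f to the integral of \<open>kelvin f\<close> is a finite complex measure in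
  z = w / |w|^2. For homogeneous P of degree m one has P z = |w|^(-2m) P w, so
  \<open>kelvin P\<close> carries the annihilated kernel with k = 0.\<close>

definition kelvin :: "('a \<Rightarrow> real) \<Rightarrow> 'a \<Rightarrow> complex" where
  "kelvin f y = v y * complex_of_real (norm (y - x0) powr (- \<alpha>) * f ((1 / (norm (y - x0))\<^sup>2) *\<^sub>R (y - x0)))"

lemma kelvin_domain:
  assumes "2 * r \<le> norm w"
  shows "(1 / (norm w)\<^sup>2) *\<^sub>R w \<in> cball 0 (1 / (2 * r))"
proof -
  have "norm w > 0" using assms r by linarith
  then have "norm ((1 / (norm w)\<^sup>2) *\<^sub>R w) = 1 / norm w" by (simp add: power2_eq_square)
  also have "\<dots> \<le> 1 / (2 * r)" using assms r by (intro frac_le) auto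
  finally show ?thesis by simp
qed

lemma integrable_kelvin_weight: "integrable lborel (\<lambda>y. cmod (v y) * norm (y - x0) powr (- \<alpha>))"
proof -
  have "admissible (\<lambda>w. norm w powr (- \<alpha>) * 1)"
    by (rule admissible_norm_powr[OF homogeneous.const]) (use \<alpha> in simp)
  from integrable_norm[OF admissible_integrable[OF this, of x0]] r show ?thesis
    by (simp add: norm_mult)
qed

lemma kelvin_bound:
  assumes "\<And>z. z \<in> cball 0 (1 / (2 * r)) \<Longrightarrow> \<bar>f z\<bar> \<le> C"
  shows "cmod (kelvin f y) \<le> C * (cmod (v y) * norm (y - x0) powr (- \<alpha>))"
proof (cases "2 * r \<le> norm (y - x0)")
  case True
  have "cmod (v y) * norm (y - x0) powr (- \<alpha>) * \<bar>f ((1 / (norm (y - x0))\<^sup>2) *\<^sub>R (y - x0))\<bar>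
      \<le> cmod (v y) * norm (y - x0) powr (- \<alpha>) * C"
    by (intro mult_left_mono assms kelvin_domain[OF True]) auto
  then show ?thesis by (simp add: kelvin_def norm_mult abs_mult mult_ac)
qed (simp add: kelvin_def v_zero)

lemma kelvin_integrable:
  assumes f: "continuous_on (cball 0 (1 / (2 * r))) f"
  shows "integrable lborel (kelvin f)"
proof -
  \<comment> \<open>Continuity is known only on the closed ball. Extension by 0 is measurable, and
    points outside the ball are never seen because v vanishes at the corresponding y.\<close>
  define g where "g z = (if z \<in> cball 0 (1 / (2 * r)) then f z else 0)" for z
  have [measurable]: "g \<in> borel_measurable borel"
    unfolding g_def[abs_def] by (rule borel_measurable_continuous_on_if) (auto intro: f)
  have eq: "kelvin f y = kelvin g y" for y
    using kelvin_domain[of "y - x0"] v_zero[of y] by (cases "2 * r \<le> norm (y - x0)") (auto simp: kelvin_def g_def)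
  have "compact (f ` cball 0 (1 / (2 * r)))"
    by (intro compact_continuous_image f compact_cball)
  then obtain C where "\<And>y. y \<in> f ` cball 0 (1 / (2 * r)) \<Longrightarrow> norm y \<le> C"
    using compact_imp_bounded bounded_iff by metis
  then have C: "\<bar>g z\<bar> \<le> C" if "z \<in> cball 0 (1 / (2 * r))" for z
    using that by (simp add: g_def)
  have "kelvin g \<in> borel_measurable lborel"
    unfolding kelvin_def[abs_def] by measurable
  then have "integrable lborel (kelvin g)"
  proof (rule Bochner_Integration.integrable_bound[OF integrable_mult_right[OF integrable_kelvin_weight, of C]])
    show "AE y in lborel. norm (kelvin g y) \<le> norm (C * (cmod (v y) * norm (y - x0) powr (- \<alpha>)))"
      unfolding real_norm_def by (intro AE_I2 order.trans[OF kelvin_bound abs_ge_self] C)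
  qed
  then show ?thesis using eq by presburger
qed

lemma kelvin_homogeneous_sum:
  "homogeneous_sum p \<Longrightarrow> continuous_on UNIV p \<and> (LINT y|lborel. kelvin p y) = 0"
proof (induction rule: homogeneous_sum.induct)
  case (homogeneous m P)
  have "kelvin P y = v y * complex_of_real (norm (y - x0) powr (- (\<alpha> + 2 * real 0 + 2 * real m)) * P (y - x0))" for y
  proof (cases "y = x0")
    case False
    have "(1 / (norm (y - x0))\<^sup>2) ^ m = norm (y - x0) powr (- (2 * real m))"
      using False by (simp add: powr_minus_divide power_divide powr_realpow[symmetric] powr_powr flip: powr_numeral)
    then show ?thesis
      unfolding kelvin_def homogeneous_scaleR[OF homogeneous] by (simp add: powr_diff powr_minus_divide)
  qed (use v_zero[of x0] r in \<open>simp add: kelvin_def\<close>)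
  \<comment> \<open>Only the centre x = x0 matters from here on; the other points of the ball served
    to take derivatives.\<close>
  moreover have "(LINT y|lborel. v y * complex_of_real (norm (y - x0) powr (- (\<alpha> + 2 * real 0 + 2 * real m)) * P (y - x0))) = 0"
    using annihilates_homogeneous[OF homogeneous, of 0] r unfolding annihilates_def by simp
  ultimately show ?case
    using homogeneous_continuous[OF homogeneous] by simp
next
  case (add P Q)
  have i: "integrable lborel (kelvin P)" "integrable lborel (kelvin Q)"
    using add by (auto intro!: kelvin_integrable intro: continuous_on_subset)
  have "kelvin (\<lambda>w. P w + Q w) y = kelvin P y + kelvin Q y" for y
    by (simp add: kelvin_def algebra_simps)
  then show ?case
    using add i by (auto intro!: continuous_intros)
qed

text \<open>The weighted mass \<open>M\<close> of v is finite, so a uniform polynomial error d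
  changes the integral by at most d M.\<close>

lemma kelvin_continuous:
  assumes f: "continuous_on (cball 0 (1 / (2 * r))) f"
  shows "(LINT y|lborel. kelvin f y) = 0"
proof -
  define M where "M = (LINT y|lborel. cmod (v y) * norm (y - x0) powr (- \<alpha>))"
  have M: "M \<ge> 0" by (simp add: M_def)
  have "cmod (LINT y|lborel. kelvin f y) \<le> 0"
  proof (rule field_le_epsilon)
    fix e :: real assume e: "e > 0"
    define d where "d = e / (1 + M)"
    have d: "d > 0" using e M by (simp add: d_def)
    obtain p where p: "real_polynomial_function p" "\<And>z. z \<in> cball 0 (1 / (2 * r)) \<Longrightarrow> \<bar>f z - p z\<bar> < d"
      using Stone_Weierstrass_real_polynomial_function[OF compact_cball f d] by blast
    have pc: "continuous_on UNIV p" and p0: "(LINT y|lborel. kelvin p y) = 0"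
      using kelvin_homogeneous_sum[OF homogeneous_sum_polynomial[OF p(1)]] by auto
    have ip: "integrable lborel (kelvin p)"
      by (intro kelvin_integrable continuous_on_subset[OF pc]) simp
    have eq: "kelvin f y - kelvin p y = kelvin (\<lambda>z. f z - p z) y" for y
      by (simp add: kelvin_def algebra_simps)
    have "(LINT y|lborel. kelvin f y) = (LINT y|lborel. kelvin f y - kelvin p y)"
      using ip kelvin_integrable[OF f] p0 by simp
    also have "cmod \<dots> \<le> (LINT y|lborel. d * (cmod (v y) * norm (y - x0) powr (- \<alpha>)))"
    proof (rule order.trans[OF integral_norm_bound integral_mono])
      show "integrable lborel (\<lambda>y. cmod (kelvin f y - kelvin p y))"
        by (intro integrable_norm Bochner_Integration.integrable_diff ip kelvin_integrable[OF f])
      show "integrable lborel (\<lambda>y. d * (cmod (v y) * norm (y - x0) powr (- \<alpha>)))"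
        by (intro integrable_mult_right integrable_kelvin_weight)
      show "cmod (kelvin f y - kelvin p y) \<le> d * (cmod (v y) * norm (y - x0) powr (- \<alpha>))" for y
        unfolding eq by (rule kelvin_bound) (rule less_imp_le[OF p(2)])
    qed
    also have "\<dots> = d * M" unfolding M_def by (rule integral_mult_right_zero)
    also have "\<dots> \<le> 0 + e" using e M by (simp add: d_def field_simps)
    finally show "cmod (LINT y|lborel. kelvin f y) \<le> 0 + e" .
  qed
  then show ?thesis by simp
qed

lemma AE_zero_if_annihilates: "AE y in lborel. v y = 0"
proof -
  have main: "integrable lborel (\<lambda>y. v y * \<phi> y) \<and> (LINT y|lborel. v y * \<phi> y) = 0"
    if \<phi>: "test_fun UNIV \<phi>" for \<phi>
  proof -
    \<comment> \<open>\<phi> pulled back by the inversion. Since |z| = 1 / |w|, the factor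
      |z|^(-\<alpha>) cancels the |w|^(-\<alpha>) inside \<open>kelvin\<close>.\<close>
    define F where "F z = (if z = 0 then 0 else complex_of_real (norm z powr (- \<alpha>)) * \<phi> (x0 + (1 / (norm z)\<^sup>2) *\<^sub>R z))" for z
    have F: "continuous_on UNIV F"
    proof -
      \<comment> \<open>Small z correspond to large w, outside the compact support of \<phi>; hence
        \<open>F\<close> vanishes near 0 and is continuous there despite the negative power.\<close>
      obtain R where R: "R > 0" "\<And>y. y \<in> csupport \<phi> \<Longrightarrow> norm (y - x0) \<le> R"
      proof -
        have "bounded (csupport \<phi>)" using test_fun_compact[OF \<phi>] by (rule compact_imp_bounded)
        then obtain B where "B > 0" "csupport \<phi> \<subseteq> ball x0 B"
          using bounded_subset_ballD by blast
        then show ?thesis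
          by (intro that[of B]) (auto simp: dist_norm norm_minus_commute dest!: subsetD)
      qed
      have "continuous_on (- {0}) F"
      proof -
        have "continuous_on (- {0}) (\<lambda>z. complex_of_real (norm z powr (- \<alpha>)) * \<phi> (x0 + (1 / (norm z)\<^sup>2) *\<^sub>R z))"
          by (intro continuous_intros continuous_on_compose2[OF test_fun_continuous[OF \<phi>, of UNIV]]) auto
        then show ?thesis by (rule continuous_on_eq) (simp add: F_def)
      qed
      moreover have "continuous_on (ball 0 (1 / R)) F"
      proof -
        have "F z = 0" if "z \<in> ball 0 (1 / R)" for z
        proof (cases "z = 0")
          case False
          then have "R < 1 / norm z" using that R(1) by (simp add: field_simps)
          moreover have "norm ((x0 + (1 / (norm z)\<^sup>2) *\<^sub>R z) - x0) = 1 / norm z"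
            using False by (simp add: power2_eq_square)
          ultimately have "x0 + (1 / (norm z)\<^sup>2) *\<^sub>R z \<notin> csupport \<phi>"
            using R(2) by fastforce
          then have "\<phi> (x0 + (1 / (norm z)\<^sup>2) *\<^sub>R z) = 0" using in_csupport[of \<phi>] by blast
          then show ?thesis by (simp add: F_def)
        qed (simp add: F_def)
        then show ?thesis by (intro continuous_on_eq[OF continuous_on_const[of _ 0]]) simp
      qed
      ultimately have "continuous_on (- {0} \<union> ball 0 (1 / R)) F"
        by (intro continuous_on_open_Un) auto
      moreover have "- {0} \<union> ball 0 (1 / R) = (UNIV :: 'a set)" using R(1) by auto
      ultimately show ?thesis by (simp only:)
    qed
    then have c: "continuous_on (cball 0 (1 / (2 * r))) (\<lambda>z. Re (F z))" "continuous_on (cball 0 (1 / (2 * r))) (\<lambda>z. Im (F z))"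
      by (auto intro!: continuous_intros intro: continuous_on_subset)
    have "v y * \<phi> y = kelvin (\<lambda>z. Re (F z)) y + \<i> * kelvin (\<lambda>z. Im (F z)) y" for y
    proof (cases "2 * r \<le> norm (y - x0)")
      case True
      then have n: "norm (y - x0) > 0" using r by linarith
      define z where "z = (1 / (norm (y - x0))\<^sup>2) *\<^sub>R (y - x0)"
      have nz: "norm z = 1 / norm (y - x0)" using n by (simp add: z_def power2_eq_square)
      have "z \<noteq> 0" using nz n by auto
      have "(1 / (norm z)\<^sup>2) *\<^sub>R z = y - x0"
        unfolding nz using n by (simp add: z_def power_divide)
      then have "F z = complex_of_real (norm z powr (- \<alpha>)) * \<phi> y"
        using \<open>z \<noteq> 0\<close> by (simp add: F_def)
      moreover have "norm (y - x0) powr (- \<alpha>) * norm z powr (- \<alpha>) = 1"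
        unfolding nz using n by (simp add: powr_divide)
      ultimately have "complex_of_real (norm (y - x0) powr (- \<alpha>)) * F z = \<phi> y"
        by (metis mult.assoc mult_1 of_real_1 of_real_mult)
      moreover have "F z = complex_of_real (Re (F z)) + \<i> * complex_of_real (Im (F z))" by (rule complex_eq)
      ultimately show ?thesis
        unfolding kelvin_def z_def[symmetric] of_real_mult by (metis (no_types, lifting) distrib_left mult.left_commute)
    qed (simp add: kelvin_def v_zero)
    then show ?thesis
      using kelvin_integrable[OF c(1)] kelvin_integrable[OF c(2)] kelvin_continuous[OF c(1)] kelvin_continuous[OF c(2)]
      by simp
  qed
  have "AE y in lborel. y \<in> UNIV \<longrightarrow> v y = 0"
    using main by (intro AE_zero_if_test_integrals_zero) auto
  then show ?thesis by simp
qed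

end

section \<open>From the distributional to the pointwise identity\<close>

text \<open>Fubini turns the weak identity into vanishing of the potential \<open>H\<close> almost
  everywhere in the ball, and continuity of \<open>H\<close> upgrades this to every point.\<close>

lemma annihilates_if_weakly_annihilates:
  assumes K: "admissible K" and cont: "continuous_on (- {0}) K"
    and weak: "\<And>\<phi>. test_fun (ball x0 r) \<phi> \<Longrightarrow>
      (LINT y|lborel. v y * (LINT x|lborel. \<phi> x * complex_of_real (K (y - x)))) = 0"
  shows "annihilates K"
proof -
  have [measurable]: "K \<in> borel_measurable borel" using K by (simp add: admissible_def)
  obtain C where C: "C \<ge> 0" "\<And>x y. x \<in> ball x0 r \<Longrightarrow>
    cmod (v y * complex_of_real (K (y - x))) \<le> C * (cmod (v y) / (1 + norm (y - x0)) ^ DIM('a))"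
    using admissible_dominated[OF K] by blast
  define H where "H x = (LINT y|lborel. v y * complex_of_real (K (y - x)))" for x
  have [measurable]: "H \<in> borel_measurable borel" unfolding H_def[abs_def] by measurable
  have Hcont: "continuous_on (ball x0 r) H"
  proof (clarsimp simp: continuous_on_sequentially)
    fix X x assume X: "\<forall>n. dist x0 (X n) < r" and x: "dist x0 x < r" and lim: "X \<longlonglongrightarrow> x"
    show "(H \<circ> X) \<longlonglongrightarrow> H x"
      unfolding H_def comp_def
    proof (rule integral_dominated_convergence[where w = "\<lambda>y. C * (cmod (v y) / (1 + norm (y - x0)) ^ DIM('a))"])
      show "AE y in lborel. (\<lambda>n. v y * complex_of_real (K (y - X n))) \<longlonglongrightarrow> v y * complex_of_real (K (y - x))"
      proof (rule AE_I2)
        fix y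
        show "(\<lambda>n. v y * complex_of_real (K (y - X n))) \<longlonglongrightarrow> v y * complex_of_real (K (y - x))"
        proof (cases "2 * r \<le> norm (y - x0)")
          case True
          then have "y - x \<noteq> 0" using distance_bounds(1)[of x y] x r by auto
          then have "isCont K (y - x)"
            using cont continuous_on_eq_continuous_at[of "- {0}" K] by (auto simp: open_Compl)
          then show ?thesis
            by (intro tendsto_intros isCont_tendsto_compose[of _ K] lim)
        qed (simp add: v_zero)
      qed
      show "AE y in lborel. norm (v y * complex_of_real (K (y - X n))) \<le> C * (cmod (v y) / (1 + norm (y - x0)) ^ DIM('a))" for n
        using X by (intro AE_I2 C(2)) simp
      show "integrable lborel (\<lambda>y. C * (cmod (v y) / (1 + norm (y - x0)) ^ DIM('a)))"
        by (intro integrable_mult_right v_integrable)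
    qed auto
  qed
  have test: "integrable lborel (\<lambda>x. H x * \<phi> x) \<and> (LINT x|lborel. H x * \<phi> x) = 0"
    if \<phi>: "test_fun (ball x0 r) \<phi>" for \<phi>
  proof -
    have [measurable]: "\<phi> \<in> borel_measurable borel" by (rule test_fun_measurable[OF \<phi>])
    have b: "cmod (\<phi> x * (v y * complex_of_real (K (y - x)))) \<le> cmod (\<phi> x) * (C * (cmod (v y) / (1 + norm (y - x0)) ^ DIM('a)))" for x y
    proof (cases "x \<in> ball x0 r")
      case True
      then show ?thesis unfolding norm_mult[of "\<phi> x"] by (intro mult_left_mono C(2)) auto
    qed (simp add: test_fun_outside[OF \<phi>])
    have i: "integrable lborel (\<lambda>x. cmod (\<phi> x))" "integrable lborel (\<lambda>y. C * (cmod (v y) / (1 + norm (y - x0)) ^ DIM('a)))"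
      by (intro integrable_norm test_fun_integrable[OF \<phi>] integrable_mult_right v_integrable)+
    have "integrable (lborel \<Otimes>\<^sub>M lborel) (\<lambda>(x, y). \<phi> x * (v y * complex_of_real (K (y - x))))"
      by (rule integrable_pair_dominated[OF _ i b]) measurable
    then have 1: "integrable lborel (\<lambda>x. H x * \<phi> x)"
      by (auto dest!: lborel_pair.integrable_fst simp: H_def mult.commute)
    have "(LINT x|lborel. H x * \<phi> x) = (LINT x|lborel. LINT y|lborel. \<phi> x * (v y * complex_of_real (K (y - x))))"
      by (simp add: H_def mult.commute)
    also have "\<dots> = (LINT y|lborel. LINT x|lborel. \<phi> x * (v y * complex_of_real (K (y - x))))"
      by (rule Fubini_dominated[OF _ i b]) measurable
    also have "\<dots> = (LINT y|lborel. v y * (LINT x|lborel. \<phi> x * complex_of_real (K (y - x))))"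
    proof (rule Bochner_Integration.integral_cong[OF refl])
      fix y
      have "(LINT x|lborel. \<phi> x * (v y * complex_of_real (K (y - x)))) = (LINT x|lborel. v y * (\<phi> x * complex_of_real (K (y - x))))"
        by (simp only: mult.left_commute)
      then show "(LINT x|lborel. \<phi> x * (v y * complex_of_real (K (y - x)))) = v y * (LINT x|lborel. \<phi> x * complex_of_real (K (y - x)))"
        by (simp only: integral_mult_right_zero)
    qed
    also have "\<dots> = 0" by (rule weak[OF \<phi>])
    finally show ?thesis using 1 by simp
  qed
  have ae: "AE x in lborel. x \<in> ball x0 r \<longrightarrow> H x = 0"
    using test by (intro AE_zero_if_test_integrals_zero) auto
  \<comment> \<open>The set where \<open>H\<close> is nonzero is open and null, hence empty.\<close>
  have op: "open (ball x0 r \<inter> H -` (- {0}))"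
    by (intro continuous_open_preimage[OF Hcont]) auto
  have "ball x0 r \<inter> H -` (- {0}) \<in> null_sets lborel"
    using ae op by (subst AE_iff_null_sets) (auto elim: eventually_mono)
  then have "negligible (ball x0 r \<inter> H -` (- {0}))"
    by (simp add: negligible_iff_null_sets null_sets_completionI)
  then have "ball x0 r \<inter> H -` (- {0}) = {}"
    using op open_not_negligible by blast
  then show ?thesis
    by (auto simp: annihilates_def H_def)
qed

end

lemma weak_Riesz_unique_continuation:
  fixes v :: "'a::euclidean_space \<Rightarrow> complex" and \<alpha> :: real
  assumes r: "r > 0" and v: "v \<in> borel_measurable borel" and \<alpha>: "DIM('a) < \<alpha>"
    and v_zero: "\<And>y. norm (y - x0) < 2 * r \<Longrightarrow> v y = 0"
    and v_int: "integrable lborel (\<lambda>y. cmod (v y) / (1 + norm (y - x0)) ^ DIM('a))"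
    and weak: "\<And>\<phi>. test_fun (ball x0 r) \<phi> \<Longrightarrow>
      (LINT y|lborel. v y * (LINT x|lborel. \<phi> x * complex_of_real (norm (y - x) powr (- \<alpha>)))) = 0"
  shows "AE y in lborel. v y = 0"
proof (rule AE_zero_if_annihilates[OF r v v_zero v_int \<alpha>])
  show "annihilates v x0 r (\<lambda>w. norm w powr (- \<alpha>))"
  proof (rule annihilates_if_weakly_annihilates[OF r v v_zero v_int _ _ weak])
    show "admissible r (\<lambda>w::'a. norm w powr (- \<alpha>))"
      using admissible_norm_powr[OF r v v_zero v_int homogeneous.const[of 1], of \<alpha>] \<alpha> by simp
    show "continuous_on (- {0}) (\<lambda>w::'a. norm w powr (- \<alpha>))"
      by (intro continuous_intros) auto
  qed
qed

section \<open>Unique continuation\<close>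

lemma frac_lap_unique_continuation:
  fixes u :: "'a::euclidean_space \<Rightarrow> complex" and s r :: real
  assumes s: "0 < s" "s < 1" and r: "r > 0" and u: "L2 u"
    and zero: "AE y in lborel. y \<in> ball x0 (2 * r) \<longrightarrow> u y = 0"
    and weak: "\<And>\<phi>. test_fun (ball x0 r) \<phi> \<Longrightarrow> frac_lap_pair s u \<phi> = 0"
  shows "AE y in lborel. u y = 0"
proof -
  \<comment> \<open>A representative that is zero at every point of the ball, as the potential
    estimates require, and not merely almost everywhere.\<close>
  define v where "v y = (if norm (y - x0) < 2 * r then 0 else u y)" for y
  have [measurable]: "u \<in> borel_measurable borel" using u by (simp add: L2_def)
  have vm[measurable]: "v \<in> borel_measurable borel" unfolding v_def[abs_def] by measurable
  have uv: "AE y in lborel. u y = v y"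
    using zero by eventually_elim (auto simp: v_def dist_norm norm_minus_commute)
  obtain c where c: "c > 0"
    "\<And>U (\<phi> :: 'a \<Rightarrow> complex) y d. test_fun U \<phi> \<Longrightarrow> d > 0 \<Longrightarrow> (\<And>x. \<phi> x \<noteq> 0 \<Longrightarrow> d \<le> norm (y - x)) \<Longrightarrow>
      frac_lap_test s \<phi> y = - (complex_of_real c * (LINT x|lborel. \<phi> x * complex_of_real (norm (y - x) powr (- (DIM('a) + 2 * s)))))"
    using frac_lap_test_off_support[OF s, where 'a='a] by blast
  have "AE y in lborel. v y = 0"
  proof (rule weak_Riesz_unique_continuation[OF r vm, where \<alpha> = "DIM('a) + 2 * s"])
    show "real DIM('a) < DIM('a) + 2 * s" using s by simp
    show "v y = 0" if "norm (y - x0) < 2 * r" for y using that by (simp add: v_def)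
    show "integrable lborel (\<lambda>y. cmod (v y) / (1 + norm (y - x0)) ^ DIM('a))"
    proof (rule Bochner_Integration.integrable_bound)
      have "integrable lborel (\<lambda>y. rho (- x0 + 1 *\<^sub>R y))"
        by (subst integrable_affine_iff) (auto intro: integrable_rho)
      then show "integrable lborel (\<lambda>y. (cmod (u y))\<^sup>2 + rho (y - x0))"
        using u by (simp add: L2_def)
      show "AE y in lborel. norm (cmod (v y) / (1 + norm (y - x0)) ^ DIM('a)) \<le> norm ((cmod (u y))\<^sup>2 + rho (y - x0))"
      proof (rule AE_I2)
        fix y
        define b where "b = 1 / (1 + norm (y - x0)) ^ DIM('a)"
        have b: "b \<ge> 0" "b\<^sup>2 \<le> rho (y - x0)"
          unfolding b_def by (simp, rule one_plus_norm_power_le_rho)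
        have "cmod (v y) * b \<le> cmod (u y) * b"
          using b by (intro mult_right_mono) (auto simp: v_def)
        also have "\<dots> \<le> (cmod (u y))\<^sup>2 + b\<^sup>2"
          using mult_le_sum_squares[of "u y" "complex_of_real b"] b by simp
        also have "\<dots> \<le> norm ((cmod (u y))\<^sup>2 + rho (y - x0))"
          using b by simp
        finally show "norm (cmod (v y) / (1 + norm (y - x0)) ^ DIM('a)) \<le> norm ((cmod (u y))\<^sup>2 + rho (y - x0))"
          by (simp add: b_def)
      qed
    qed measurable
    fix \<phi> :: "'a \<Rightarrow> complex" assume \<phi>: "test_fun (ball x0 r) \<phi>"
    have [measurable]: "ft \<phi> \<in> borel_measurable borel" by (rule ft_measurable[OF \<phi>])
    have [measurable]: "frac_lap_test s \<phi> \<in> borel_measurable borel"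
      unfolding frac_lap_test_def ift_def[abs_def] by measurable
    \<comment> \<open>Where v is nonzero, y is at distance at least 2r from x0, hence at least r
      from the support of \<phi>: the off-support formula applies with d = r.\<close>
    have eq: "v y * frac_lap_test s \<phi> y = - complex_of_real c *
        (v y * (LINT x|lborel. \<phi> x * complex_of_real (norm (y - x) powr (- (DIM('a) + 2 * s)))))" for y
    proof (cases "norm (y - x0) < 2 * r")
      case False
      have "r \<le> norm (y - x)" if "\<phi> x \<noteq> 0" for x
      proof -
        have "x \<in> ball x0 r" using test_fun_outside[OF \<phi>] that by blast
        then show ?thesis
          using False norm_triangle_ineq[of "y - x" "x - x0"] by (simp add: dist_norm norm_minus_commute)
      qed
      then show ?thesis by (simp add: c(2)[OF \<phi> r])
    qed (simp add: v_def)
    have "0 = (LINT y|lborel. u y * frac_lap_test s \<phi> y)"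
      using weak[OF \<phi>] by (simp add: frac_lap_pair_def)
    also have "\<dots> = (LINT y|lborel. v y * frac_lap_test s \<phi> y)"
      by (rule integral_cong_AE) (use uv in \<open>auto elim: eventually_mono\<close>)
    also have "\<dots> = - complex_of_real c *
        (LINT y|lborel. v y * (LINT x|lborel. \<phi> x * complex_of_real (norm (y - x) powr (- (DIM('a) + 2 * s)))))"
      unfolding eq by (rule integral_mult_right_zero)
    finally show "(LINT y|lborel. v y * (LINT x|lborel. \<phi> x * complex_of_real (norm (y - x) powr (- (DIM('a) + 2 * s))))) = 0"
      using c(1) by simp
  qed
  with uv show ?thesis by eventually_elim simp
qed

text \<open>The distance from x to \<Omega> exceeds the propagation strictly, which leaves room for
  an admissible radius in between; the support of u is no closer to x than \<Omega> is.\<close>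

lemma dspt_avoids_exterior_point:
  fixes \<Psi> :: "('a::euclidean_space \<Rightarrow> complex) \<Rightarrow> ('a \<Rightarrow> complex) \<Rightarrow> complex"
  assumes fin: "finite_propagation s \<Psi>" and u: "Hs s u" and \<Omega>: "\<Omega> \<noteq> {}"
    and fspt: "fspt u \<subseteq> closure \<Omega>" and x: "x \<notin> nbhd \<Omega> (propagation s \<Psi>)"
  shows "x \<notin> closure \<Omega>" "x \<notin> dspt (\<Psi> u)"
proof -
  let ?R = "{R. prop_radius s \<Psi> R}"
  have ne: "?R \<noteq> {}" using fin by (auto simp: finite_propagation_def)
  have nonneg: "0 \<le> propagation s \<Psi>"
    unfolding propagation_def by (rule cInf_greatest[OF ne]) (simp add: prop_radius_def)
  have d: "propagation s \<Psi> < infdist x \<Omega>" using x \<Omega> by (simp add: nbhd_def)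
  then have "infdist x \<Omega> > 0" using nonneg by linarith
  then show "x \<notin> closure \<Omega>" using in_closure_iff_infdist_zero[OF \<Omega>] by auto
  \<comment> \<open>Working with such an R avoids the question whether the infimum is itself a
    propagation radius.\<close>
  obtain R where R: "prop_radius s \<Psi> R" "R < infdist x \<Omega>"
    using cInf_lessD[OF ne, of "infdist x \<Omega>"] d by (auto simp: propagation_def)
  \<comment> \<open>Nonemptiness matters: \<open>infdist\<close> to the empty set is 0. In that case
    \<open>nbhd\<close> is empty by definition.\<close>
  have le: "infdist x \<Omega> \<le> infdist x (fspt u)" if "fspt u \<noteq> {}"
    unfolding infdist_notempty[OF that]
  proof (rule cINF_greatest[OF that])
    fix a assume "a \<in> fspt u"
    then have "infdist a \<Omega> = 0" using fspt in_closure_iff_infdist_zero[OF \<Omega>] by auto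
    then show "infdist x \<Omega> \<le> dist x a" using infdist_triangle[of x \<Omega> a] by simp
  qed
  have "x \<notin> nbhd (fspt u) R"
  proof
    assume "x \<in> nbhd (fspt u) R"
    then have "fspt u \<noteq> {}" "infdist x (fspt u) \<le> R" by (simp_all add: nbhd_def)
    with le R(2) show False by fastforce
  qed
  then show "x \<notin> dspt (\<Psi> u)" using R(1) u by (auto simp: prop_radius_def)
qed

theorem theorem4p1:
  fixes s :: real
    and \<Psi> :: "('a::euclidean_space \<Rightarrow> complex) \<Rightarrow> ('a \<Rightarrow> complex) \<Rightarrow> complex"
    and \<Omega> W :: "'a set"
    and u :: "'a \<Rightarrow> complex"
  assumes "0 < s" and "s < 1"
    and "bounded_Hs_Hms s \<Psi>"
    and "finite_propagation s \<Psi>"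
    and "open \<Omega>" and "\<Omega> \<noteq> {}" and "open W" and "W \<noteq> {}"
    and "W \<inter> ext_set (nbhd \<Omega> (propagation s \<Psi>)) \<noteq> {}"
    and "Hs_tilde s \<Omega> u"
    and "\<forall>\<phi>. test_fun W \<phi> \<longrightarrow> frac_lap_pair s u \<phi> + \<Psi> u \<phi> = 0"
  shows "AE x in lborel. u x = 0"
proof -
  have Hs: "Hs s u" using assms(10) by (simp add: Hs_tilde_def)
  then have L2: "L2 u" by (auto simp: Hs_def is_ft_def)
  have zero: "AE y in lborel. y \<in> - closure \<Omega> \<longrightarrow> u y = 0"
    using assms(1,2,10) closure_subset[of \<Omega>] by (intro Hs_tilde_AE_zero[of s \<Omega>]) auto
  then have fspt: "fspt u \<subseteq> closure \<Omega>"
    unfolding fspt_def by (auto intro!: exI[of _ "- closure \<Omega>"])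
  obtain x0 where x0: "x0 \<in> W" "x0 \<notin> nbhd \<Omega> (propagation s \<Psi>)"
    using assms(9) closure_subset by (fastforce simp: ext_set_def)
  note off = dspt_avoids_exterior_point[OF assms(4) Hs assms(6) fspt x0(2)]
  obtain U where U: "open U" "x0 \<in> U" "\<And>\<phi>. test_fun U \<phi> \<Longrightarrow> \<Psi> u \<phi> = 0"
    using off(2) by (auto simp: dspt_def)
  have "open (W \<inter> U \<inter> - closure \<Omega>)" using assms(7) U(1) by auto
  \<comment> \<open>One ball serves three purposes: in W the equation holds, in U the functional
    \<Psi> u vanishes, and off the closure of \<Omega> u itself vanishes.\<close>
  then obtain e where e: "e > 0" "ball x0 e \<subseteq> W \<inter> U \<inter> - closure \<Omega>"
    using x0(1) U(2) off(1) open_contains_ball by (metis ComplI IntI)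
  show ?thesis
  proof (rule frac_lap_unique_continuation[OF assms(1,2) _ L2])
    \<comment> \<open>The radius is halved because u has to vanish on twice the ball in which the
      equation is tested.\<close>
    show "e / 2 > 0" using e by simp
    show "AE y in lborel. y \<in> ball x0 (2 * (e / 2)) \<longrightarrow> u y = 0"
      using zero by eventually_elim (use e(2) in auto)
    fix \<phi> :: "'a \<Rightarrow> complex" assume \<phi>: "test_fun (ball x0 (e / 2)) \<phi>"
    have "ball x0 (e / 2) \<subseteq> ball x0 e" using e(1) by (intro subset_ball) simp
    then have "test_fun W \<phi>" "test_fun U \<phi>"
      using e(2) by (auto intro!: test_fun_mono[OF \<phi>])
    then show "frac_lap_pair s u \<phi> = 0"
      using U(3) assms(11) by force
  qed
qed

end
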